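(* Let $f_0$ be a convex (and decreasing) probability density on $[0,\infty)$, and let $x_0\in(0,\infty)$ with $f_0(x_0)>0$. Assume that there are constants $K_1<0$, $K_2>0$ and $\alpha>1$ such that one of the following holds for every $t$ in a fixed (small) neighborhood of $x_0$: (B) $f_0(t)=f_0(x_0)+K_1(t-x_0)+K_2(t-x_0)^\alpha\,\mathbf 1_{[x_0,\infty)}(t)$; or (C) $f_0(t)=f_0(x_0)+K_1(t-x_0)+K_2(x_0-t)^\alpha\,\mathbf 1_{[0,x_0)}(t)$. Let $\hat f_n$ be the convex least squares estimator based on $n$ i.i.d. observations from $f_0$. Then $$|\hat f_n(x_0)-f_0(x_0)|=O_p\big(n^{-\alpha/(2\alpha+1)}\sqrt{\log\log n}\big).$$ Moreover, $$\min\big(\hat f_n(x_0)-f_0(x_0),0\big)=O_p(n^{-1/2}).$$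
   Context: Let $\mathcal K$ be the convex cone of all non-negative, continuous, convex and integrable functions on $[0,\infty)$. With $\mathbb F_n$ the empirical distribution function of the $n$ observations, the convex LSE is $$\hat f_n=\operatorname*{argmin}_{g\in\mathcal K}\Big(\tfrac12\int_0^\infty g(t)^2dt-\int_0^\infty g(t)\,d\mathbb F_n(t)\Big).$$ *)

theory Defs
  imports "HOL-Probability.Probability"
begin

text \<open>Functions on \<open>[0, \<infinity>)\<close> are functions on \<open>\<real>\<close>
  whose values on \<open>(-\<infinity>, 0)\<close> are irrelevant: every integral below is over \<open>{0..}\<close>.\<close>

definition probability_density_on_nonneg :: "(real \<Rightarrow> real) \<Rightarrow> bool" where
  "probability_density_on_nonneg f \<longleftrightarrow>
     (\<forall>t\<ge>0. 0 \<le> f t) \<and> set_integrable lborel {0..} f \<and> (LINT t:{0..}|lborel. f t) = 1"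

definition convex_cone :: "(real \<Rightarrow> real) set" where
  "convex_cone = {g. (\<forall>t\<ge>0. 0 \<le> g t) \<and> continuous_on {0..} g \<and> convex_on {0..} g \<and>
                     set_integrable lborel {0..} g}"

definition ecdf :: "nat \<Rightarrow> (nat \<Rightarrow> real) \<Rightarrow> real \<Rightarrow> real" where
  "ecdf n x t = real (card {i. i < n \<and> x i \<le> t}) / real n"

text \<open>The integral against \<open>ecdf n x\<close> is a Lebesgue--Stieltjes integral;
  \<open>integral_ecdf\<close> below gives the usual sample mean.\<close>

definition ls_criterion :: "nat \<Rightarrow> (nat \<Rightarrow> real) \<Rightarrow> (real \<Rightarrow> real) \<Rightarrow> real" where
  "ls_criterion n x g =
     1 / 2 * (LINT t:{0..}|lborel. (g t)\<^sup>2) - (LINT t:{0..}|interval_measure (ecdf n x). g t)"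

text \<open>The minimizer is only determined on \<open>[0, \<infinity>)\<close>. It need not exist for the
  exceptional samples containing a point \<open>x i = 0\<close> (the criterion can then be unbounded
  below); \<open>arg_min_on\<close> is arbitrary there, and such samples have probability zero.\<close>

definition convex_lse :: "nat \<Rightarrow> (nat \<Rightarrow> real) \<Rightarrow> real \<Rightarrow> real" where
  "convex_lse n x = arg_min_on (ls_criterion n x) convex_cone"

text \<open>\<open>Z n = O\<^sub>p(r n)\<close>. The exceptional event is bounded in outer probability, i.e.
  through a measurable superset, because \<open>measure\<close> is \<open>0\<close> on non-measurable sets;
  for random variables \<open>Z n\<close> this is the usual notion.\<close>

definition bigO_in_prob :: "'a measure \<Rightarrow> (nat \<Rightarrow> 'a \<Rightarrow> real) \<Rightarrow> (nat \<Rightarrow> real) \<Rightarrow> bool" where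
  "bigO_in_prob M Z r \<longleftrightarrow>
     (\<forall>\<epsilon>>0. \<exists>C>0. \<forall>\<^sub>F n in sequentially.
        \<exists>A\<in>sets M. {\<omega> \<in> space M. \<bar>Z n \<omega>\<bar> > C * r n} \<subseteq> A \<and> measure M A \<le> \<epsilon>)"

lemma interval_measure_ecdf:
  assumes "n > 0"
  shows "interval_measure (ecdf n x) = distr (uniform_count_measure {..<n}) borel x"
proof -
  define N where "N = distr (uniform_count_measure {..<n}) borel x"
  have meas: "x \<in> measurable (uniform_count_measure {..<n}) borel"
    by (simp add: measurable_def sets_uniform_count_measure space_uniform_count_measure)
  interpret U: prob_space "uniform_count_measure {..<n}"
    using assms by (intro prob_space_uniform_count_measure) auto
  interpret N: real_distribution N
    unfolding N_def using meas by (rule U.real_distribution_distr)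
  have cdf: "ecdf n x = cdf N"
  proof
    fix t
    have "cdf N t = measure (uniform_count_measure {..<n}) (x -` {..t} \<inter> {..<n})"
      unfolding cdf_def N_def by (subst measure_distr[OF meas]) (auto simp: space_uniform_count_measure)
    also have "\<dots> = card (x -` {..t} \<inter> {..<n}) / n"
      by (subst measure_uniform_count_measure) auto
    also have "x -` {..t} \<inter> {..<n} = {i. i < n \<and> x i \<le> t}" by auto
    finally show "ecdf n x t = cdf N t" by (simp add: ecdf_def)
  qed
  have "interval_measure (cdf N) = N"
  proof (rule cdf_unique)
    show "real_distribution (interval_measure (cdf N))"
      by (intro real_distribution_interval_measure N.cdf_nondecreasing N.cdf_is_right_cont
          N.cdf_lim_at_bot N.cdf_lim_at_top_prob)
    show "real_distribution N" by unfold_locales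
    show "cdf (interval_measure (cdf N)) = cdf N"
      by (intro cdf_interval_measure N.cdf_nondecreasing N.cdf_is_right_cont N.cdf_lim_at_bot)
  qed
  then show ?thesis by (simp add: cdf N_def)
qed

lemma integral_ecdf:
  assumes "n > 0" and "set_borel_measurable borel {0..} g" and "\<And>i. i < n \<Longrightarrow> x i \<ge> 0"
  shows "(LINT t:{0..}|interval_measure (ecdf n x). g t) = (\<Sum>i<n. g (x i)) / real n"
proof -
  have meas: "x \<in> measurable (uniform_count_measure {..<n}) borel"
    by (simp add: measurable_def sets_uniform_count_measure space_uniform_count_measure)
  have "(LINT t:{0..}|interval_measure (ecdf n x). g t) =
      (LINT i|uniform_count_measure {..<n}. indicator {0..} (x i) *\<^sub>R g (x i))"
    unfolding set_lebesgue_integral_def interval_measure_ecdf[OF assms(1)]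
    using meas assms(2) by (subst integral_distr) (auto simp: set_borel_measurable_def)
  also have "\<dots> = (\<Sum>i<n. g (x i)) / real n"
    using assms(3) by (subst integral_uniform_count_measure) (auto intro!: arg_cong2[where f="(/)"] sum.cong)
  finally show ?thesis .
qed

end

theory Submission
  imports Defs
begin

text \<open>
  Write \<open>D s\<close> for the integral of \<open>max 0 (s - t)\<close> against \<open>f t dt - d\<bbbF>\<^sub>n t\<close>,
  where \<open>f\<close> is the estimator. Optimality gives \<open>D \<ge> 0\<close>, and between zeros of \<open>D\<close>
  (``contacts'') \<open>f\<close> is affine; at a contact the distribution functions of \<open>f\<close> and of the
  sample agree. Hence the twice integrated error \<open>g\<close>, with \<open>g'' = f - f\<^sub>0\<close>, is bounded below by
  minus the empirical noise everywhere, and \<open>g\<close>, \<open>g'\<close> are of the size of the noise at contacts. On an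
  interval between contacts \<open>g''\<close> is concave because \<open>f\<close> is affine and \<open>f\<^sub>0\<close> is convex, so there
  \<open>g\<close> is also bounded above by the noise.

  On the side of \<open>x\<^sub>0\<close> where \<open>f\<^sub>0\<close> is affine, \<open>g''\<close> is convex and \<open>g = O\<^sub>p(n\<^sup>-\<^sup>1\<^sup>/\<^sup>2)\<close>, so
  \<open>f - f\<^sub>0 = O\<^sub>p(n\<^sup>-\<^sup>1\<^sup>/\<^sup>2)\<close> inside, and convexity extrapolates this to a lower bound at \<open>x\<^sub>0\<close>.
  On the other side the curvature of \<open>f\<^sub>0\<close> over a scale \<open>L\<close> forces a contact as soon as
  \<open>L powr (\<alpha> + 2)\<close> exceeds the noise \<open>L powr (3/2) / sqrt n\<close>, that is, within
  \<open>L\<^sub>0 = n powr (-1/(2\<alpha>+1))\<close> up to constants, and a large positive error at \<open>x\<^sub>0\<close> would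
  persist to the contacts at that scale.

  Only scales above \<open>L\<^sub>0\<close> enter, and the bounds have polynomial slack in \<open>L / L\<^sub>0\<close>. So
  chaining with fourth-power tail bounds suffices, and the factor \<open>sqrt (ln (ln n))\<close> is not used.
\<close>

subsection \<open>Second differences\<close>

text \<open>The \<open>g\<close> in use is the twice integrated error minus the first order
  expansion at \<open>x0\<close> of the integrated empirical error. This leaves the second
  derivative unchanged, but at a contact within distance L of \<open>x0\<close> the first derivative
  becomes an increment of the empirical process, of order sqrt (L / n) instead of n powr (-1/2).
  Only the largest scale \<open>Z\<close> sees noise \<open>e\<close> of order n powr (-1/2); the
  bound from the affine side contains \<open>e\<close> alone, whence the faster rate of the negative
  part. An obstacle is that the argument lives between contacts. At the left end 0 is a contact
  because all observations are positive; at the right end a contact at bounded distance beyond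
  \<open>x0\<close> must be produced, by playing the decay of an affine stretch of the estimator
  against the positivity of the true density near \<open>x0\<close>. All constants of the
  deterministic part are fixed before the sample size and the sample, so chance enters only through
  the oscillation of the empirical process around \<open>x0\<close>. The two local forms are
  exchanged by reflection at \<open>x0\<close>. Since the estimator is picked by a choice operator,
  existence of a minimizer has to be proved as well.\<close>

lemma mvt_lower:
  fixes g g' :: "real \<Rightarrow> real"
  assumes "u \<le> v" "continuous_on {u..v} g"
    and "\<And>x. u < x \<Longrightarrow> x < v \<Longrightarrow> (g has_real_derivative g' x) (at x)"
    and "\<And>x. u < x \<Longrightarrow> x < v \<Longrightarrow> c \<le> g' x"
  shows "c * (v - u) \<le> g v - g u"
proof (cases "u = v")
  case False
  then have "u < v" using assms(1) by simp
  then obtain z where z: "u < z" "z < v" "g v - g u = (v - u) * g' z"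
    using MVT[OF \<open>u < v\<close> assms(2)] assms(3)
    by (metis DERIV_unique real_differentiable_def)
  then show ?thesis using assms(4)[OF z(1,2)] \<open>u < v\<close> by (simp add: mult.commute)
qed simp

lemma mvt_point:
  fixes g g' :: "real \<Rightarrow> real"
  assumes "u < v" "continuous_on {u..v} g"
    and "\<And>x. u < x \<Longrightarrow> x < v \<Longrightarrow> (g has_real_derivative g' x) (at x)"
  obtains z where "u < z" "z < v" "g v - g u = (v - u) * g' z"
  using MVT[OF assms(1,2)] assms(3) by (metis DERIV_unique real_differentiable_def)

text \<open>Symmetrize at the midpoint: \<open>g (m + t) + g (m - t) - c * t\<^sup>2\<close> is
  nondecreasing in t, since its derivative compares \<open>g1\<close> at two points at distance 2t.
  The half-length h gives \<open>c * h\<^sup>2\<close>, hence the factor 1/4.\<close>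

lemma second_difference_ge:
  fixes g g1 k :: "real \<Rightarrow> real"
  assumes "u \<le> v" and cg: "continuous_on {u..v} g" and cg1: "continuous_on {u..v} g1"
    and dg: "\<And>x. u < x \<Longrightarrow> x < v \<Longrightarrow> (g has_real_derivative g1 x) (at x)"
    and dg1: "\<And>x. u < x \<Longrightarrow> x < v \<Longrightarrow> (g1 has_real_derivative k x) (at x)"
    and k: "\<And>x. u < x \<Longrightarrow> x < v \<Longrightarrow> c \<le> k x"
  shows "c * (v - u)\<^sup>2 / 4 \<le> g u + g v - 2 * g ((u + v) / 2)"
proof -
  define m h where "m = (u + v) / 2" and "h = (v - u) / 2"
  have u: "u = m - h" and v: "v = m + h" and h: "0 \<le> h" using assms(1) by (auto simp: m_def h_def field_simps)
  define \<phi> where "\<phi> t = g (m + t) + g (m - t) - c * t\<^sup>2" for t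
  have "0 * (h - 0) \<le> \<phi> h - \<phi> 0"
  proof (rule mvt_lower[OF h])
    show "continuous_on {0..h} \<phi>" unfolding \<phi>_def
      by (intro continuous_intros continuous_on_compose2[OF cg]) (auto simp: u v)
    fix t assume t: "0 < t" "t < h"
    show "(\<phi> has_real_derivative g1 (m + t) - g1 (m - t) - 2 * c * t) (at t)"
    proof -
      have "((\<lambda>z. g (m + z)) has_real_derivative g1 (m + t) * 1) (at t)"
        by (rule DERIV_chain2[OF dg]) (use t in \<open>auto intro!: derivative_eq_intros simp: u v\<close>)
      moreover have "((\<lambda>z. g (m - z)) has_real_derivative g1 (m - t) * - 1) (at t)"
        by (rule DERIV_chain2[OF dg]) (use t in \<open>auto intro!: derivative_eq_intros simp: u v\<close>)
      ultimately show ?thesis unfolding \<phi>_def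
        by (auto intro!: derivative_eq_intros)
    qed
    have "c * ((m + t) - (m - t)) \<le> g1 (m + t) - g1 (m - t)"
      by (rule mvt_lower[where g'=k])
        (use t in \<open>auto intro!: dg1 k continuous_on_subset[OF cg1] simp: u v\<close>)
    then show "0 \<le> g1 (m + t) - g1 (m - t) - 2 * c * t" by (simp add: algebra_simps)
  qed
  then have "0 \<le> g v + g u - c * h\<^sup>2 - 2 * g m" by (simp add: \<phi>_def u v)
  moreover have "h\<^sup>2 = (v - u)\<^sup>2 / 4" by (simp add: h_def power_divide)
  ultimately show ?thesis by (simp add: m_def)
qed

text \<open>The standard passage from noise to error: a small function cannot have a second
  derivative that is large throughout an interval. The second difference has total weight 4, which
  turns the 1/4 into 16.\<close>

lemma second_derivative_le_of_bounded:
  fixes g g1 k :: "real \<Rightarrow> real"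
  assumes "u \<le> v" "continuous_on {u..v} g" "continuous_on {u..v} g1"
    and "\<And>x. u < x \<Longrightarrow> x < v \<Longrightarrow> (g has_real_derivative g1 x) (at x)"
    and "\<And>x. u < x \<Longrightarrow> x < v \<Longrightarrow> (g1 has_real_derivative k x) (at x)"
    and "\<And>x. u < x \<Longrightarrow> x < v \<Longrightarrow> c \<le> k x"
    and A: "\<And>x. u \<le> x \<Longrightarrow> x \<le> v \<Longrightarrow> \<bar>g x\<bar> \<le> A"
  shows "c * (v - u)\<^sup>2 \<le> 16 * A"
proof -
  have "c * (v - u)\<^sup>2 / 4 \<le> g u + g v - 2 * g ((u + v) / 2)"
    using assms(1-6) by (rule second_difference_ge)
  moreover have "\<bar>g u\<bar> \<le> A" "\<bar>g v\<bar> \<le> A" "\<bar>g ((u + v) / 2)\<bar> \<le> A"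
    using assms(1) by (auto intro!: A simp: field_simps)
  ultimately show ?thesis by linarith
qed

text \<open>An interior maximum above the bound would force the second derivative to change sign
  in the pattern \<open>+,-,+\<close>, which a concave function cannot do.\<close>

lemma concave_second_derivative_le:
  fixes g g1 k :: "real \<Rightarrow> real"
  assumes uv: "u \<le> v" and cg: "continuous_on {u..v} g" and cg1: "continuous_on {u..v} g1"
    and dg: "\<And>x. u < x \<Longrightarrow> x < v \<Longrightarrow> (g has_real_derivative g1 x) (at x)"
    and dg1: "\<And>x. u < x \<Longrightarrow> x < v \<Longrightarrow> (g1 has_real_derivative k x) (at x)"
    and k: "concave_on {u<..<v} k"
    and A: "g u \<le> A" "g v \<le> A" and B: "\<bar>g1 u\<bar> \<le> B" "\<bar>g1 v\<bar> \<le> B"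
    and t: "u \<le> t" "t \<le> v"
  shows "g t \<le> A + B * (v - u)"
proof (rule ccontr)
  assume c: "\<not> ?thesis"
  have B0: "0 \<le> B" using B by linarith
  obtain s where s: "s \<in> {u..v}" "\<And>y. y \<in> {u..v} \<Longrightarrow> g y \<le> g s"
    using continuous_attains_sup[OF compact_Icc _ cg] uv by fastforce
  have gs: "g s > A + B * (v - u)" using s(2)[of t] t c by simp
  moreover have "0 \<le> B * (v - u)" using B0 uv by simp
  ultimately have "s \<noteq> u" "s \<noteq> v" using A by auto
  with s(1) have us: "u < s" "s < v" by auto
  have g1s: "g1 s = 0"
    by (rule DERIV_local_max[OF dg[OF us], of "min (s - u) (v - s)"])
      (use us in \<open>auto intro!: s(2) simp: abs_if split: if_splits\<close>)
  obtain p where p: "u < p" "p < s" "g s - g u = (s - u) * g1 p"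
    by (rule mvt_point[OF us(1), of g g1]) (use us in \<open>auto intro!: dg continuous_on_subset[OF cg]\<close>)
  have "B * (s - u) \<le> B * (v - u)" using us B0 by (intro mult_left_mono) auto
  then have "(s - u) * B < (s - u) * g1 p" using p(3) gs A by (simp add: mult.commute)
  then have p1: "B < g1 p" using us by simp
  obtain r where r: "s < r" "r < v" "g v - g s = (v - s) * g1 r"
    by (rule mvt_point[OF us(2), of g g1]) (use us in \<open>auto intro!: dg continuous_on_subset[OF cg]\<close>)
  have "B * (v - s) \<le> B * (v - u)" using us B0 by (intro mult_left_mono) auto
  then have "(v - s) * g1 r < (v - s) * (- B)" using r(3) gs A by (simp add: mult.commute)
  then have r1: "g1 r < - B" using us by (metis diff_gt_0_iff_gt mult_less_cancel_left_pos)
  obtain a where a: "u < a" "a < p" "g1 p - g1 u = (p - u) * k a"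
    by (rule mvt_point[OF p(1), of g1 k]) (use us p in \<open>auto intro!: dg1 continuous_on_subset[OF cg1]\<close>)
  have ka: "k a > 0" using a p p1 B by (smt (verit) zero_less_mult_pos)
  obtain b where b: "p < b" "b < s" "g1 s - g1 p = (s - p) * k b"
    by (rule mvt_point[OF p(2), of g1 k]) (use us p in \<open>auto intro!: dg1 continuous_on_subset[OF cg1]\<close>)
  have kb: "k b < 0" using b p p1 B0 g1s by (smt (verit) mult_nonneg_nonneg)
  obtain e where e: "r < e" "e < v" "g1 v - g1 r = (v - r) * k e"
    by (rule mvt_point[OF r(2), of g1 k]) (use us r in \<open>auto intro!: dg1 continuous_on_subset[OF cg1]\<close>)
  have ke: "k e > 0" using e r r1 B by (smt (verit) zero_less_mult_pos)
  have "concave_on {a..e} k"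
    using k a e p r us unfolding concave_on_def by (elim convex_on_subset) auto
  then have "min (k a) (k e) \<le> k b" by (rule concave_on_ge_min) (use a b e r p us in auto)
  then show False using ka kb ke by simp
qed

subsection \<open>Curves with contact points\<close>

text \<open>Strict convexity of the power gives positivity, compactness a uniform bound. The window
  and the step 1/16 keep all arguments between 5/8 and 7/8, thus inside the upper half of the unit
  interval.\<close>

lemma powr_second_difference_bound:
  fixes \<alpha> :: real
  assumes "1 < \<alpha>"
  obtains q where "0 < q"
    "\<And>x. 11/16 \<le> x \<Longrightarrow> x \<le> 13/16 \<Longrightarrow> q \<le> (x + 1/16) powr \<alpha> + (x - 1/16) powr \<alpha> - 2 * x powr \<alpha>"
proof -
  define f :: "real \<Rightarrow> real" where "f x = (x + 1/16) powr \<alpha> + (x - 1/16) powr \<alpha> - 2 * x powr \<alpha>" for x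
  have pos: "0 < f x" if x: "11/16 \<le> x" "x \<le> 13/16" for x
  proof -
    have D: "((\<lambda>y. y powr \<alpha>) has_real_derivative \<alpha> * z powr (\<alpha> - 1)) (at z)" if "0 < z" for z
      using that by (auto intro!: derivative_eq_intros)
    have C: "continuous_on {u..v} (\<lambda>y. y powr \<alpha>)" if "0 < u" for u v
      using that by (auto intro!: continuous_intros)
    obtain z1 where z1: "x - 1/16 < z1" "z1 < x"
      "x powr \<alpha> - (x - 1/16) powr \<alpha> = (x - (x - 1/16)) * (\<alpha> * z1 powr (\<alpha> - 1))"
      by (rule mvt_point[of "x - 1/16" x "\<lambda>y. y powr \<alpha>" "\<lambda>z. \<alpha> * z powr (\<alpha> - 1)"])
        (use x in \<open>auto intro!: D C\<close>)
    obtain z2 where z2: "x < z2" "z2 < x + 1/16"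
      "(x + 1/16) powr \<alpha> - x powr \<alpha> = ((x + 1/16) - x) * (\<alpha> * z2 powr (\<alpha> - 1))"
      by (rule mvt_point[of x "x + 1/16" "\<lambda>y. y powr \<alpha>" "\<lambda>z. \<alpha> * z powr (\<alpha> - 1)"])
        (use x in \<open>auto intro!: D C\<close>)
    have "z1 powr (\<alpha> - 1) < z2 powr (\<alpha> - 1)"
      using z1 z2 x assms by (intro powr_less_mono2) auto
    then have "\<alpha> * z1 powr (\<alpha> - 1) < \<alpha> * z2 powr (\<alpha> - 1)" using assms by simp
    then show ?thesis using z1(3) z2(3) by (simp add: f_def)
  qed
  have "continuous_on {11/16..13/16} f"
    unfolding f_def by (intro continuous_intros) auto
  then obtain x where x: "x \<in> {11/16..13/16}" "\<And>y. y \<in> {11/16..13/16} \<Longrightarrow> f x \<le> f y"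
    using continuous_attains_inf[of "{11/16..13/16::real}" f] by auto
  show ?thesis
    by (rule that[of "f x"]) (use x pos in \<open>auto simp: f_def\<close>)
qed

text \<open>The unknown affine part p + r x of the second derivative is removed by \<open>e\<close>,
  minus the second difference with step S/16, which commutes with differentiation. Of the power
  there remains, by homogeneity, at least \<open>K * q * S powr \<alpha>\<close>. Since |e g| is at
  most 4A on an interval of length S/8, the constant is 64 * 64 = 4096.\<close>

lemma powr_curvature_le_of_bounded:
  fixes g g1 k :: "real \<Rightarrow> real"
  assumes q: "\<And>x. 11/16 \<le> x \<Longrightarrow> x \<le> 13/16 \<Longrightarrow> q \<le> (x + 1/16) powr \<alpha> + (x - 1/16) powr \<alpha> - 2 * x powr \<alpha>"
    and S: "0 < S" and K: "0 \<le> K"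
    and cg: "continuous_on {S/2..S} g" and cg1: "continuous_on {S/2..S} g1"
    and dg: "\<And>x. S/2 < x \<Longrightarrow> x < S \<Longrightarrow> (g has_real_derivative g1 x) (at x)"
    and dg1: "\<And>x. S/2 < x \<Longrightarrow> x < S \<Longrightarrow> (g1 has_real_derivative k x) (at x)"
    and k: "\<And>x. S/2 < x \<Longrightarrow> x < S \<Longrightarrow> k x = p + r * x - K * x powr \<alpha>"
    and A: "\<And>x. S/2 \<le> x \<Longrightarrow> x \<le> S \<Longrightarrow> \<bar>g x\<bar> \<le> A"
  shows "K * q * S powr \<alpha> * S\<^sup>2 \<le> 4096 * A"
proof -
  define h u v where "h = S/16" and "u = 11 * S / 16" and "v = 13 * S / 16"
  define e where "e f t = 2 * f t - (f (t + h) + f (t - h))" for f :: "real \<Rightarrow> real" and t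
  have hb: "S/2 < t - h" "t + h < S" "S/2 < t" "t < S" if "u \<le> t" "t \<le> v" for t
    using that S by (auto simp: h_def u_def v_def)
  have ce: "continuous_on {u..v} (e f)" if "continuous_on {S/2..S} f" for f
    unfolding e_def using hb S
    by (intro continuous_intros continuous_on_compose2[OF that]) (auto simp: h_def u_def v_def)
  have de: "(e f has_real_derivative e f' t) (at t)"
    if f: "\<And>x. S/2 < x \<Longrightarrow> x < S \<Longrightarrow> (f has_real_derivative f' x) (at x)" and t: "u < t" "t < v" for f f' t
  proof -
    have "((\<lambda>z. f (z + h)) has_real_derivative f' (t + h) * 1) (at t)"
      by (rule DERIV_chain2[OF f]) (use t hb[of t] S in \<open>auto intro!: derivative_eq_intros simp: h_def\<close>)
    moreover have "((\<lambda>z. f (z - h)) has_real_derivative f' (t - h) * 1) (at t)"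
      by (rule DERIV_chain2[OF f]) (use t hb[of t] S in \<open>auto intro!: derivative_eq_intros simp: h_def\<close>)
    ultimately show ?thesis unfolding e_def using t hb[of t]
      by (auto intro!: derivative_eq_intros f)
  qed
  have "K * q * S powr \<alpha> * (v - u)\<^sup>2 \<le> 16 * (4 * A)"
  proof (rule second_derivative_le_of_bounded[OF _ ce[OF cg] ce[OF cg1] de[OF dg] de[OF dg1]])
    show "u \<le> v" using S by (simp add: u_def v_def)
    fix x assume x: "u < x" "x < v"
    define y where "y = x / S"
    have xy: "x = S * y" using S by (simp add: y_def)
    have y: "11/16 \<le> y" "y \<le> 13/16" using x S by (auto simp: y_def u_def v_def field_simps)
    have "e k x = K * ((x + h) powr \<alpha> + (x - h) powr \<alpha> - 2 * x powr \<alpha>)"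
      using hb[of x] x S by (simp add: e_def k h_def algebra_simps)
    also have "x + h = S * (y + 1/16)" by (simp add: xy h_def algebra_simps)
    also have "x - h = S * (y - 1/16)" by (simp add: xy h_def algebra_simps)
    also have "(S * (y + 1/16)) powr \<alpha> = S powr \<alpha> * (y + 1/16) powr \<alpha>" by (rule powr_mult)
    also have "(S * (y - 1/16)) powr \<alpha> = S powr \<alpha> * (y - 1/16) powr \<alpha>" by (rule powr_mult)
    also have "x powr \<alpha> = S powr \<alpha> * y powr \<alpha>" unfolding xy by (rule powr_mult)
    finally have "e k x = K * (S powr \<alpha> * ((y + 1/16) powr \<alpha> + (y - 1/16) powr \<alpha> - 2 * y powr \<alpha>))"
      by (simp add: algebra_simps)
    moreover have "K * (S powr \<alpha> * q) \<le> \<dots>"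
      using q[OF y] K by (intro mult_left_mono) auto
    ultimately show "K * q * S powr \<alpha> \<le> e k x" by (simp add: mult_ac)
  next
    fix x assume x: "u \<le> x" "x \<le> v"
    have "\<bar>g x\<bar> \<le> A" "\<bar>g (x + h)\<bar> \<le> A" "\<bar>g (x - h)\<bar> \<le> A"
      using hb[OF x] S by (auto intro!: A simp: h_def)
    then show "\<bar>e g x\<bar> \<le> 4 * A" unfolding e_def by linarith
  qed auto
  moreover have "(v - u)\<^sup>2 = S\<^sup>2 / 64" by (simp add: u_def v_def power2_eq_square)
  ultimately show ?thesis by simp
qed

text \<open>The points with value below f s form an interval that misses s, so they lie on one side
  of s only.\<close>

lemma convex_one_sided_lower:
  fixes f :: "real \<Rightarrow> real"
  assumes "convex_on {u..v} f" "u \<le> s - h" "s + h \<le> v"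
  shows "(\<forall>x\<in>{s - h..s}. f s \<le> f x) \<or> (\<forall>x\<in>{s..s + h}. f s \<le> f x)"
proof (rule ccontr)
  assume "\<not> ?thesis"
  then obtain x y where x: "x \<in> {s - h..s}" "f x < f s" and y: "y \<in> {s..s + h}" "f y < f s"
    by (auto simp: not_le)
  have "convex_on {x..y} f"
    using assms x y by (elim convex_on_subset) auto
  then have "f s \<le> max (f x) (f y)" by (rule convex_on_le_max) (use x y in auto)
  then show False using x y by simp
qed

lemma compact_gap_around:
  fixes T :: "real set"
  assumes "compact T" "p \<in> T" "q \<in> T" "p \<le> s" "s \<le> q"
  obtains \<tau> \<tau>' where "\<tau> \<in> T" "\<tau>' \<in> T" "\<tau> \<le> s" "s \<le> \<tau>'" "{\<tau><..<\<tau>'} \<inter> T = {}"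
proof -
  have "compact (T \<inter> {..s})" "compact (T \<inter> {s..})"
    using assms(1) by (auto intro!: compact_Int_closed)
  moreover have "T \<inter> {..s} \<noteq> {}" "T \<inter> {s..} \<noteq> {}" using assms by auto
  ultimately obtain \<tau> \<tau>' where t: "\<tau> \<in> T" "\<tau> \<le> s" "\<And>y. y \<in> T \<Longrightarrow> y \<le> s \<Longrightarrow> y \<le> \<tau>"
    and t': "\<tau>' \<in> T" "s \<le> \<tau>'" "\<And>y. y \<in> T \<Longrightarrow> s \<le> y \<Longrightarrow> \<tau>' \<le> y"
    using compact_attains_sup[of "T \<inter> {..s}"] compact_attains_inf[of "T \<inter> {s..}"] by auto
  show ?thesis
  proof (rule that[OF t(1) t'(1) t(2) t'(2)])
    show "{\<tau><..<\<tau>'} \<inter> T = {}"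
      using t(3) t'(3) by (metis Int_iff equals0I greaterThanLessThan_iff linorder_le_cases not_le)
  qed
qed

lemma convex_on_eqI:
  assumes "convex_on S f" "\<And>x. x \<in> S \<Longrightarrow> f x = h x"
  shows "convex_on S h"
proof (rule convex_onI)
  show c: "convex S" using assms(1) by (rule convex_on_imp_convex)
  fix t :: real and x y assume t: "0 < t" "t < 1" and xy: "x \<in> S" "y \<in> S"
  then have "(1 - t) *\<^sub>R x + t *\<^sub>R y \<in> S" using c by (simp add: convex_def)
  then show "h ((1 - t) *\<^sub>R x + t *\<^sub>R y) \<le> (1 - t) * h x + t * h y"
    using convex_onD[OF assms(1), of t x y] t xy assms(2) by auto
qed

lemma convex_on_affine:
  fixes p r :: real
  assumes "convex S"
  shows "convex_on S (\<lambda>s. p + r * s)"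
proof (rule convex_onI[OF _ assms])
  fix t x y :: real
  show "p + r * ((1 - t) *\<^sub>R x + t *\<^sub>R y) \<le> (1 - t) * (p + r * x) + t * (p + r * y)"
    by (simp add: algebra_simps)
qed

text \<open>Abstract picture around \<open>x0\<close>, moved to the origin: \<open>T\<close> holds
  the contacts, \<open>d\<close> and \<open>m\<close> are estimator and truth after subtracting the
  same line, and \<open>g\<close> is the twice integrated difference. The line does not affect
  \<open>d - m\<close>, convexity or affine pieces; it is chosen later so that \<open>m\<close>
  vanishes on one side of 0 and \<open>d 0\<close> is the error at \<open>x0\<close>.\<close>

locale contact_curve =
  fixes a b :: real and T :: "real set" and d m g g1 :: "real \<Rightarrow> real"
  assumes ab: "0 < a" "0 < b"
    and T: "compact T" "T \<subseteq> {-a..b}" "-a \<in> T" "b \<in> T"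
    and d_convex: "convex_on {-a..b} d" and m_convex: "convex_on {-a<..<b} m"
    and d_affine: "\<And>\<tau> \<tau>'. \<tau> \<in> T \<Longrightarrow> \<tau>' \<in> T \<Longrightarrow> {\<tau><..<\<tau>'} \<inter> T = {} \<Longrightarrow>
      \<exists>p r. \<forall>s\<in>{\<tau>..\<tau>'}. d s = p + r * s"
    and cont_g: "continuous_on {-a..b} g" and cont_g1: "continuous_on {-a..b} g1"
    and deriv_g: "\<And>x. -a < x \<Longrightarrow> x < b \<Longrightarrow> (g has_real_derivative g1 x) (at x)"
    and deriv_g1: "\<And>x. -a < x \<Longrightarrow> x < b \<Longrightarrow> (g1 has_real_derivative d x - m x) (at x)"
begin

text \<open>\<open>N\<close> is the size of the derivative and \<open>L * N\<close> that of the
  function at scale \<open>L\<close>. The two-sided bounds are required at contacts only; elsewhere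
  there is just the lower bound that follows from nonnegativity of the gap function.\<close>

definition noise :: "real \<Rightarrow> real \<Rightarrow> bool" where
  "noise L N \<longleftrightarrow> (\<forall>s\<in>T. \<bar>s\<bar> \<le> L \<longrightarrow> \<bar>g s\<bar> \<le> L * N \<and> \<bar>g1 s\<bar> \<le> N) \<and>
     (\<forall>s\<in>{-a..b}. \<bar>s\<bar> \<le> L \<longrightarrow> -(L * N) \<le> g s)"

lemma gap_around:
  assumes "-a \<le> s" "s \<le> b"
  obtains \<tau> \<tau>' where "\<tau> \<in> T" "\<tau>' \<in> T" "\<tau> \<le> s" "s \<le> \<tau>'" "{\<tau><..<\<tau>'} \<inter> T = {}"
  using compact_gap_around[OF T(1,3,4) assms] that by blast

lemma restrict_curve:
  assumes "-a \<le> u" "v \<le> b"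
  shows "continuous_on {u..v} g" "continuous_on {u..v} g1"
    "\<And>x. u < x \<Longrightarrow> x < v \<Longrightarrow> (g has_real_derivative g1 x) (at x)"
    "\<And>x. u < x \<Longrightarrow> x < v \<Longrightarrow> (g1 has_real_derivative d x - m x) (at x)"
  using assms by (auto intro!: deriv_g deriv_g1 continuous_on_subset[OF cont_g] continuous_on_subset[OF cont_g1])

lemma noise_nonneg:
  assumes "noise L N" "\<tau> \<in> T" "\<bar>\<tau>\<bar> \<le> L"
  shows "0 \<le> N"
  using assms unfolding noise_def by (meson abs_ge_zero order_trans)

text \<open>The factor 3 is 1 from the value of \<open>g\<close> at the ends of the gap plus 2 from
  the slope bound \<open>N\<close> times the length of the gap, which is at most 2L.\<close>

lemma noise_gap:
  assumes n: "noise L N" and t: "\<tau> \<in> T" "\<tau>' \<in> T" "{\<tau><..<\<tau>'} \<inter> T = {}" "-L \<le> \<tau>" "\<tau>' \<le> L"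
    and s: "\<tau> \<le> s" "s \<le> \<tau>'"
  shows "\<bar>g s\<bar> \<le> 3 * L * N"
proof -
  have tb: "-a \<le> \<tau>" "\<tau>' \<le> b" using t T by auto
  have N: "0 \<le> N" using noise_nonneg[OF n t(1)] t s by auto
  have L: "0 \<le> L" using t s by linarith
  obtain p r where pr: "\<And>s. s \<in> {\<tau>..\<tau>'} \<Longrightarrow> d s = p + r * s" using d_affine[OF t(1,2,3)] by blast
  have "convex_on {\<tau><..<\<tau>'} (\<lambda>s. m s + (- p + (- r) * s))"
    using tb by (intro convex_on_add convex_on_subset[OF m_convex] convex_on_affine) auto
  then have "concave_on {\<tau><..<\<tau>'} (\<lambda>s. d s - m s)"
    unfolding concave_on_def
    by (rule convex_on_eqI) (auto simp: pr)
  moreover have "\<tau> \<le> \<tau>'" using s by simp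
  moreover have "\<bar>g \<tau>\<bar> \<le> L * N" "\<bar>g \<tau>'\<bar> \<le> L * N" "\<bar>g1 \<tau>\<bar> \<le> N" "\<bar>g1 \<tau>'\<bar> \<le> N"
    using n t s by (auto simp: noise_def)
  ultimately have "g s \<le> L * N + N * (\<tau>' - \<tau>)"
    using restrict_curve[OF tb] s
    by (intro concave_second_derivative_le[of \<tau> \<tau>' g g1 "\<lambda>s. d s - m s"]) (auto simp: abs_le_iff)
  also have "N * (\<tau>' - \<tau>) \<le> N * (2 * L)" using t N by (intro mult_left_mono) auto
  finally have "g s \<le> 3 * L * N" by simp
  moreover have "-(L * N) \<le> g s" using n t s tb by (auto simp: noise_def)
  moreover have "0 \<le> L * N" using L N by simp
  ultimately show ?thesis by simp
qed

lemma noise_whole: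
  assumes "noise L N" "a \<le> L" "b \<le> L" "-a \<le> s" "s \<le> b"
  shows "\<bar>g s\<bar> \<le> 3 * L * N"
proof -
  obtain \<tau> \<tau>' where t: "\<tau> \<in> T" "\<tau>' \<in> T" "\<tau> \<le> s" "s \<le> \<tau>'" "{\<tau><..<\<tau>'} \<inter> T = {}"
    using gap_around[OF assms(4,5)] by blast
  show ?thesis
    by (rule noise_gap[OF assms(1) t(1,2,5)]) (use t T(2) assms in auto)
qed

section \<open>The side of the origin on which the truth is affine\<close>

context
  fixes \<delta> A :: real
  assumes del: "0 < \<delta>" "\<delta> \<le> a" and m0: "\<And>s. -\<delta> < s \<Longrightarrow> s < 0 \<Longrightarrow> m s = 0"
    and A: "\<And>s. -\<delta> \<le> s \<Longrightarrow> s \<le> 0 \<Longrightarrow> \<bar>g s\<bar> \<le> A"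
begin

text \<open>Here \<open>d\<close> itself is the second derivative of \<open>g\<close>. By convexity
  it stays above d s on one of the two adjacent intervals of length delta/8, and a bounded
  \<open>g\<close> allows this only if d s is small.\<close>

lemma linear_zone_upper:
  assumes s: "-7 * \<delta> / 8 \<le> s" "s \<le> -\<delta> / 8"
  shows "d s \<le> 1024 * A / \<delta>\<^sup>2"
proof -
  have "convex_on {-\<delta>..0} d" using ab del by (intro convex_on_subset[OF d_convex]) auto
  then consider "\<forall>x\<in>{s - \<delta>/8..s}. d s \<le> d x" | "\<forall>x\<in>{s..s + \<delta>/8}. d s \<le> d x"
    using convex_one_sided_lower[of "-\<delta>" 0 d s "\<delta>/8"] s by fastforce
  then obtain u where u: "-\<delta> \<le> u" "u + \<delta>/8 \<le> 0" "\<forall>x\<in>{u..u + \<delta>/8}. d s \<le> d x"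
  proof cases
    case 1 then show ?thesis using that[of "s - \<delta>/8"] s by auto
  next
    case 2 then show ?thesis using that[of s] s del by auto
  qed
  have uv: "-a \<le> u" "u + \<delta>/8 \<le> b" using u ab del by auto
  have "d s * ((u + \<delta>/8) - u)\<^sup>2 \<le> 16 * A"
    by (rule second_derivative_le_of_bounded[OF _ restrict_curve[OF uv]])
      (use u del in \<open>auto simp: m0 intro!: A\<close>)
  then show ?thesis using del by (simp add: field_simps power2_eq_square)
qed

text \<open>With P the upper bound already known, a value d s < -3P would, by interpolation with the
  values at most P at s - 2h and s + 2h, force d <= (d s + P)/2 on the whole of [s - h, s + h]. The
  second difference bound for -g on this interval of length delta/8 excludes that.\<close>

lemma linear_zone_lower:
  assumes s: "-3 * \<delta> / 4 \<le> s" "s \<le> -\<delta> / 4"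
  shows "-(3 * (1024 * A / \<delta>\<^sup>2)) \<le> d s"
proof (rule ccontr)
  define P where "P = 1024 * A / \<delta>\<^sup>2"
  assume "\<not> ?thesis"
  then have ds: "d s < - (3 * P)" by (simp add: P_def)
  have A0: "0 \<le> A" using A[of 0] del by (smt (verit) abs_ge_zero)
  have P0: "0 \<le> P" using A0 del by (simp add: P_def)
  define h where "h = \<delta> / 16"
  have h: "0 < h" using del by (simp add: h_def)
  have near: "d x \<le> (d s + P) / 2" if x: "s - h \<le> x" "x \<le> s + h" for x
  proof (cases "x \<le> s")
    case True
    have "convex_on {s - 2*h..s} d"
      using s ab del by (intro convex_on_subset[OF d_convex]) (auto simp: h_def)
    then have "d x \<le> (d (s - 2*h) - d s) / (s - (s - 2*h)) * (s - x) + d s"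
      by (rule convex_onD_Icc'') (use x True h in auto)
    also have "(d (s - 2*h) - d s) / (s - (s - 2*h)) * (s - x) \<le> (P - d s) / (2*h) * (s - x)"
      using linear_zone_upper[of "s - 2*h"] s h True
      by (simp, intro mult_right_mono divide_right_mono) (auto simp: P_def h_def)
    also have "\<dots> \<le> (P - d s) / (2*h) * h"
      using ds P0 h x True by (intro mult_left_mono divide_nonneg_nonneg) auto
    also have "(P - d s) / (2*h) * h = (P - d s) / 2" using h by simp
    finally show ?thesis by (simp add: field_simps)
  next
    case False
    have "convex_on {s..s + 2*h} d"
      using s ab del by (intro convex_on_subset[OF d_convex]) (auto simp: h_def)
    then have "d x \<le> (d (s + 2*h) - d s) / (s + 2*h - s) * (x - s) + d s"
      by (rule convex_onD_Icc') (use x False h in auto)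
    also have "(d (s + 2*h) - d s) / (s + 2*h - s) * (x - s) \<le> (P - d s) / (2*h) * (x - s)"
      using linear_zone_upper[of "s + 2*h"] s h False
      by (simp, intro mult_right_mono divide_right_mono) (auto simp: P_def h_def)
    also have "\<dots> \<le> (P - d s) / (2*h) * h"
      using ds P0 h x False by (intro mult_left_mono divide_nonneg_nonneg) auto
    also have "(P - d s) / (2*h) * h = (P - d s) / 2" using h by simp
    finally show ?thesis by (simp add: field_simps)
  qed
  have uv: "-a \<le> s - h" "s + h \<le> b" using s h ab del by (auto simp: h_def)
  let ?g = "\<lambda>x. - g x" and ?g1 = "\<lambda>x. - g1 x" and ?k = "\<lambda>x. - (d x - m x)"
  have "(- (d s + P) / 2) * ((s + h) - (s - h))\<^sup>2 \<le> 16 * A"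
  proof (rule second_derivative_le_of_bounded[of "s - h" "s + h" ?g ?g1 ?k])
    show "continuous_on {s - h..s + h} ?g" "continuous_on {s - h..s + h} ?g1"
      using restrict_curve[OF uv] by (auto intro!: continuous_intros)
    fix x assume x: "s - h < x" "x < s + h"
    show "(?g has_real_derivative ?g1 x) (at x)" "(?g1 has_real_derivative ?k x) (at x)"
      by (rule DERIV_minus[OF restrict_curve(3)[OF uv x]] DERIV_minus[OF restrict_curve(4)[OF uv x]])+
    show "- (d s + P) / 2 \<le> ?k x"
      using near[of x] m0[of x] x s del by (simp add: h_def)
  next
    fix x assume x: "s - h \<le> x" "x \<le> s + h"
    show "\<bar>?g x\<bar> \<le> A" using A[of x] x s del by (simp add: h_def)
  qed (use h in auto)
  moreover have "((s + h) - (s - h))\<^sup>2 = \<delta>\<^sup>2 / 64" by (simp add: h_def power2_eq_square)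
  ultimately have "(- (d s + P) / 2) * (\<delta>\<^sup>2 / 64) \<le> 16 * A" by (simp only:)
  then have "- (d s + P) * \<delta>\<^sup>2 \<le> 2 * 1024 * A" by (simp add: field_simps)
  then have "- (d s + P) \<le> 2 * P" using del by (simp add: P_def field_simps)
  then show False using ds by simp
qed

text \<open>A convex function lies above the continuation of its chords. The chord from
  \<open>y1\<close> to \<open>y2\<close> is prolonged by at most half its length, and it descends by
  at most 4P from a value of at least -3P at \<open>y2\<close>: together -5P. At t = 0 this is the
  lower bound for the error.\<close>

lemma linear_zone_extrapolate:
  assumes t: "-\<delta> / 4 \<le> t" "t \<le> 0"
  shows "-(5 * (1024 * A / \<delta>\<^sup>2)) \<le> d t"
proof -
  define P where "P = 1024 * A / \<delta>\<^sup>2"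
  define y1 y2 where "y1 = -3 * \<delta> / 4" and "y2 = -\<delta> / 4"
  have A0: "0 \<le> A" using A[of 0] del by (smt (verit) abs_ge_zero)
  have P0: "0 \<le> P" using A0 del by (simp add: P_def)
  have d1: "d y1 \<le> P" unfolding P_def by (rule linear_zone_upper) (use del in \<open>auto simp: y1_def\<close>)
  have d2: "- (3 * P) \<le> d y2" unfolding P_def by (rule linear_zone_lower) (use del in \<open>auto simp: y2_def\<close>)
  have "convex_on {y1..t} d"
    using ab del t by (intro convex_on_subset[OF d_convex]) (auto simp: y1_def)
  then have "d y2 \<le> (d t - d y1) / (t - y1) * (y2 - y1) + d y1"
    by (rule convex_onD_Icc') (use t del in \<open>auto simp: y1_def y2_def\<close>)
  moreover have "0 < t - y1" using t del by (simp add: y1_def)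
  ultimately have "(d y2 - d y1) * (t - y1) \<le> (d t - d y1) * (y2 - y1)"
    by (simp add: field_simps)
  moreover have "y2 - y1 = \<delta> / 2" by (simp add: y1_def y2_def)
  ultimately have *: "(d y2 - d y1) * (t - y1) * 2 \<le> (d t - d y1) * \<delta>" by simp
  define w where "w = (t - y2) * 2 / \<delta>"
  have w: "0 \<le> w" "w \<le> 1/2" "(t - y1) * 2 = (1 + w) * \<delta>"
    using t del by (auto simp: w_def y1_def y2_def field_simps)
  have "(d y2 - d y1) * (1 + w) \<le> d t - d y1"
    using * w(3) del by (metis mult.assoc mult_le_cancel_right_pos)
  then have "d y2 + w * (d y2 - d y1) \<le> d t" by (simp add: algebra_simps)
  moreover have "w * (- (4 * P)) \<le> w * (d y2 - d y1)" using w d1 d2 by (intro mult_left_mono) auto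
  moreover have "w * P \<le> 1/2 * P" using w P0 by (intro mult_right_mono) auto
  ultimately have "- (5 * P) \<le> d t" using d2 by simp
  then show ?thesis by (simp add: P_def)
qed

end

end

text \<open>With 1/n = \<open>L0 powr (2 * \<alpha> + 1)\<close> the order sqrt (L / n) of the
  empirical increments equals \<open>L0 powr (\<alpha> + 1) * (L / L0) powr (1/2)\<close>. The
  additional exponent 1/4 pays for holding the bound at all scales at once.\<close>

definition scale_noise :: "real \<Rightarrow> real \<Rightarrow> real \<Rightarrow> real \<Rightarrow> real" where
  "scale_noise \<kappa> \<alpha> L0 L = \<kappa> * L0 powr (\<alpha> + 1) * (L / L0) powr (3/4)"

text \<open>The multiple of \<open>L0\<close> that results from solving the inequality in
  \<open>wide_gap_bound\<close>; 12288 is 3 * 4096. The maximum with 1 also covers gaps that end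
  before \<open>L0\<close>.\<close>

definition gap_const :: "real \<Rightarrow> real \<Rightarrow> real \<Rightarrow> real \<Rightarrow> real \<Rightarrow> real \<Rightarrow> real" where
  "gap_const \<alpha> K \<delta> Z \<kappa> q = max 1 (12288 * \<kappa> / (K * q) * (Z / \<delta>) powr (\<alpha> + 2))"

text \<open>A cruder bound, linear in L, with which the scale cancels from inequalities between c *
  L^2 and L times the noise.\<close>

lemma scale_noise_le:
  assumes "0 \<le> \<kappa>" "0 < L0" "L0 \<le> L"
  shows "scale_noise \<kappa> \<alpha> L0 L \<le> \<kappa> * L0 powr \<alpha> * L"
proof -
  have "(L / L0) powr (3/4) \<le> (L / L0) powr 1"
    using assms by (intro powr_mono) auto
  also have "\<dots> = L / L0" using assms by simp
  finally have "scale_noise \<kappa> \<alpha> L0 L \<le> \<kappa> * L0 powr (\<alpha> + 1) * (L / L0)"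
    unfolding scale_noise_def using assms by (intro mult_left_mono) auto
  then show ?thesis using assms by (simp add: powr_add)
qed

section \<open>The curved side: distance to the next contact and upper bound for the error\<close>

context contact_curve
begin

context
  fixes \<alpha> K \<delta> Z \<kappa> L0 q :: real
  assumes par: "1 < \<alpha>" "0 < K" "0 < \<delta>" "\<delta> \<le> a" "\<delta> \<le> b" "a \<le> Z" "b \<le> Z" "0 < \<kappa>" "0 < L0" "0 < q"
    and q: "\<And>x. 11/16 \<le> x \<Longrightarrow> x \<le> 13/16 \<Longrightarrow> q \<le> (x + 1/16) powr \<alpha> + (x - 1/16) powr \<alpha> - 2 * x powr \<alpha>"
    and m_left: "\<And>s. -\<delta> < s \<Longrightarrow> s < 0 \<Longrightarrow> m s = 0"
    and m_right: "\<And>s. 0 < s \<Longrightarrow> s < \<delta> \<Longrightarrow> m s = K * s powr \<alpha>"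
    and noise: "\<And>L. L0 \<le> L \<Longrightarrow> L \<le> Z \<Longrightarrow> noise L (scale_noise \<kappa> \<alpha> L0 L)"
begin

text \<open>The gap contains [S'/2, S'], where \<open>d\<close> is affine and \<open>m\<close> is
  the power, so the curvature bound applies with the noise at scale \<open>\<tau>'\<close>. In the
  variable x = \<open>\<tau>' / L0\<close> the curvature grows like x powr (alpha + 2), the noise
  only like x powr (7/4); hence x is bounded.\<close>

lemma wide_gap_bound:
  assumes t: "\<tau> \<in> T" "\<tau>' \<in> T" "{\<tau><..<\<tau>'} \<inter> T = {}"
    and S: "L0 \<le> \<tau>'" "- \<tau>' \<le> \<tau>" "\<tau> \<le> min \<tau>' \<delta> / 2"
  shows "\<tau>' \<le> gap_const \<alpha> K \<delta> Z \<kappa> q * L0"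
proof -
  define S' where "S' = min \<tau>' \<delta>"
  define x where "x = \<tau>' / L0"
  define N where "N = scale_noise \<kappa> \<alpha> L0 \<tau>'"
  have tb: "-a \<le> \<tau>" "\<tau>' \<le> b" using t T by auto
  have S': "0 < S'" "S' \<le> \<tau>'" "S' \<le> \<delta>" "\<tau> \<le> S' / 2" using S par by (auto simp: S'_def)
  have x: "1 \<le> x" "\<tau>' = L0 * x" using S par by (auto simp: x_def)
  have nz: "noise \<tau>' N" unfolding N_def using S tb par by (intro noise) auto
  obtain p r where pr: "\<And>s. s \<in> {\<tau>..\<tau>'} \<Longrightarrow> d s = p + r * s" using d_affine[OF t(1,2,3)] by blast
  have uv: "-a \<le> S'/2" "S' \<le> b" using S' tb ab by auto
  have "K * q * S' powr \<alpha> * S'\<^sup>2 \<le> 4096 * (3 * \<tau>' * N)"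
  proof (rule powr_curvature_le_of_bounded[OF q S'(1) _ restrict_curve[OF uv]])
    fix s assume s: "S'/2 < s" "s < S'"
    show "d s - m s = p + r * s - K * s powr \<alpha>"
      using s S' by (subst pr, simp, subst m_right) auto
  next
    fix s assume s: "S'/2 \<le> s" "s \<le> S'"
    show "\<bar>g s\<bar> \<le> 3 * \<tau>' * N"
      by (rule noise_gap[OF nz t]) (use s S' S in auto)
  qed (use par in auto)
  also have "S' powr \<alpha> * S'\<^sup>2 = S' powr (\<alpha> + 2)"
    using S' by (simp add: powr_add)
  then have "K * q * S' powr \<alpha> * S'\<^sup>2 = K * q * S' powr (\<alpha> + 2)" by simp
  finally have 1: "K * q * S' powr (\<alpha> + 2) \<le> 12288 * \<tau>' * N" by simp
  \<comment> \<open>Covers both cases of the minimum: a gap that leaves the zone of known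
    \<open>m\<close> is cut at delta, which costs at most the factor delta / Z.\<close>
  have "\<delta> / Z * \<tau>' \<le> S'"
    unfolding S'_def using par tb S by (auto simp: field_simps intro!: mult_mono)
  then have "(\<delta> / Z * \<tau>') powr (\<alpha> + 2) \<le> S' powr (\<alpha> + 2)"
    using par S by (intro powr_mono2) auto
  moreover have "(\<delta> / Z * \<tau>') powr (\<alpha> + 2) = (\<delta> / Z) powr (\<alpha> + 2) * L0 powr (\<alpha> + 2) * x powr (\<alpha> + 2)"
    unfolding x(2) by (simp only: powr_mult mult.assoc)
  ultimately have "K * q * ((\<delta> / Z) powr (\<alpha> + 2) * L0 powr (\<alpha> + 2) * x powr (\<alpha> + 2)) \<le> 12288 * \<tau>' * N"
    using 1 par by (smt (verit) mult_left_mono mult_pos_pos)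
  moreover have "\<tau>' * N = \<kappa> * (L0 powr (\<alpha> + 2)) * x powr (7/4)"
  proof -
    have "\<alpha> + 2 = 1 + (\<alpha> + 1)" by simp
    then have "L0 powr (\<alpha> + 2) = L0 powr 1 * L0 powr (\<alpha> + 1)" by (simp only: powr_add)
    moreover have "x powr (7/4) = x powr 1 * x powr (3/4)" by (simp only: powr_add[symmetric]) simp
    ultimately show ?thesis unfolding N_def scale_noise_def using x par by simp
  qed
  ultimately have "L0 powr (\<alpha> + 2) * (K * q * (\<delta> / Z) powr (\<alpha> + 2) * x powr (\<alpha> + 2))
      \<le> L0 powr (\<alpha> + 2) * (12288 * \<kappa> * x powr (7/4))" by (simp add: mult_ac)
  then have "K * q * (\<delta> / Z) powr (\<alpha> + 2) * x powr (\<alpha> + 2) \<le> 12288 * \<kappa> * x powr (7/4)"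
    using par by simp
  moreover have "x powr (\<alpha> + 2) = x powr (\<alpha> + 1/4) * x powr (7/4)"
    by (simp flip: powr_add add: add.commute)
  ultimately have "K * q * (\<delta> / Z) powr (\<alpha> + 2) * x powr (\<alpha> + 1/4) \<le> 12288 * \<kappa>"
    using x by (simp add: mult.assoc[symmetric])
  \<comment> \<open>The exponents differ by alpha + 2 - 7/4, which exceeds 1, so the bound may be
    made linear in x.\<close>
  moreover have "x powr 1 \<le> x powr (\<alpha> + 1/4)" using x par by (intro powr_mono) auto
  ultimately have "K * q * (\<delta> / Z) powr (\<alpha> + 2) * x \<le> 12288 * \<kappa>"
    using x par by (smt (verit) mult_left_mono mult_pos_pos powr_gt_zero powr_one zero_less_divide_iff)
  moreover have "(\<delta> / Z) powr (\<alpha> + 2) = 1 / (Z / \<delta>) powr (\<alpha> + 2)"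
    using par by (simp add: powr_divide)
  ultimately have "x \<le> 12288 * \<kappa> / (K * q) * (Z / \<delta>) powr (\<alpha> + 2)"
    using par by (simp add: field_simps)
  then have "x * L0 \<le> gap_const \<alpha> K \<delta> Z \<kappa> q * L0"
    unfolding gap_const_def using par by (intro mult_right_mono) auto
  then show ?thesis using x by (simp add: mult.commute)
qed

text \<open>A large c = d 0 persists to the right, because \<open>d\<close> is small at -delta/4 and
  convex. Contacts near the origin are then forced on both sides of an interval of length comparable
  to \<open>L0\<close> on which the second derivative of \<open>g\<close> is at least c/2, and the
  noise at contacts does not permit this. The three terms in the constant exclude, in this order:
  loss of c to the curvature of \<open>m\<close>, a long gap to the left, and curvature between two
  contacts on the right.\<close>

lemma error_upper_bound:
  fixes e :: real
  defines "C3 \<equiv> 5 * gap_const \<alpha> K \<delta> Z \<kappa> q"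
    and "P \<equiv> 3072 * Z * e / \<delta>\<^sup>2"
  assumes e: "noise Z e" and small: "C3 * L0 < \<delta>"
  shows "d 0 \<le> 10 * P + (2 * K * C3 powr \<alpha> + 768 * (4 * Z / \<delta>)\<^sup>2 * \<kappa> + 512 * \<kappa>) * L0 powr \<alpha>"
proof (rule ccontr)
  define c where "c = d 0"
  define r where "r = L0 powr \<alpha>"
  define C2 where "C2 = gap_const \<alpha> K \<delta> Z \<kappa> q"
  have C2: "1 \<le> C2" "C3 = 5 * C2" by (auto simp: C2_def C3_def gap_const_def)
  have r: "0 < r" using par by (simp add: r_def)
  have Z: "0 < Z" using par by linarith
  have eZ: "\<bar>g s\<bar> \<le> 3 * Z * e" if "-\<delta> \<le> s" "s \<le> 0" for s
    by (rule noise_whole[OF e]) (use that par in auto)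
  have P: "P = 1024 * (3 * Z * e) / \<delta>\<^sup>2" by (simp add: P_def)
  have P0: "0 \<le> P" unfolding P using eZ[of 0] par by (smt (verit) abs_ge_zero divide_nonneg_nonneg zero_le_power2)
  assume "\<not> ?thesis"
  then have "10 * P + (2 * K * C3 powr \<alpha> + 768 * (4 * Z / \<delta>)\<^sup>2 * \<kappa> + 512 * \<kappa>) * r < c"
    by (simp add: c_def r_def)
  moreover have "0 \<le> 2 * K * C3 powr \<alpha> * r" "0 \<le> 768 * (4 * Z / \<delta>)\<^sup>2 * \<kappa> * r" "0 \<le> 512 * \<kappa> * r"
    using par r by auto
  ultimately have cP: "10 * P < c" and c1: "2 * K * C3 powr \<alpha> * r < c"
    and c2: "768 * (4 * Z / \<delta>)\<^sup>2 * \<kappa> * r < c" and c3: "512 * \<kappa> * r < c"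
    using P0 unfolding distrib_right by linarith+
  have c0: "0 < c" using cP P0 by simp
  note zone = linear_zone_upper[OF par(3,4) m_left eZ, folded P]
    linear_zone_extrapolate[OF par(3,4) m_left eZ, folded P]
  \<comment> \<open>The value at 0 is at most the larger of the values at -delta/4 and at s, and the
    former is too small.\<close>
  have right: "c \<le> d s" if s: "0 \<le> s" "s \<le> b" for s
  proof -
    have "convex_on {-\<delta>/4..s} d"
      using par ab s by (intro convex_on_subset[OF d_convex]) auto
    then have "c \<le> max (d (-\<delta>/4)) (d s)"
      unfolding c_def by (rule convex_on_le_max) (use s par in auto)
    moreover have "d (-\<delta>/4) \<le> P" by (rule zone(1)) (use par in auto)
    ultimately show ?thesis using cP P0 by linarith
  qed
  obtain \<tau>1 \<tau>2 where t: "\<tau>1 \<in> T" "\<tau>2 \<in> T" "\<tau>1 \<le> 0" "0 \<le> \<tau>2" "{\<tau>1<..<\<tau>2} \<inter> T = {}"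
    using gap_around[of 0] ab by auto
  have tb: "-a \<le> \<tau>1" "\<tau>2 \<le> b" using t T by auto
  \<comment> \<open>The gap around 0 is handled at the scale of its longer arm. If the left arm
    dominates, the affine zone yields a contradiction; otherwise the gap ends before
    \<open>L0\<close> or is a wide gap on the curved side.\<close>
  have "\<tau>2 \<le> C2 * L0"
  proof (cases "\<tau>2 \<le> - \<tau>1 \<and> L0 \<le> - \<tau>1")
    case True
    define D where "D = - \<tau>1"
    define D' where "D' = min D (\<delta> / 4)"
    define N where "N = scale_noise \<kappa> \<alpha> L0 D"
    have D: "\<tau>2 \<le> D" "L0 \<le> D" "0 < D" "D \<le> Z" "\<tau>1 = - D"
      using True par tb by (auto simp: D_def)
    have D': "0 < D'" "D' \<le> D" "D' \<le> \<delta> / 4" using D par by (auto simp: D'_def)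
    have nz: "noise D N" unfolding N_def using D by (intro noise) auto
    obtain p w where pw: "\<And>s. s \<in> {\<tau>1..\<tau>2} \<Longrightarrow> d s = p + w * s" using d_affine[OF t(1,2,5)] by blast
    have "p = c" using pw[of 0] t by (simp add: c_def)
    moreover have "- (5 * P) \<le> d (- D')" by (rule zone(2)) (use D' in auto)
    \<comment> \<open>The affine \<open>d\<close> is at least -5P > -c/2 at -D', so it climbs by
      less than 3c/2 over the length D' and still is at least c/4 on the right half.\<close>
    ultimately have w: "w * D' \<le> 3 / 2 * c" using pw[of "- D'"] D' D t cP by simp
    have low: "c / 4 \<le> d s" if s: "- D' / 2 \<le> s" "s \<le> 0" for s
    proof (cases "0 \<le> w")
      case True
      then have "w * (- D' / 2) \<le> w * s" using s by (intro mult_left_mono) auto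
      then show ?thesis using pw[of s] \<open>p = c\<close> w s D' D t by simp
    next
      case False
      then have "0 \<le> w * s" using s by (simp add: mult_nonpos_nonpos)
      then show ?thesis using pw[of s] \<open>p = c\<close> w s D' D t c0 by simp
    qed
    have uv: "- a \<le> - D' / 2" "0 \<le> b" using D' tb D ab by auto
    have "c / 4 * (0 - (- D' / 2))\<^sup>2 \<le> 16 * (3 * D * N)"
    proof (rule second_derivative_le_of_bounded[OF _ restrict_curve[OF uv]])
      fix x assume x: "- D' / 2 < x" "x < 0"
      show "c / 4 \<le> d x - m x" using low[of x] m_left[of x] x D' par by simp
    next
      fix x assume x: "- D' / 2 \<le> x" "x \<le> 0"
      show "\<bar>g x\<bar> \<le> 3 * D * N"
        by (rule noise_gap[OF nz t(1,2,5)]) (use x D D' t in auto)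
    qed (use D' in auto)
    then have 1: "c * D'\<^sup>2 \<le> 768 * D * N" by (simp add: power2_eq_square)
    have "\<delta> / (4 * Z) * D \<le> D'"
      unfolding D'_def using par D Z by (auto simp: field_simps intro!: mult_mono)
    then have "(\<delta> / (4 * Z) * D)\<^sup>2 \<le> D'\<^sup>2" using par D Z by (intro power_mono) auto
    then have "c * (\<delta> / (4 * Z) * D)\<^sup>2 \<le> 768 * D * N" using 1 c0 by (smt (verit) mult_left_mono)
    also have "\<dots> \<le> 768 * D * (\<kappa> * r * D)"
      unfolding N_def r_def using D par by (intro mult_left_mono scale_noise_le) auto
    finally have "D\<^sup>2 * (c * (\<delta> / (4 * Z))\<^sup>2) \<le> D\<^sup>2 * (768 * \<kappa> * r)"
      by (simp add: power2_eq_square mult_ac)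
    then have "c * (\<delta> / (4 * Z))\<^sup>2 \<le> 768 * \<kappa> * r"
      using D by (simp only: mult_le_cancel_left_pos zero_less_power)
    then have "c \<le> 768 * (4 * Z / \<delta>)\<^sup>2 * \<kappa> * r" using Z par by (simp add: field_simps power2_eq_square)
    then show ?thesis using c2 by simp
  next
    case False
    show ?thesis
    proof (cases "L0 \<le> \<tau>2")
      case True
      with False show ?thesis
        unfolding C2_def using t par by (intro wide_gap_bound[OF t(1,2,5)]) auto
    next
      case F: False
      have "1 * L0 \<le> C2 * L0" using C2 par by (intro mult_right_mono) auto
      then show ?thesis using F by simp
    qed
  qed
  \<comment> \<open>Five times the bound for \<open>\<tau>2\<close>, so a contact beyond L/2 has
    distance at least L/4 from \<open>\<tau>2\<close>.\<close>
  define L where "L = C3 * L0"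
  define N where "N = scale_noise \<kappa> \<alpha> L0 L"
  have L: "0 < L" "L < \<delta>" "L0 \<le> L" "\<tau>2 \<le> L / 5" "C2 * L0 < L"
    using small C2 par \<open>\<tau>2 \<le> C2 * L0\<close> by (auto simp: L_def)
  have LZ: "L \<le> Z" using L par by linarith
  have nz: "noise L N" unfolding N_def using L LZ by (intro noise) auto
  have curv: "c / 2 \<le> d s - m s" if s: "0 < s" "s < L" for s
  proof -
    have "s powr \<alpha> \<le> L powr \<alpha>" using s par by (intro powr_mono2) auto
    also have "L powr \<alpha> = C3 powr \<alpha> * r" by (simp add: L_def r_def powr_mult)
    finally have "K * s powr \<alpha> \<le> K * (C3 powr \<alpha> * r)" using par by (intro mult_left_mono) auto
    moreover have "m s = K * s powr \<alpha>" using s L by (intro m_right) auto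
    moreover have "c \<le> d s" using s L par by (intro right) auto
    ultimately show ?thesis using c1 by simp
  qed
  obtain \<tau>3 \<tau>4 where t': "\<tau>3 \<in> T" "\<tau>4 \<in> T" "\<tau>3 \<le> L / 2" "L / 2 \<le> \<tau>4" "{\<tau>3<..<\<tau>4} \<inter> T = {}"
    using gap_around[of "L/2"] L par ab by auto
  have tb': "\<tau>4 \<le> b" using t' T by auto
  show False
  \<comment> \<open>Either the contacts \<open>\<tau>2\<close> and \<open>\<tau>4\<close> enclose an
    interval of strong curvature within scale L, or the gap around L/2 reaches beyond L and
    contradicts the bound for wide gaps. In the first case the midpoint needs only the lower noise
    bound.\<close>
  proof (cases "\<tau>4 \<le> L")
    case True
    have uv: "-a \<le> \<tau>2" "\<tau>4 \<le> b" using t ab tb' by auto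
    have "c / 2 \<le> d s - m s" if "\<tau>2 < s" "s < \<tau>4" for s
      using that t True by (intro curv) auto
    moreover have "\<tau>2 \<le> \<tau>4" using t' L by simp
    ultimately have "c / 2 * (\<tau>4 - \<tau>2)\<^sup>2 / 4 \<le> g \<tau>2 + g \<tau>4 - 2 * g ((\<tau>2 + \<tau>4) / 2)"
      by (intro second_difference_ge[OF _ restrict_curve[OF uv]])
    moreover have "g \<tau>2 \<le> L * N" "g \<tau>4 \<le> L * N"
      using nz t t' L True by (auto simp: noise_def abs_le_iff)
    moreover have "(\<tau>2 + \<tau>4) / 2 \<in> {-a..b}" "\<bar>(\<tau>2 + \<tau>4) / 2\<bar> \<le> L"
      using t t' L True tb' ab by auto
    then have "- (L * N) \<le> g ((\<tau>2 + \<tau>4) / 2)"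
      using nz unfolding noise_def by blast
    ultimately have 1: "c * (\<tau>4 - \<tau>2)\<^sup>2 \<le> 32 * (L * N)" by simp
    have "(L / 4)\<^sup>2 \<le> (\<tau>4 - \<tau>2)\<^sup>2" using t t' L by (intro power_mono) auto
    then have "c * (L / 4)\<^sup>2 \<le> 32 * (L * N)" using 1 c0 by (smt (verit) mult_left_mono)
    also have "\<dots> \<le> 32 * (L * (\<kappa> * r * L))"
      unfolding N_def r_def using L par by (intro mult_left_mono scale_noise_le) auto
    finally have "c \<le> 512 * \<kappa> * r" using L by (simp add: power2_eq_square mult_ac)
    then show False using c3 by simp
  next
    case False
    have "\<tau>2 \<le> \<tau>3"
    proof (rule ccontr)
      assume "\<not> ?thesis"
      then have "\<tau>2 \<in> {\<tau>3<..<\<tau>4}" using t'(4) L by simp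
      then show False using t'(5) t(2) by blast
    qed
    then have "\<tau>4 \<le> C2 * L0"
      unfolding C2_def using t t' L False by (intro wide_gap_bound[OF t'(1,2,5)]) auto
    then show False using False L by simp
  qed
qed

end

end

text \<open>The origin of \<open>d\<close> and \<open>m\<close> is \<open>x0\<close>; the scale \<open>L0\<close> will be \<open>n powr (-1/(2\<alpha>+1))\<close>.\<close>

lemma contact_curve_bounds:
  fixes \<alpha> K \<delta> Z \<kappa> :: real
  assumes "1 < \<alpha>" "0 < K" "0 < \<delta>" "\<delta> \<le> Z" "0 < \<kappa>"
  obtains C \<rho> where "0 < C" "0 < \<rho>"
    "\<And>a b T d m g g1 L0 e. contact_curve a b T d m g g1 \<Longrightarrow> \<delta> \<le> a \<Longrightarrow> \<delta> \<le> b \<Longrightarrow> a \<le> Z \<Longrightarrow> b \<le> Z \<Longrightarrow>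
      (\<And>s. -\<delta> < s \<Longrightarrow> s < 0 \<Longrightarrow> m s = 0) \<Longrightarrow> (\<And>s. 0 < s \<Longrightarrow> s < \<delta> \<Longrightarrow> m s = K * s powr \<alpha>) \<Longrightarrow>
      0 < L0 \<Longrightarrow> L0 < \<rho> \<Longrightarrow> contact_curve.noise a b T g g1 Z e \<Longrightarrow>
      (\<And>L. L0 \<le> L \<Longrightarrow> L \<le> Z \<Longrightarrow> contact_curve.noise a b T g g1 L (scale_noise \<kappa> \<alpha> L0 L)) \<Longrightarrow>
      - (C * e) \<le> d 0 \<and> d 0 \<le> C * (e + L0 powr \<alpha>)"
proof -
  obtain q where q: "0 < q"
    "\<And>x. 11/16 \<le> x \<Longrightarrow> x \<le> 13/16 \<Longrightarrow> q \<le> (x + 1/16) powr \<alpha> + (x - 1/16) powr \<alpha> - 2 * x powr \<alpha>"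
    using powr_second_difference_bound[OF assms(1)] by blast
  define C3 where "C3 = 5 * gap_const \<alpha> K \<delta> Z \<kappa> q"
  define C1 where "C1 = 2 * K * C3 powr \<alpha> + 768 * (4 * Z / \<delta>)\<^sup>2 * \<kappa> + 512 * \<kappa>"
  define C4 where "C4 = 30720 * Z / \<delta>\<^sup>2"
  have C3: "0 < C3" by (simp add: C3_def gap_const_def less_max_iff_disj)
  have C1: "0 < C1" unfolding C1_def using assms C3 by (intro add_nonneg_pos) auto
  have C4: "0 < C4" unfolding C4_def using assms by simp
  show ?thesis
  \<comment> \<open>The threshold for \<open>L0\<close> says that the contacts sought, within
    \<open>C3 * L0\<close>, stay in the zone where \<open>m\<close> is known.\<close>
  proof (rule that[of "C1 + C4" "\<delta> / C3"])
    fix a b T d m g g1 L0 e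
    assume cc: "contact_curve a b T d m g g1" and del: "\<delta> \<le> a" "\<delta> \<le> b" "a \<le> Z" "b \<le> Z"
      and m: "\<And>s. -\<delta> < s \<Longrightarrow> s < 0 \<Longrightarrow> m s = 0" "\<And>s. 0 < s \<Longrightarrow> s < \<delta> \<Longrightarrow> m s = K * s powr \<alpha>"
      and L0: "0 < L0" "L0 < \<delta> / C3" and e: "contact_curve.noise a b T g g1 Z e"
      and nz: "\<And>L. L0 \<le> L \<Longrightarrow> L \<le> Z \<Longrightarrow> contact_curve.noise a b T g g1 L (scale_noise \<kappa> \<alpha> L0 L)"
    interpret contact_curve a b T d m g g1 by (rule cc)
    have small: "C3 * L0 < \<delta>" using L0 C3 by (simp add: field_simps)
    have e0: "0 \<le> e" by (rule noise_nonneg[OF e T(4)]) (use ab del in auto)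
    have "- (5 * (1024 * (3 * Z * e) / \<delta>\<^sup>2)) \<le> d 0"
      by (rule linear_zone_extrapolate[OF assms(3) del(1) m(1) noise_whole[OF e del(3,4)]])
        (use assms del ab in auto)
    moreover have "5 * (1024 * (3 * Z * e) / \<delta>\<^sup>2) = C4 * e / 2" by (simp add: C4_def)
    moreover have "0 \<le> C4 * e" "0 \<le> C1 * e" "0 \<le> C4 * L0 powr \<alpha>" using C4 C1 e0 by auto
    moreover have "d 0 \<le> 10 * (3072 * Z * e / \<delta>\<^sup>2) + C1 * L0 powr \<alpha>"
      unfolding C1_def C3_def
      by (rule error_upper_bound[OF assms(1,2,3) del assms(5) L0(1) q m nz e small[unfolded C3_def]])
    moreover have "10 * (3072 * Z * e / \<delta>\<^sup>2) = C4 * e" by (simp add: C4_def)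
    ultimately show "- ((C1 + C4) * e) \<le> d 0 \<and> d 0 \<le> (C1 + C4) * (e + L0 powr \<alpha>)"
      unfolding distrib_left distrib_right by linarith
  qed (use C1 C4 C3 assms in auto)
qed

subsection \<open>The cone and the least squares criterion\<close>

lemma set_integrable_le_of_bounded:
  fixes f g :: "real \<Rightarrow> real"
  assumes "set_integrable lborel {0..} f" "continuous_on {0..} g"
    and "\<And>t. 0 \<le> t \<Longrightarrow> \<bar>g t\<bar> \<le> C * f t"
  shows "set_integrable lborel {0..} g"
proof (rule set_integrable_bound)
  show "set_integrable lborel {0..} (\<lambda>t. C * f t)" using assms(1) by simp
  show "set_borel_measurable lborel {0..} g"
    using set_measurable_continuous_on[of "{0..}" g] assms(2) by (simp add: set_borel_measurable_def)
  show "AE t in lborel. t \<in> {0..} \<longrightarrow> norm (g t) \<le> norm (C * f t)"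
    using assms(3) by (auto intro!: AE_I2 order_trans[OF assms(3)])
qed

lemma set_integrable_compact_support:
  fixes g :: "real \<Rightarrow> real"
  assumes "continuous_on {0..} g" "\<And>t. c \<le> t \<Longrightarrow> g t = 0"
  shows "set_integrable lborel {0..} g"
proof -
  have "set_integrable lborel {0..max c 0} g"
    using assms(1) by (intro borel_integrable_atLeastAtMost') (auto elim: continuous_on_subset)
  moreover have "(\<lambda>t. indicator {0..max c 0} t *\<^sub>R g t) = (\<lambda>t. indicator {0..} t *\<^sub>R g t)"
    using assms(2) by (auto simp: indicator_def fun_eq_iff)
  ultimately show ?thesis by (simp only: set_integrable_def)
qed

lemma set_integral_ge_const:
  fixes g :: "real \<Rightarrow> real"
  assumes "set_integrable lborel {0..} g" "\<And>t. 0 \<le> t \<Longrightarrow> 0 \<le> g t"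
    and "0 \<le> u" "u \<le> v" and c: "\<And>t. u \<le> t \<Longrightarrow> t \<le> v \<Longrightarrow> c \<le> g t"
  shows "c * (v - u) \<le> (LINT t:{0..}|lborel. g t)"
proof -
  have uv: "set_integrable lborel {u..v} g"
    using assms(1,3) by (rule_tac set_integrable_subset) auto
  have "c * (v - u) = (LINT t:{u..v}|lborel. c)"
    using assms by (simp add: set_lebesgue_integral_def)
  also have "\<dots> \<le> (LINT t:{u..v}|lborel. g t)"
    by (rule set_integral_mono[OF borel_integrable_atLeastAtMost' uv]) (use c in auto)
  also have "\<dots> \<le> (LINT t:{0..}|lborel. g t)"
    using uv assms unfolding set_lebesgue_integral_def set_integrable_def
    by (intro integral_mono) (auto simp: indicator_def)
  finally show ?thesis .
qed

lemma convex_coneD: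
  assumes "g \<in> convex_cone"
  shows "\<And>t. 0 \<le> t \<Longrightarrow> 0 \<le> g t" "continuous_on {0..} g" "convex_on {0..} g" "set_integrable lborel {0..} g"
  using assms by (auto simp: convex_cone_def)

text \<open>Once a convex function has increased it never falls below that level again, and a
  positive level on a half-line contradicts integrability.\<close>

lemma convex_cone_antimono:
  assumes g: "g \<in> convex_cone" and st: "0 \<le> s" "s \<le> t"
  shows "g t \<le> g s"
proof (rule ccontr)
  assume n: "\<not> ?thesis"
  define J where "J = (LINT u:{0..}|lborel. g u)"
  have "g t \<le> g u" if "t \<le> u" for u
  proof -
    have "convex_on {s..u} g" using convex_coneD(3)[OF g] st that by (elim convex_on_subset) auto
    then have "g t \<le> max (g s) (g u)" by (rule convex_on_le_max) (use st that in auto)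
    then show ?thesis using n by linarith
  qed
  then have "g t * ((t + N) - t) \<le> J" if "0 \<le> N" for N
    unfolding J_def using convex_coneD[OF g] st that by (intro set_integral_ge_const) auto
  from this[of "(\<bar>J\<bar> + 1) / g t"] show False
    using n convex_coneD(1)[OF g st(1)] by simp
qed

text \<open>Members of the cone are bounded by their value at 0, so products, in particular squares,
  are dominated by an integrable function.\<close>

lemma convex_cone_mult_integrable:
  assumes "f \<in> convex_cone" "g \<in> convex_cone"
  shows "set_integrable lborel {0..} (\<lambda>t. f t * g t)"
proof (rule set_integrable_le_of_bounded[OF convex_coneD(4)[OF assms(2)]])
  show "continuous_on {0..} (\<lambda>t. f t * g t)"
    using convex_coneD(2) assms by (intro continuous_intros) auto
  fix t :: real assume "0 \<le> t"
  then show "\<bar>f t * g t\<bar> \<le> f 0 * g t"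
    using convex_coneD(1) convex_cone_antimono[of f 0 t] assms
    by (auto simp: abs_mult intro!: mult_right_mono)
qed

lemma convex_cone_add:
  assumes "f \<in> convex_cone" "g \<in> convex_cone"
  shows "(\<lambda>t. f t + g t) \<in> convex_cone"
  using assms by (auto simp: convex_cone_def intro!: continuous_intros convex_on_add)

lemma convex_cone_scale:
  assumes "f \<in> convex_cone" "0 \<le> c"
  shows "(\<lambda>t. c * f t) \<in> convex_cone"
  using assms by (auto simp: convex_cone_def intro!: continuous_intros convex_on_cmul)

lemma ls_criterion_convex_cone:
  assumes "0 < n" "\<And>i. i < n \<Longrightarrow> 0 < x i" "g \<in> convex_cone"
  shows "ls_criterion n x g = 1/2 * (LINT t:{0..}|lborel. (g t)\<^sup>2) - (\<Sum>i<n. g (x i)) / n"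
proof -
  have "set_borel_measurable borel {0..} g"
    using convex_coneD(2)[OF assms(3)] by (intro set_measurable_continuous_on) auto
  then show ?thesis unfolding ls_criterion_def
    using assms by (subst integral_ecdf) (auto intro: less_imp_le)
qed

lemma quadratic_minimum_slope:
  fixes a b :: real
  assumes "\<And>\<epsilon>. 0 < \<epsilon> \<Longrightarrow> \<epsilon> \<le> 1 \<Longrightarrow> 0 \<le> \<epsilon> * a + \<epsilon>\<^sup>2 * b"
  shows "0 \<le> a"
proof (rule ccontr)
  assume a: "\<not> 0 \<le> a"
  define \<epsilon> where "\<epsilon> = min 1 (- a / (2 * (\<bar>b\<bar> + 1)))"
  have e: "0 < \<epsilon>" "\<epsilon> \<le> 1" "\<epsilon> \<le> - a / (2 * (\<bar>b\<bar> + 1))" using a by (auto simp: \<epsilon>_def divide_neg_pos)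
  have "\<epsilon> * (2 * (\<bar>b\<bar> + 1)) \<le> - a" using e(3) by (simp add: field_simps)
  moreover have "\<epsilon> * b \<le> \<epsilon> * (\<bar>b\<bar> + 1)" using e by (intro mult_left_mono) auto
  ultimately have "\<epsilon> * b < - a" using a by (simp add: algebra_simps)
  then have "\<epsilon> * (a + \<epsilon> * b) < 0" using e by (simp add: mult_pos_neg)
  then show False using assms[OF e(1,2)] by (simp add: algebra_simps power2_eq_square)
qed

section \<open>Support lines and gluing of convex functions\<close>

lemma convex_on_support:
  fixes f :: "real \<Rightarrow> real"
  assumes "convex_on {0..} f" "0 < c"
  obtains \<sigma> where "\<And>t. 0 \<le> t \<Longrightarrow> f c + \<sigma> * (t - c) \<le> f t"
  using convex_le_Inf_differential[OF assms(1), of c] assms(2) that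
  by (metis atLeast_iff greaterThan_iff interior_real_atLeast)

lemma antimono_support_slope:
  fixes f :: "real \<Rightarrow> real"
  assumes "f c + \<sigma> * (c + 1 - c) \<le> f (c + 1)" "f (c + 1) \<le> f c"
  shows "\<sigma> \<le> 0"
  using assms by simp

lemma convex_on_diff_line:
  fixes f :: "real \<Rightarrow> real"
  assumes "convex_on S f"
  shows "convex_on S (\<lambda>t. f t - (y + r * (t - c)))"
proof -
  have "convex_on S (\<lambda>t. f t + ((r * c - y) + (- r) * t))"
    using assms by (intro convex_on_add convex_on_affine convex_on_imp_convex)
  then show ?thesis by (rule convex_on_eqI) (simp add: algebra_simps)
qed

text \<open>The point c is a minimum with value 0, and replacing a convex function by its minimal
  value beyond a minimum keeps it convex. Adding a support line afterwards glues a convex function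
  to its tangent, which is how competitors of the estimator are built.\<close>

lemma convex_on_clip_left:
  fixes u :: "real \<Rightarrow> real"
  assumes u: "convex_on S u" and "\<And>t. t \<in> S \<Longrightarrow> 0 \<le> u t" "c \<in> S" "u c = 0"
  shows "convex_on S (\<lambda>t. u (min t c))"
proof (rule convex_on_linorderI)
  show S: "convex S" using u by (rule convex_on_imp_convex)
  fix t x y :: real assume t: "0 < t" "t < 1" and xy: "x \<in> S" "y \<in> S" "x < y"
  define z where "z = (1 - t) *\<^sub>R x + t *\<^sub>R y"
  have zx: "z - x = t * (y - x)" by (simp add: z_def algebra_simps)
  have yz: "y - z = (1 - t) * (y - x)" by (simp add: z_def algebra_simps)
  have "0 \<le> z - x" "0 \<le> y - z" unfolding zx yz using t xy by auto
  then have z: "x \<le> z" "z \<le> y" by auto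
  have m: "min x c \<in> S" "min y c \<in> S" using xy assms(3) by (auto simp: min_def)
  show "u (min z c) \<le> (1 - t) * u (min x c) + t * u (min y c)" (is "_ \<le> ?r")
  proof (cases "c \<le> z")
    case True
    then show ?thesis using t assms(2)[OF m(1)] assms(2)[OF m(2)] assms(4) by (simp add: min_def)
  next
    case False
    show ?thesis
    proof (cases "y \<le> c")
      case True
      then show ?thesis using False convex_onD[OF u, of t x y] xy t by (simp add: z_def min_def)
    next
      case nF: False
      \<comment> \<open>The chord is taken to c, where u vanishes, instead of y; as c is nearer, z
        has the larger weight w there, and the bound by (1 - w) * u x is better than
        required.\<close>
      define w where "w = (z - x) / (c - x)"
      have cx: "x < c" using z False by simp
      have "z - x = w * (c - x)" using cx by (simp add: w_def)
      then have zw: "z = (1 - w) *\<^sub>R x + w *\<^sub>R c" by (simp add: algebra_simps)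
      have w: "0 \<le> w" "w \<le> 1" using z cx False by (auto simp: w_def)
      have "w \<ge> t"
      proof -
        have "t * (c - x) \<le> t * (y - x)" using t nF by (intro mult_left_mono) auto
        then show ?thesis using zx cx by (simp add: w_def field_simps)
      qed
      have "u z \<le> (1 - w) * u x + w * u c" unfolding zw using w xy assms(3) by (intro convex_onD[OF u]) auto
      also have "\<dots> \<le> (1 - t) * u x + 0"
        using \<open>w \<ge> t\<close> assms xy by (auto intro!: mult_right_mono)
      finally show ?thesis using False nF cx assms(4) by (simp add: min_def)
    qed
  qed
qed

lemma convex_on_reflect:
  fixes f :: "real \<Rightarrow> real"
  assumes "convex_on S f"
  shows "convex_on (uminus ` S) (\<lambda>t. f (- t))"
proof (rule convex_onI)
  show "convex (uminus ` S)" using convex_on_imp_convex[OF assms] by (rule convex_negations)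
  fix t x y :: real assume "0 < t" "t < 1" "x \<in> uminus ` S" "y \<in> uminus ` S"
  then show "f (- ((1 - t) *\<^sub>R x + t *\<^sub>R y)) \<le> (1 - t) * f (- x) + t * f (- y)"
    using convex_onD[OF assms, of t "- x" "- y"] by (auto simp: algebra_simps)
qed

lemma convex_on_clip_right:
  fixes u :: "real \<Rightarrow> real"
  assumes u: "convex_on S u" and "\<And>t. t \<in> S \<Longrightarrow> 0 \<le> u t" "c \<in> S" "u c = 0"
  shows "convex_on S (\<lambda>t. u (max t c))"
proof -
  have "convex_on (uminus ` S) (\<lambda>t. u (- (min t (- c))))"
    by (rule convex_on_clip_left[OF convex_on_reflect[OF u]]) (use assms in auto)
  then have "convex_on (uminus ` (uminus ` S)) (\<lambda>t. u (- (min (- t) (- c))))"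
    by (rule convex_on_reflect)
  moreover have "- min (- t) (- c) = max t c" for t :: real by auto
  ultimately show ?thesis by (simp add: image_image)
qed

lemma convex_on_max:
  fixes f g :: "real \<Rightarrow> real"
  assumes "convex_on S f" "convex_on S g"
  shows "convex_on S (\<lambda>t. max (f t) (g t))"
proof (rule convex_onI)
  show "convex S" using assms(1) by (rule convex_on_imp_convex)
  fix t x y :: real assume t: "0 < t" "t < 1" and xy: "x \<in> S" "y \<in> S"
  let ?z = "(1 - t) *\<^sub>R x + t *\<^sub>R y"
  have "(1 - t) * f x \<le> (1 - t) * max (f x) (g x)" "t * f y \<le> t * max (f y) (g y)"
    "(1 - t) * g x \<le> (1 - t) * max (f x) (g x)" "t * g y \<le> t * max (f y) (g y)"
    using t by (auto intro!: mult_left_mono)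
  moreover have "f ?z \<le> (1 - t) * f x + t * f y" "g ?z \<le> (1 - t) * g x + t * g y"
    using t xy convex_onD[OF assms(1), of t x y] convex_onD[OF assms(2), of t x y] by auto
  ultimately show "max (f ?z) (g ?z) \<le> (1 - t) * max (f x) (g x) + t * max (f y) (g y)"
    by (intro max.boundedI) linarith+
qed

lemma hinge_in_convex_cone:
  "(\<lambda>t. max 0 (s - t)) \<in> convex_cone"
proof -
  have "continuous_on {0..} (\<lambda>t. max 0 (s - t))" by (intro continuous_intros)
  moreover have "convex_on {0..} (\<lambda>t. max 0 (s - t))"
    using convex_on_max[OF convex_on_affine[of "{0..}" 0 0] convex_on_affine[of "{0..}" s "-1"]] by simp
  moreover have "set_integrable lborel {0..} (\<lambda>t. max 0 (s - t))"
    by (rule set_integrable_compact_support[of _ s]) (auto intro!: continuous_intros)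
  ultimately show ?thesis by (simp add: convex_cone_def)
qed

subsection \<open>Optimality and contact points\<close>

locale lse =
  fixes n :: nat and x :: "nat \<Rightarrow> real" and f :: "real \<Rightarrow> real"
  assumes n: "0 < n" and x_pos: "\<And>i. i < n \<Longrightarrow> 0 < x i" and f: "f \<in> convex_cone"
    and f_min: "\<And>g. g \<in> convex_cone \<Longrightarrow> ls_criterion n x f \<le> ls_criterion n x g"
begin

definition sample_mean :: "(real \<Rightarrow> real) \<Rightarrow> real" where
  "sample_mean g = (\<Sum>i<n. g (x i)) / n"

definition f_inner :: "(real \<Rightarrow> real) \<Rightarrow> real" where
  "f_inner g = (LINT t:{0..}|lborel. f t * g t)"

definition gap :: "real \<Rightarrow> real" where
  "gap s = f_inner (\<lambda>t. max 0 (s - t)) - sample_mean (\<lambda>t. max 0 (s - t))"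

definition contacts :: "real set" where
  "contacts = {s. 0 \<le> s \<and> gap s = 0}"

lemma sample_mean_mono:
  assumes "\<And>t. 0 \<le> t \<Longrightarrow> g t \<le> h t"
  shows "sample_mean g \<le> sample_mean h"
  unfolding sample_mean_def using n x_pos
  by (intro divide_right_mono sum_mono) (auto intro!: assms simp: less_imp_le)

lemma sample_mean_add: "sample_mean (\<lambda>t. g t + h t) = sample_mean g + sample_mean h"
  by (simp add: sample_mean_def sum.distrib add_divide_distrib)

lemma sample_mean_cmult: "sample_mean (\<lambda>t. c * g t) = c * sample_mean g"
  by (simp add: sample_mean_def sum_distrib_left)

lemma sample_mean_const: "sample_mean (\<lambda>t. c) = c"
  using n by (simp add: sample_mean_def)

lemma f_inner_add:
  assumes "g \<in> convex_cone" "h \<in> convex_cone"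
  shows "f_inner (\<lambda>t. g t + h t) = f_inner g + f_inner h"
  unfolding f_inner_def using convex_cone_mult_integrable[OF f assms(1)] convex_cone_mult_integrable[OF f assms(2)]
  by (simp add: distrib_left)

lemma f_inner_cmult: "f_inner (\<lambda>t. c * g t) = c * f_inner g"
proof -
  have "f_inner (\<lambda>t. c * g t) = (LINT t:{0..}|lborel. c * (f t * g t))"
    by (simp add: f_inner_def mult_ac)
  then show ?thesis by (simp add: f_inner_def)
qed

lemma f_inner_mono:
  assumes "g \<in> convex_cone" "h \<in> convex_cone" "\<And>t. 0 \<le> t \<Longrightarrow> g t \<le> h t"
  shows "f_inner g \<le> f_inner h"
  unfolding f_inner_def
  using assms convex_coneD(1)[OF f]
  by (intro set_integral_mono convex_cone_mult_integrable f) (auto intro!: mult_left_mono)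

text \<open>Along the segment from f to g, which stays in the cone, the criterion is a quadratic
  polynomial with minimum at the end f; the claim is the sign of its slope there.\<close>

lemma variational_inequality:
  assumes g: "g \<in> convex_cone"
  shows "sample_mean g - sample_mean f \<le> f_inner g - f_inner f"
proof -
  define C where "C = (LINT t:{0..}|lborel. g t * g t)"
  have "0 \<le> (f_inner g - f_inner f) - (sample_mean g - sample_mean f)"
  proof (rule quadratic_minimum_slope[of _ "f_inner f / 2 - f_inner g + C / 2"])
    fix \<epsilon> :: real assume e: "0 < \<epsilon>" "\<epsilon> \<le> 1"
    define h where "h t = (1 - \<epsilon>) * f t + \<epsilon> * g t" for t
    have h: "h \<in> convex_cone"
      unfolding h_def using e by (intro convex_cone_add convex_cone_scale f g) auto
    have "(LINT t:{0..}|lborel. (h t)\<^sup>2) =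
      (LINT t:{0..}|lborel. (1 - \<epsilon>)\<^sup>2 * (f t * f t) + (2 * \<epsilon> * (1 - \<epsilon>) * (f t * g t) + \<epsilon>\<^sup>2 * (g t * g t)))"
      by (simp add: h_def power2_eq_square algebra_simps)
    also have "\<dots> = (1 - \<epsilon>)\<^sup>2 * f_inner f + (2 * \<epsilon> * (1 - \<epsilon>) * f_inner g + \<epsilon>\<^sup>2 * C)"
      unfolding f_inner_def C_def
      using convex_cone_mult_integrable[OF f f] convex_cone_mult_integrable[OF f g]
        convex_cone_mult_integrable[OF g g]
      by (subst set_integral_add, simp, simp, subst set_integral_add) simp_all
    finally have "ls_criterion n x h =
        1/2 * ((1 - \<epsilon>)\<^sup>2 * f_inner f + (2 * \<epsilon> * (1 - \<epsilon>) * f_inner g + \<epsilon>\<^sup>2 * C)) - sample_mean h"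
      using ls_criterion_convex_cone[of n x h] n x_pos h by (simp add: sample_mean_def)
    moreover have "sample_mean h = (1 - \<epsilon>) * sample_mean f + \<epsilon> * sample_mean g"
      unfolding h_def by (simp add: sample_mean_add sample_mean_cmult)
    moreover have "ls_criterion n x f = 1/2 * f_inner f - sample_mean f"
      using ls_criterion_convex_cone[of n x f] n x_pos f by (simp add: sample_mean_def f_inner_def power2_eq_square)
    moreover have "ls_criterion n x f \<le> ls_criterion n x h" by (rule f_min[OF h])
    ultimately show "0 \<le> \<epsilon> * (f_inner g - f_inner f - (sample_mean g - sample_mean f)) +
        \<epsilon>\<^sup>2 * (f_inner f / 2 - f_inner g + C / 2)"
      by (simp add: algebra_simps power2_eq_square)
  qed
  then show ?thesis by simp
qed

lemma gap_nonneg: "0 \<le> gap s"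
proof -
  have "(\<lambda>t. f t + max 0 (s - t)) \<in> convex_cone" by (intro convex_cone_add f hinge_in_convex_cone)
  from variational_inequality[OF this] show ?thesis
    by (simp add: gap_def sample_mean_add f_inner_add f hinge_in_convex_cone)
qed

text \<open>Lower \<open>f\<close> by \<open>q\<close>, the part of its curvature between \<open>\<tau>\<close> and \<open>\<beta>\<close>:
  to the left of \<open>\<tau>\<close> the graph is tilted along the line \<open>l\<close> so that it meets the
  support line at \<open>\<beta>\<close>. As \<open>\<beta>\<close> decreases to \<open>\<tau>\<close>, the suitably normalized \<open>q\<close> tends to the
  hinge at \<open>\<tau>\<close>.\<close>

lemma gap_le_of_kink:
  assumes \<tau>: "0 < \<tau>" and \<beta>: "\<tau> < \<beta>"
    and l: "\<And>t. 0 \<le> t \<Longrightarrow> f \<tau> + s0 * (t - \<tau>) \<le> f t" and kink: "f \<tau> + s0 * (\<beta> - \<tau>) < f \<beta>"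
  shows "gap \<tau> \<le> \<beta> - \<tau>"
proof -
  define l where "l t = f \<tau> + s0 * (t - \<tau>)" for t
  obtain \<sigma> where \<sigma>: "\<And>t. 0 \<le> t \<Longrightarrow> f \<beta> + \<sigma> * (t - \<beta>) \<le> f t"
    using convex_on_support[OF convex_coneD(3)[OF f], of \<beta>] \<tau> \<beta> by auto
  define T where "T t = f \<beta> + \<sigma> * (t - \<beta>)" for t
  have T: "T t \<le> f t" if "0 \<le> t" for t using \<sigma>[OF that] by (simp add: T_def)
  have lf: "l t \<le> f t" if "0 \<le> t" for t using l[OF that] by (simp add: l_def)
  define m where "m = \<sigma> - s0"
  have "T \<tau> \<le> l \<tau>" using T[of \<tau>] \<tau> by (simp add: l_def)
  then have "s0 * (\<beta> - \<tau>) < \<sigma> * (\<beta> - \<tau>)" using kink by (simp add: T_def l_def algebra_simps)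
  then have m: "0 < m" using \<beta> by (simp add: m_def)
  have s: "\<sigma> \<le> 0"
    by (rule antimono_support_slope[OF \<sigma>]) (use convex_cone_antimono[OF f] \<tau> \<beta> in auto)
  define u where "u t = f t - l t" for t
  define v where "v t = f t - T t" for t
  have cf: "convex_on {0..} f" "continuous_on {0..} f" using convex_coneD[OF f] by auto
  have u: "convex_on {0..} u" "\<And>t. 0 \<le> t \<Longrightarrow> 0 \<le> u t" "u \<tau> = 0"
    using convex_on_diff_line[OF cf(1)] lf by (auto simp: u_def[abs_def] l_def)
  have v: "convex_on {0..} v" "\<And>t. 0 \<le> t \<Longrightarrow> 0 \<le> v t" "v \<beta> = 0"
    using convex_on_diff_line[OF cf(1)] T by (auto simp: v_def[abs_def] T_def)
  \<comment> \<open>The result is f to the right of \<open>\<beta>\<close>, the tangent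
    \<open>T\<close> between \<open>\<tau>\<close> and \<open>\<beta>\<close>, and f - (l - T) to
    the left of \<open>\<tau>\<close>.\<close>
  define g where "g t = T t + u (min t \<tau>) + v (max t \<beta>)" for t
  have g_right: "g t = f t" if "\<beta> \<le> t" for t using that \<beta> u(3) by (simp add: g_def min_def max_def v_def)
  have g_mid: "g t = T t" if "\<tau> \<le> t" "t \<le> \<beta>" for t using that u(3) v(3) by (simp add: g_def min_def max_def)
  have g_left: "g t = T t + f t - l t" if "t \<le> \<tau>" for t using that \<beta> v(3) by (simp add: g_def min_def max_def u_def)
  have cu: "convex_on {0..} (\<lambda>t. u (min t \<tau>))"
    by (rule convex_on_clip_left[OF u(1)]) (use u \<tau> in auto)
  have cv: "convex_on {0..} (\<lambda>t. v (max t \<beta>))"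
    by (rule convex_on_clip_right[OF v(1)]) (use v \<tau> \<beta> in auto)
  have "convex_on {0..} (\<lambda>t. ((f \<beta> - \<sigma> * \<beta>) + \<sigma> * t) + u (min t \<tau>) + v (max t \<beta>))"
    by (rule convex_on_add[OF convex_on_add[OF convex_on_affine cu] cv]) simp
  then have g1: "convex_on {0..} g" by (rule convex_on_eqI) (simp add: g_def T_def algebra_simps)
  have g2: "continuous_on {0..} g"
    unfolding g_def u_def v_def l_def T_def using \<tau>
    by (intro continuous_intros continuous_on_compose2[OF cf(2)]) auto
  have g3: "0 \<le> g t" if "0 \<le> t" for t
  proof (cases "t \<le> \<beta>")
    case True
    have "0 \<le> \<sigma> * (t - \<beta>)" using s True by (simp add: mult_nonpos_nonpos)
    then have "0 \<le> T t" using convex_coneD(1)[OF f, of \<beta>] \<tau> \<beta> by (simp add: T_def)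
    moreover have "0 \<le> u (min t \<tau>)" "0 \<le> v (max t \<beta>)" using that \<tau> by (auto intro!: u v)
    ultimately show ?thesis by (simp add: g_def)
  next
    case False then show ?thesis using g_right[of t] convex_coneD(1)[OF f that] by simp
  qed
  have "set_integrable lborel {0..} (\<lambda>t. g t - f t)"
    by (rule set_integrable_compact_support[of _ \<beta>]) (use g2 cf g_right in \<open>auto intro!: continuous_intros\<close>)
  from set_integral_add[OF this convex_coneD(4)[OF f]] have g4: "set_integrable lborel {0..} g" by simp
  have g: "g \<in> convex_cone" using g1 g2 g3 g4 by (simp add: convex_cone_def)
  \<comment> \<open>With the slope difference m as normalization, f - g lies between m times the
    hinge at \<open>\<tau>\<close> and the same plus m * (\<open>\<beta>\<close> -
    \<open>\<tau>\<close>). The lower estimate is fed into the integral against f, the upper one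
    into the sample mean, and the variational inequality links the two.\<close>
  have q_lower: "g t + m * max 0 (\<tau> - t) \<le> f t" if t: "0 \<le> t" for t
  proof -
    consider "t \<le> \<tau>" | "\<tau> \<le> t" "t \<le> \<beta>" | "\<beta> \<le> t" by linarith
    then show ?thesis
    proof cases
      case 1
      have "T t + m * (\<tau> - t) = T \<tau> + s0 * (t - \<tau>)" by (simp add: T_def m_def algebra_simps)
      also have "\<dots> \<le> l \<tau> + s0 * (t - \<tau>)" using \<open>T \<tau> \<le> l \<tau>\<close> by simp
      also have "\<dots> = l t" by (simp add: l_def)
      finally show ?thesis using g_left[OF 1] 1 by simp
    next
      case 2 then show ?thesis using g_mid[OF 2] T[OF t] by simp
    next
      case 3 then show ?thesis using g_right[OF 3] \<beta> by simp
    qed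
  qed
  have q\<tau>: "l \<tau> - T \<tau> \<le> m * (\<beta> - \<tau>)" using kink by (simp add: l_def T_def m_def algebra_simps)
  have q_upper: "f t \<le> g t + (m * max 0 (\<tau> - t) + m * (\<beta> - \<tau>))" if t: "0 \<le> t" for t
  proof -
    consider "t \<le> \<tau>" | "\<tau> \<le> t" "t \<le> \<beta>" | "\<beta> \<le> t" by linarith
    then show ?thesis
    proof cases
      case 1
      have "l t - T t = l \<tau> - T \<tau> + m * (\<tau> - t)" by (simp add: l_def T_def m_def algebra_simps)
      then show ?thesis using g_left[OF 1] 1 q\<tau> by simp
    next
      case 2
      have "convex_on {\<tau>..\<beta>} v" using v(1) \<tau> by (elim convex_on_subset) auto
      then have "v t \<le> max (v \<tau>) (v \<beta>)" by (rule convex_on_le_max) (use 2 in auto)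
      moreover have "v \<tau> = l \<tau> - T \<tau>" by (simp add: v_def l_def)
      moreover have "0 \<le> m * (\<beta> - \<tau>)" using m \<beta> by simp
      ultimately have "v t \<le> m * (\<beta> - \<tau>)" using v(3) q\<tau> by simp
      then show ?thesis using g_mid[OF 2] 2 by (simp add: v_def)
    next
      case 3 then show ?thesis using g_right[OF 3] m \<beta> by simp
    qed
  qed
  have hc: "(\<lambda>t. m * max 0 (\<tau> - t)) \<in> convex_cone"
    using m by (intro convex_cone_scale hinge_in_convex_cone) auto
  have "f_inner (\<lambda>t. g t + m * max 0 (\<tau> - t)) \<le> f_inner f"
    by (rule f_inner_mono[OF convex_cone_add[OF g hc] f q_lower])
  then have 1: "f_inner g + m * f_inner (\<lambda>t. max 0 (\<tau> - t)) \<le> f_inner f"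
    by (simp add: f_inner_add[OF g hc] f_inner_cmult)
  have "sample_mean f \<le> sample_mean (\<lambda>t. g t + (m * max 0 (\<tau> - t) + m * (\<beta> - \<tau>)))"
    by (rule sample_mean_mono[OF q_upper])
  then have 2: "sample_mean f \<le> sample_mean g + (m * sample_mean (\<lambda>t. max 0 (\<tau> - t)) + m * (\<beta> - \<tau>))"
    by (simp add: sample_mean_add sample_mean_cmult sample_mean_const)
  have "m * gap \<tau> \<le> m * (\<beta> - \<tau>)"
    using 1 2 variational_inequality[OF g] by (simp add: gap_def right_diff_distrib)
  then show ?thesis using m by simp
qed

text \<open>Tilt f by the slope of its chord. Unless f is affine, the tilted function has an
  interior minimum below its end values, and its last minimizer is a kink in the sense of
  \<open>gap_le_of_kink\<close> for every \<open>\<beta>\<close> to its right. Letting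
  \<open>\<beta>\<close> approach it makes it a contact.\<close>

lemma affine_off_contacts:
  assumes ab: "0 \<le> a" "a \<le> b" and no: "{a<..<b} \<inter> contacts = {}"
  shows "\<exists>p r. \<forall>s\<in>{a..b}. f s = p + r * s"
proof (cases "a = b")
  case True then show ?thesis by (intro exI[of _ "f a"] exI[of _ 0]) auto
next
  case False
  then have lt: "a < b" using ab by simp
  define s0 where "s0 = (f b - f a) / (b - a)"
  define h where "h t = f t - s0 * t" for t
  have hab: "h a = h b" using lt by (simp add: h_def s0_def field_simps)
  have cvx: "convex_on {a..b} f" using convex_coneD(3)[OF f] ab by (elim convex_on_subset) auto
  have h_le: "h t \<le> h a" if "t \<in> {a..b}" for t
    using convex_onD_Icc'[OF cvx that] unfolding s0_def[symmetric] by (simp add: h_def algebra_simps)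
  have ch: "continuous_on {a..b} h" unfolding h_def
    using ab by (intro continuous_intros continuous_on_subset[OF convex_coneD(2)[OF f]]) auto
  obtain w where w: "w \<in> {a..b}" "\<And>y. y \<in> {a..b} \<Longrightarrow> h w \<le> h y"
    using continuous_attains_inf[OF compact_Icc _ ch] lt by fastforce
  have "h w = h a"
  proof (rule ccontr)
    assume "h w \<noteq> h a"
    then have hw: "h w < h a" using h_le[OF w(1)] by simp
    \<comment> \<open>The largest minimizer is needed: immediately to its right h is strictly
      larger, which is the kink hypothesis.\<close>
    have "closed ({a..b} \<inter> h -` {h w})" by (rule continuous_closed_preimage[OF ch]) auto
    then have "compact ({a..b} \<inter> ({a..b} \<inter> h -` {h w}))" by (intro compact_Int_closed) auto
    moreover have "{a..b} \<inter> ({a..b} \<inter> h -` {h w}) \<noteq> {}" using w(1) by blast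
    ultimately obtain \<tau> where "\<tau> \<in> {a..b} \<inter> ({a..b} \<inter> h -` {h w})"
      "\<forall>y\<in>{a..b} \<inter> ({a..b} \<inter> h -` {h w}). y \<le> \<tau>"
      using compact_attains_sup by blast
    then have \<tau>: "\<tau> \<in> {a..b}" "h \<tau> = h w" "\<And>y. y \<in> {a..b} \<Longrightarrow> h y = h w \<Longrightarrow> y \<le> \<tau>"
      by auto
    have "\<tau> \<noteq> a" "\<tau> \<noteq> b" using \<tau>(2) hw hab by auto
    then have t: "a < \<tau>" "\<tau> < b" using \<tau>(1) by auto
    have near: "f \<tau> + s0 * (t - \<tau>) \<le> f t" if "t \<in> {a..b}" for t
      using w(2)[OF that] \<tau>(2) by (simp add: h_def algebra_simps)
    \<comment> \<open>Beyond [a, b] the support inequality follows from monotonicity of slopes: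
      those from \<open>\<tau>\<close> to points outside are compared with those to a and to
      b.\<close>
    have glob: "f \<tau> + s0 * (t - \<tau>) \<le> f t" if t0: "0 \<le> t" for t
    proof -
      obtain \<sigma> where \<sigma>: "\<And>t. 0 \<le> t \<Longrightarrow> f \<tau> + \<sigma> * (t - \<tau>) \<le> f t"
        using convex_on_support[OF convex_coneD(3)[OF f], of \<tau>] t ab by auto
      consider "t \<in> {a..b}" | "t < a" | "b < t" by force
      then show ?thesis
      proof cases
        case 1 then show ?thesis by (rule near)
      next
        case 2
        have "convex_on {t..\<tau>} f" using convex_coneD(3)[OF f] t0 by (elim convex_on_subset) auto
        then have "f a \<le> (f t - f \<tau>) / (\<tau> - t) * (\<tau> - a) + f \<tau>"
          by (rule convex_onD_Icc'') (use 2 t in auto)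
        moreover have "f \<tau> + s0 * (a - \<tau>) \<le> f a" using lt by (intro near) auto
        ultimately have "(- s0) * (\<tau> - a) \<le> (f t - f \<tau>) / (\<tau> - t) * (\<tau> - a)" by (simp add: algebra_simps)
        then have "- s0 \<le> (f t - f \<tau>) / (\<tau> - t)" using t by (simp only: mult_le_cancel_right_pos diff_gt_0_iff_gt)
        then show ?thesis using 2 t by (simp add: field_simps)
      next
        case 3
        have "convex_on {\<tau>..t} f" using convex_coneD(3)[OF f] t ab by (elim convex_on_subset) auto
        then have "f b \<le> (f t - f \<tau>) / (t - \<tau>) * (b - \<tau>) + f \<tau>"
          by (rule convex_onD_Icc') (use 3 t in auto)
        moreover have "f \<tau> + s0 * (b - \<tau>) \<le> f b" using lt by (intro near) auto
        ultimately have "s0 * (b - \<tau>) \<le> (f t - f \<tau>) / (t - \<tau>) * (b - \<tau>)" by simp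
        then have "s0 \<le> (f t - f \<tau>) / (t - \<tau>)" using t by (simp only: mult_le_cancel_right_pos diff_gt_0_iff_gt)
        then show ?thesis using 3 t by (simp add: field_simps)
      qed
    qed
    have bound: "gap \<tau> \<le> \<epsilon>" if e: "0 < \<epsilon>" for \<epsilon>
    proof -
      define \<beta> where "\<beta> = min b (\<tau> + \<epsilon>)"
      have b: "\<tau> < \<beta>" "\<beta> \<le> b" "\<beta> \<le> \<tau> + \<epsilon>" using t e by (auto simp: \<beta>_def)
      have "h \<beta> \<noteq> h w" using \<tau>(3)[of \<beta>] b t by auto
      then have "h w < h \<beta>" using w(2)[of \<beta>] b t by simp
      then have "gap \<tau> \<le> \<beta> - \<tau>"
        using b t ab \<tau>(2) glob by (intro gap_le_of_kink) (auto simp: h_def algebra_simps)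
      then show ?thesis using b by simp
    qed
    have "gap \<tau> \<le> 0" by (rule field_le_epsilon) (use bound in simp)
    then have "\<tau> \<in> contacts" using gap_nonneg[of \<tau>] t ab by (simp add: contacts_def)
    then show False using no t by auto
  qed
  then have "h s = h a" if "s \<in> {a..b}" for s using w(2)[OF that] h_le[OF that] by simp
  then show ?thesis by (intro exI[of _ "h a"] exI[of _ s0]) (auto simp: h_def algebra_simps)
qed

end

subsection \<open>Existence of the estimator\<close>

lemma convex_cone_tangent_left:
  assumes g: "g \<in> convex_cone" and c: "0 < c"
    and \<sigma>: "\<And>t. 0 \<le> t \<Longrightarrow> g c + \<sigma> * (t - c) \<le> g t"
  shows "(\<lambda>t. if t \<le> c then g c + \<sigma> * (t - c) else g t) \<in> convex_cone" (is "?h \<in> _")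
proof -
  define T where "T t = g c + \<sigma> * (t - c)" for t
  define v where "v t = g t - T t" for t
  note gc = convex_coneD[OF g]
  have s: "\<sigma> \<le> 0"
    by (rule antimono_support_slope[OF \<sigma>]) (use convex_cone_antimono[OF g] c in auto)
  have v: "convex_on {0..} v"
    using convex_on_diff_line[OF gc(3)] by (simp add: v_def[abs_def] T_def)
  have h: "?h t = T t + v (max t c)" for t by (simp add: T_def v_def max_def)
  have "convex_on {0..} (\<lambda>t. v (max t c))"
    by (rule convex_on_clip_right[OF v]) (use \<sigma> c in \<open>auto simp: v_def T_def\<close>)
  then have "convex_on {0..} (\<lambda>t. ((g c - \<sigma> * c) + \<sigma> * t) + v (max t c))"
    by (intro convex_on_add convex_on_affine) auto
  then have 1: "convex_on {0..} ?h" by (rule convex_on_eqI) (simp add: h T_def algebra_simps)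
  have 2: "continuous_on {0..} ?h"
    unfolding h v_def T_def using c by (intro continuous_intros continuous_on_compose2[OF gc(2)]) auto
  have 3: "0 \<le> ?h t" if "0 \<le> t" for t
  proof (cases "t \<le> c")
    case True
    have "0 \<le> \<sigma> * (t - c)" using s True by (simp add: mult_nonpos_nonpos)
    then show ?thesis using gc(1)[of c] c True by simp
  qed (use gc(1)[OF that] in simp)
  have "set_integrable lborel {0..} (\<lambda>t. ?h t - g t)"
    by (rule set_integrable_compact_support[of _ c]) (use 2 gc in \<open>auto intro!: continuous_intros\<close>)
  from set_integral_add[OF this gc(4)] have "set_integrable lborel {0..} ?h" by simp
  then show ?thesis using 1 2 3 by (simp add: convex_cone_def)
qed

text \<open>A decreasing convex function is steepest at the left end, where here its slope is
  \<open>\<sigma>\<close>.\<close>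

lemma convex_cone_tangent_lipschitz:
  assumes g: "g \<in> convex_cone" and c: "0 < c"
    and \<sigma>: "\<And>t. 0 \<le> t \<Longrightarrow> g c + \<sigma> * (t - c) \<le> g t"
    and left: "\<And>t. 0 \<le> t \<Longrightarrow> t \<le> c \<Longrightarrow> g t = g c + \<sigma> * (t - c)"
    and st: "0 \<le> s" "0 \<le> t"
  shows "\<bar>g s - g t\<bar> \<le> \<bar>\<sigma>\<bar> * \<bar>s - t\<bar>"
proof -
  have main: "\<bar>g s - g t\<bar> \<le> \<bar>\<sigma>\<bar> * \<bar>s - t\<bar>" if st: "0 \<le> s" "s < t" for s t
  proof -
    have "\<sigma> * (t - s) \<le> g t - g s"
    proof (cases "s \<le> c")
      case True
      then show ?thesis using left[of s] \<sigma>[of t] st by (simp add: algebra_simps)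
    next
      case False
      have "(g c - g s) / (c - s) \<le> (g c - g t) / (c - t)" "(g c - g t) / (c - t) \<le> (g s - g t) / (s - t)"
        using convex_on_slope_le[OF convex_coneD(3)[OF g], of c t s] c False st by auto
      moreover have "\<sigma> \<le> (g c - g s) / (c - s)" using \<sigma>[of s] False st by (simp add: field_simps)
      ultimately have "\<sigma> \<le> (g s - g t) / (s - t)" by linarith
      then show ?thesis using st by (simp add: field_simps)
    qed
    moreover have "g t \<le> g s" using convex_cone_antimono[OF g, of s t] st by simp
    moreover have "- \<bar>\<sigma>\<bar> * (t - s) \<le> \<sigma> * (t - s)" using st by (intro mult_right_mono) auto
    ultimately show ?thesis using st by simp
  qed
  show ?thesis using main[of s t] main[of t s] st by (cases s t rule: linorder_cases) (auto simp: abs_minus_commute)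
qed

text \<open>A value of modulus eta stays above eta/2 on an interval of length eta / (2L), which
  contributes eta^3 / (8L) to the integral. Thus convergence in mean square becomes pointwise
  convergence.\<close>

lemma lipschitz_L2_pointwise:
  fixes h :: "real \<Rightarrow> real"
  assumes int: "set_integrable lborel {0..} (\<lambda>t. (h t)\<^sup>2)" and L: "0 < L"
    and lip: "\<And>s t. 0 \<le> s \<Longrightarrow> 0 \<le> t \<Longrightarrow> \<bar>h s - h t\<bar> \<le> L * \<bar>s - t\<bar>" and t: "0 \<le> t"
  shows "\<bar>h t\<bar> ^ 3 \<le> 8 * L * (LINT t:{0..}|lborel. (h t)\<^sup>2)"
proof -
  define \<eta> where "\<eta> = \<bar>h t\<bar>"
  have "(\<eta> / 2)\<^sup>2 * ((t + \<eta> / (2 * L)) - t) \<le> (LINT t:{0..}|lborel. (h t)\<^sup>2)"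
  proof (rule set_integral_ge_const[OF int _ t])
    fix u assume u: "t \<le> u" "u \<le> t + \<eta> / (2 * L)"
    have "L * (u - t) \<le> \<eta> / 2" using u L by (simp add: field_simps)
    then have "\<eta> / 2 \<le> \<bar>h u\<bar>" using lip[of u t] u t by (simp add: \<eta>_def)
    then have "(\<eta> / 2)\<^sup>2 \<le> \<bar>h u\<bar>\<^sup>2" by (intro power_mono) (auto simp: \<eta>_def)
    then show "(\<eta> / 2)\<^sup>2 \<le> (h u)\<^sup>2" by simp
  qed (use L in \<open>auto simp: \<eta>_def\<close>)
  then have "\<eta> ^ 3 / (8 * L) \<le> (LINT t:{0..}|lborel. (h t)\<^sup>2)"
    by (simp add: power2_eq_square power3_eq_cube field_simps)
  then show ?thesis using L by (simp add: \<eta>_def field_simps)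
qed

context
  fixes n :: nat and x :: "nat \<Rightarrow> real" and x1 x2 :: real
  assumes n: "0 < n" and x1: "0 < x1" and x12: "\<And>i. i < n \<Longrightarrow> x1 \<le> x i \<and> x i \<le> x2" and x2: "0 < x2"
begin

abbreviation mean :: "(real \<Rightarrow> real) \<Rightarrow> real" where
  "mean g \<equiv> (\<Sum>i<n. g (x i)) / n"

lemma ls_criterion_formula:
  assumes "g \<in> convex_cone"
  shows "ls_criterion n x g = 1/2 * (LINT t:{0..}|lborel. (g t)\<^sup>2) - mean g"
  using ls_criterion_convex_cone[OF n _ assms, of x] x1 x12 by fastforce

lemma mean_le:
  assumes "\<And>i. i < n \<Longrightarrow> g (x i) \<le> (c::real)"
  shows "mean g \<le> c"
proof -
  have "(\<Sum>i<n. g (x i)) \<le> (\<Sum>i<n. c)" using assms by (intro sum_mono) auto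
  then show ?thesis using n by (simp add: field_simps)
qed

text \<open>All observations are at least \<open>x1\<close> and g decreases, so the mean is at most
  g x1, whereas the integral of the square is at least x1 * (g x1)^2. The quadratic term therefore
  limits g x1. Positivity of the sample is what bounds the criterion from below.\<close>

lemma ls_criterion_nonpos_bounds:
  assumes g: "g \<in> convex_cone" and le: "ls_criterion n x g \<le> 0"
  shows "g x1 \<le> 2 / x1" "(LINT t:{0..}|lborel. (g t)\<^sup>2) \<le> 4 / x1"
proof -
  note gc = convex_coneD[OF g]
  have "mean g \<le> g x1"
    using convex_cone_antimono[OF g] x1 x12 by (intro mean_le) auto
  moreover have "1/2 * (LINT t:{0..}|lborel. (g t)\<^sup>2) - mean g \<le> 0"
    using le by (simp only: ls_criterion_formula[OF g])
  ultimately have 1: "(LINT t:{0..}|lborel. (g t)\<^sup>2) \<le> 2 * g x1" by linarith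
  have "(g x1)\<^sup>2 * (x1 - 0) \<le> (LINT t:{0..}|lborel. (g t)\<^sup>2)"
    using convex_cone_mult_integrable[OF g g] x1 gc(1) convex_cone_antimono[OF g]
    by (intro set_integral_ge_const) (auto simp: power2_eq_square intro!: mult_mono)
  with 1 have "g x1 * (g x1 * x1) \<le> g x1 * 2" by (simp add: power2_eq_square mult_ac)
  then have "g x1 * x1 \<le> 2 \<or> g x1 = 0" using gc(1)[of x1] x1 by (auto simp: mult_le_cancel_left)
  then show 2: "g x1 \<le> 2 / x1" using x1 by (auto simp: field_simps)
  then show "(LINT t:{0..}|lborel. (g t)\<^sup>2) \<le> 4 / x1" using 1 by simp
qed

lemma ls_criterion_lower:
  assumes g: "g \<in> convex_cone"
  shows "- (2 / x1) \<le> ls_criterion n x g"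
proof (cases "ls_criterion n x g \<le> 0")
  case True
  have "mean g \<le> g x1"
    using convex_cone_antimono[OF g] x1 x12 by (intro mean_le) auto
  moreover have "0 \<le> (LINT t:{0..}|lborel. (g t)\<^sup>2)"
    unfolding set_lebesgue_integral_def by (intro Bochner_Integration.integral_nonneg) auto
  ultimately show ?thesis using ls_criterion_nonpos_bounds(1)[OF g True] by (simp add: ls_criterion_formula[OF g])
next
  case False
  then show ?thesis using x1 by (smt (verit) divide_pos_pos)
qed

text \<open>Below the smallest observation only the size of \<open>g\<close> counts, so the tangent at \<open>x1\<close> does better.\<close>

lemma ls_criterion_tame:
  assumes g: "g \<in> convex_cone" and le: "ls_criterion n x g \<le> 0"
  obtains h where "h \<in> convex_cone" "ls_criterion n x h \<le> ls_criterion n x g" "h 0 \<le> 8 / x1"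
    "\<And>s t. 0 \<le> s \<Longrightarrow> 0 \<le> t \<Longrightarrow> \<bar>h s - h t\<bar> \<le> 6 / x1\<^sup>2 * \<bar>s - t\<bar>"
proof -
  obtain \<sigma> where \<sigma>: "\<And>t. 0 \<le> t \<Longrightarrow> g x1 + \<sigma> * (t - x1) \<le> g t"
    using convex_on_support[OF convex_coneD(3)[OF g] x1] by auto
  define h where "h t = (if t \<le> x1 then g x1 + \<sigma> * (t - x1) else g t)" for t
  have h: "h \<in> convex_cone" unfolding h_def using g x1 \<sigma> by (rule convex_cone_tangent_left)
  note hc = convex_coneD[OF h]
  have hg: "h t \<le> g t" if "0 \<le> t" for t using \<sigma>[OF that] by (simp add: h_def)
  have "(LINT t:{0..}|lborel. (h t)\<^sup>2) \<le> (LINT t:{0..}|lborel. (g t)\<^sup>2)"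
    using convex_cone_mult_integrable[OF g g] convex_cone_mult_integrable[OF h h] hc(1) hg
    by (intro set_integral_mono) (auto simp: power2_eq_square intro!: mult_mono order_trans[OF hc(1) hg])
  moreover have "h (x i) = g (x i)" if "i < n" for i using x12[OF that] by (auto simp: h_def)
  ultimately have hle: "ls_criterion n x h \<le> ls_criterion n x g"
    by (simp add: ls_criterion_formula[OF h] ls_criterion_formula[OF g])
  note b = ls_criterion_nonpos_bounds[OF h order_trans[OF hle le]]
  have s: "\<sigma> \<le> 0"
    by (rule antimono_support_slope[OF \<sigma>]) (use convex_cone_antimono[OF g] x1 in auto)
  \<comment> \<open>On the left half of [0, x1] the tangent is at least |sigma| * x1 / 2. The bound
    4 / x1 for the integral of the square then gives (sigma * x1^2)^2 <= 32, rounded up to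
    36.\<close>
  have "(- \<sigma> * x1 / 2)\<^sup>2 * (x1 / 2 - 0) \<le> (LINT t:{0..}|lborel. (h t)\<^sup>2)"
  proof (rule set_integral_ge_const)
    show "set_integrable lborel {0..} (\<lambda>t. (h t)\<^sup>2)"
      using convex_cone_mult_integrable[OF h h] by (simp add: power2_eq_square)
    fix t assume t: "0 \<le> t" "t \<le> x1 / 2"
    have "\<sigma> * (x1 / 2 - x1) \<le> \<sigma> * (t - x1)" using s t by (intro mult_left_mono_neg) auto
    moreover have "0 \<le> g x1" using convex_coneD(1)[OF g] x1 by simp
    ultimately have "- \<sigma> * x1 / 2 \<le> h t" using t x1 by (simp add: h_def algebra_simps)
    then show "(- \<sigma> * x1 / 2)\<^sup>2 \<le> (h t)\<^sup>2" using s x1 by (intro power_mono) (auto simp: mult_nonpos_nonneg)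
  qed (use x1 in auto)
  then have "(- \<sigma> * x1 / 2)\<^sup>2 * (x1 / 2) \<le> 4 / x1" using b(2) by simp
  then have "(\<sigma> * x1\<^sup>2)\<^sup>2 \<le> 32" using x1 by (simp add: power2_eq_square field_simps)
  also have "\<dots> \<le> 6\<^sup>2" by simp
  finally have "\<bar>\<sigma> * x1\<^sup>2\<bar> \<le> 6" using abs_le_square_iff[of "\<sigma> * x1\<^sup>2" 6] by simp
  then have s6: "\<bar>\<sigma>\<bar> \<le> 6 / x1\<^sup>2" using x1 by (simp add: abs_mult field_simps)
  show ?thesis
  proof (rule that[OF h hle])
    have "\<bar>\<sigma>\<bar> * x1 \<le> 6 / x1\<^sup>2 * x1" using s6 x1 by (intro mult_right_mono) auto
    then have "- \<sigma> * x1 \<le> 6 / x1" using s x1 by (simp add: power2_eq_square)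
    moreover have "h x1 \<le> 2 / x1" by (rule b(1))
    ultimately show "h 0 \<le> 8 / x1" using x1 by (simp add: h_def)
    fix u t :: real assume ut: "0 \<le> u" "0 \<le> t"
    have "\<bar>h u - h t\<bar> \<le> \<bar>\<sigma>\<bar> * \<bar>u - t\<bar>"
      by (rule convex_cone_tangent_lipschitz[OF h x1]) (use \<sigma> ut in \<open>auto simp: h_def\<close>)
    also have "\<dots> \<le> 6 / x1\<^sup>2 * \<bar>u - t\<bar>" using s6 by (intro mult_right_mono) auto
    finally show "\<bar>h u - h t\<bar> \<le> 6 / x1\<^sup>2 * \<bar>u - t\<bar>" .
  qed
qed

text \<open>The midpoint of g and h cannot do better than I, and the criterion of the midpoint falls
  short of the average by exactly one eighth of the squared distance. Hence minimizing sequences are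
  Cauchy in mean square.\<close>

lemma ls_criterion_parallelogram:
  assumes g: "g \<in> convex_cone" and h: "h \<in> convex_cone"
    and lower: "\<And>w. w \<in> convex_cone \<Longrightarrow> I \<le> ls_criterion n x w"
  shows "set_integrable lborel {0..} (\<lambda>t. (g t - h t)\<^sup>2)"
    "(LINT t:{0..}|lborel. (g t - h t)\<^sup>2) \<le> 4 * ((ls_criterion n x g - I) + (ls_criterion n x h - I))"
proof -
  note ints = convex_cone_mult_integrable[OF g g] convex_cone_mult_integrable[OF h h] convex_cone_mult_integrable[OF g h]
  define A where "A = (LINT t:{0..}|lborel. g t * g t)"
  define B where "B = (LINT t:{0..}|lborel. h t * h t)"
  define C where "C = (LINT t:{0..}|lborel. g t * h t)"
  define S where "S w = mean w" for w :: "real \<Rightarrow> real"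
  have e1: "(\<lambda>t. (g t - h t)\<^sup>2) = (\<lambda>t. (g t * g t + h t * h t) - 2 * (g t * h t))"
    by (auto simp: power2_eq_square algebra_simps)
  show "set_integrable lborel {0..} (\<lambda>t. (g t - h t)\<^sup>2)"
    unfolding e1 using ints by (intro set_integral_diff set_integral_add set_integrable_mult_right) auto
  have d: "(LINT t:{0..}|lborel. (g t - h t)\<^sup>2) = A + B - 2 * C"
    unfolding e1 A_def B_def C_def using ints by (simp add: set_integral_add set_integral_diff)
  define w where "w t = 1/2 * g t + 1/2 * h t" for t
  have w: "w \<in> convex_cone" unfolding w_def by (intro convex_cone_add convex_cone_scale g h) auto
  have e2: "(\<lambda>t. (w t)\<^sup>2) = (\<lambda>t. 1/4 * (g t * g t) + (1/4 * (h t * h t) + 1/2 * (g t * h t)))"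
    by (auto simp: w_def power2_eq_square algebra_simps)
  have "(LINT t:{0..}|lborel. (w t)\<^sup>2) = 1/4 * A + (1/4 * B + 1/2 * C)"
    unfolding e2 A_def B_def C_def using ints
    by (subst set_integral_add, simp, simp, subst set_integral_add) simp_all
  moreover have "S w = 1/2 * S g + 1/2 * S h"
    by (simp add: S_def w_def sum.distrib add_divide_distrib flip: sum_divide_distrib)
  ultimately have "ls_criterion n x w = 1/2 * (1/4 * A + (1/4 * B + 1/2 * C)) - (1/2 * S g + 1/2 * S h)"
    by (simp add: ls_criterion_formula[OF w] S_def)
  moreover have "ls_criterion n x g = 1/2 * A - S g" "ls_criterion n x h = 1/2 * B - S h"
    by (simp_all add: ls_criterion_formula g h A_def B_def S_def power2_eq_square)
  moreover have "I \<le> ls_criterion n x w" by (rule lower[OF w])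
  ultimately show "(LINT t:{0..}|lborel. (g t - h t)\<^sup>2) \<le> 4 * ((ls_criterion n x g - I) + (ls_criterion n x h - I))"
    unfolding d by (simp add: field_simps)
qed

text \<open>The common Lipschitz constant upgrades the Cauchy property in mean square to every
  point. The bounds at 0 dominate the squares on bounded intervals only, so the estimate for the
  limit is stated on each [0, c] and integrability on the half-line is left open.\<close>

lemma minimizing_sequence_limit:
  fixes G :: "nat \<Rightarrow> real \<Rightarrow> real" and I :: real
  assumes G: "\<And>k. G k \<in> convex_cone" and crit: "\<And>k. ls_criterion n x (G k) < I + 1 / Suc k"
    and bound: "\<And>k. G k 0 \<le> B"
    and lip: "\<And>k s t. 0 \<le> s \<Longrightarrow> 0 \<le> t \<Longrightarrow> \<bar>G k s - G k t\<bar> \<le> L * \<bar>s - t\<bar>" and L: "0 < L"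
    and lower: "\<And>w. w \<in> convex_cone \<Longrightarrow> I \<le> ls_criterion n x w"
  obtains g where "convex_on {0..} g" "continuous_on {0..} g" "\<And>t. 0 \<le> t \<Longrightarrow> 0 \<le> g t"
    "\<And>s t. 0 \<le> s \<Longrightarrow> s \<le> t \<Longrightarrow> g t \<le> g s"
    "\<And>c. 0 \<le> c \<Longrightarrow> (LINT t:{0..c}|lborel. (g t)\<^sup>2) \<le> 2 * (I + mean g)"
proof -
  have cube: "\<bar>G j t - G k t\<bar> ^ 3 \<le> 64 * L * (1 / Suc j + 1 / Suc k)" if t: "0 \<le> t" for j k t
  proof -
    have "\<bar>G j t - G k t\<bar> ^ 3 \<le> 8 * (2 * L) * (LINT t:{0..}|lborel. (G j t - G k t)\<^sup>2)"
    proof (rule lipschitz_L2_pointwise[OF ls_criterion_parallelogram(1)[OF G G lower] _ _ t])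
      fix u v :: real assume "0 \<le> u" "0 \<le> v"
      then show "\<bar>G j u - G k u - (G j v - G k v)\<bar> \<le> 2 * L * \<bar>u - v\<bar>"
        using lip[of u v j] lip[of u v k] by simp
    qed (use L in auto)
    also have "\<dots> \<le> 8 * (2 * L) * (4 * (1 / Suc j + 1 / Suc k))"
      using ls_criterion_parallelogram(2)[OF G[of j] G[of k] lower] crit[of j] crit[of k] L
      by (intro mult_left_mono) auto
    also have "8 * (2 * L) * (4 * s) = 64 * L * s" for s by simp
    finally show ?thesis .
  qed
  have "Cauchy (\<lambda>k. G k t)" if t: "0 \<le> t" for t
  proof (rule CauchyI)
    fix e :: real assume e: "0 < e"
    obtain N where N: "128 * L / e ^ 3 < real N" using reals_Archimedean2 by blast
    have "\<bar>G j t - G k t\<bar> < e" if jk: "N \<le> j" "N \<le> k" for j k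
    proof (rule ccontr)
      assume "\<not> ?thesis"
      then have "e ^ 3 \<le> \<bar>G j t - G k t\<bar> ^ 3" using e by (intro power_mono) auto
      also have "\<dots> \<le> 64 * L * (1 / Suc j + 1 / Suc k)" by (rule cube[OF t])
      also have "\<dots> \<le> 64 * L * (1 / Suc N + 1 / Suc N)"
        using jk L by (intro mult_left_mono add_mono divide_left_mono) auto
      finally have "e ^ 3 * Suc N \<le> 128 * L" by (simp add: field_simps)
      moreover have "128 * L < e ^ 3 * N" using N e by (simp add: field_simps)
      moreover have "e ^ 3 * N \<le> e ^ 3 * Suc N" using e by (intro mult_left_mono) auto
      ultimately show False by simp
    qed
    then show "\<exists>M. \<forall>m\<ge>M. \<forall>n\<ge>M. norm (G m t - G n t) < e" by auto
  qed
  then have conv: "(\<lambda>k. G k t) \<longlonglongrightarrow> lim (\<lambda>k. G k t)" if "0 \<le> t" for t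
    using that Cauchy_convergent convergent_LIMSEQ_iff by blast
  define g where "g t = lim (\<lambda>k. G k t)" for t
  note conv = conv[folded g_def]
  have nn: "0 \<le> g t" if "0 \<le> t" for t
    by (rule LIMSEQ_le_const[OF conv[OF that]]) (use convex_coneD(1)[OF G that] in auto)
  have cvx: "convex_on {0..} g"
  proof (rule convex_onI)
    fix t u v :: real assume t: "0 < t" "t < 1" and uv: "u \<in> {0..}" "v \<in> {0..}"
    let ?w = "(1 - t) *\<^sub>R u + t *\<^sub>R v"
    have "0 \<le> ?w" using t uv by simp
    show "g ?w \<le> (1 - t) * g u + t * g v"
    proof (rule LIMSEQ_le[OF conv[OF \<open>0 \<le> ?w\<close>]])
      show "(\<lambda>k. (1 - t) * G k u + t * G k v) \<longlonglongrightarrow> (1 - t) * g u + t * g v"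
        using uv by (intro tendsto_intros conv) auto
      show "\<exists>N. \<forall>k\<ge>N. G k ?w \<le> (1 - t) * G k u + t * G k v"
        using convex_onD[OF convex_coneD(3)[OF G], of t u v] t uv by auto
    qed
  qed auto
  have mono: "g t \<le> g s" if "0 \<le> s" "s \<le> t" for s t
    by (rule LIMSEQ_le[OF conv conv]) (use that convex_cone_antimono[OF G that] in auto)
  have "L-lipschitz_on {0..} g"
  proof (rule lipschitz_onI)
    fix u v :: real assume uv: "u \<in> {0..}" "v \<in> {0..}"
    have "(\<lambda>k. \<bar>G k u - G k v\<bar>) \<longlonglongrightarrow> \<bar>g u - g v\<bar>" using uv by (intro tendsto_intros conv) auto
    then show "dist (g u) (g v) \<le> L * dist u v"
      unfolding dist_real_def by (rule LIMSEQ_le_const2) (use lip uv in auto)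
  qed (use L in auto)
  then have cont: "continuous_on {0..} g" by (rule lipschitz_on_continuous_on)
  have int: "(LINT t:{0..c}|lborel. (g t)\<^sup>2) \<le> 2 * (I + mean g)" if c: "0 \<le> c" for c
  proof (rule LIMSEQ_le)
    have meas: "(\<lambda>t. indicator {0..c} t *\<^sub>R (h t)\<^sup>2) \<in> borel_measurable lborel"
      if "continuous_on {0..} h" for h :: "real \<Rightarrow> real"
    proof -
      have "continuous_on {0..c} (\<lambda>t. (h t)\<^sup>2)"
        by (intro continuous_intros continuous_on_subset[OF that]) auto
      then show ?thesis
        using borel_measurable_continuous_on_indicator[of "{0..c}" "\<lambda>t. (h t)\<^sup>2"] by simp
    qed
    show "(\<lambda>k. LINT t:{0..c}|lborel. (G k t)\<^sup>2) \<longlonglongrightarrow> (LINT t:{0..c}|lborel. (g t)\<^sup>2)"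
      unfolding set_lebesgue_integral_def
    proof (rule integral_dominated_convergence[where w="\<lambda>t. indicator {0..c} t * B\<^sup>2"])
      have "set_integrable lborel {0..c} (\<lambda>t. B\<^sup>2)" by (rule borel_integrable_atLeastAtMost') simp
      then show "integrable lborel (\<lambda>t. indicator {0..c} t * B\<^sup>2)" by (simp add: set_integrable_def)
      show "AE t in lborel. (\<lambda>k. indicator {0..c} t *\<^sub>R (G k t)\<^sup>2) \<longlonglongrightarrow> indicator {0..c} t *\<^sub>R (g t)\<^sup>2"
        using conv by (intro AE_I2) (auto simp: indicator_def intro!: tendsto_intros)
      fix k
      have "(G k t)\<^sup>2 \<le> B\<^sup>2" if "0 \<le> t" for t
        using convex_coneD(1)[OF G that] convex_cone_antimono[OF G, of 0 t k] bound[of k] that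
        by (intro power_mono) auto
      then show "AE t in lborel. norm (indicator {0..c} t *\<^sub>R (G k t)\<^sup>2) \<le> indicator {0..c} t * B\<^sup>2"
        by (intro AE_I2) (auto simp: indicator_def)
    qed (use meas convex_coneD(2)[OF G] cont in auto)
    have "(\<lambda>k. 2 * (I + inverse (real (Suc k)) + mean (G k))) \<longlonglongrightarrow> 2 * (I + 0 + mean g)"
      using x1 x12 n by (intro tendsto_intros conv LIMSEQ_inverse_real_of_nat) fastforce+
    then show "(\<lambda>k. 2 * (I + inverse (real (Suc k)) + mean (G k))) \<longlonglongrightarrow> 2 * (I + mean g)"
      by simp
    have "(LINT t:{0..c}|lborel. (G k t)\<^sup>2) \<le> 2 * (I + inverse (real (Suc k)) + mean (G k))" for k
    proof -
      have i: "set_integrable lborel {0..} (\<lambda>t. (G k t)\<^sup>2)"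
        using convex_cone_mult_integrable[OF G G, of k k] by (simp add: power2_eq_square)
      then have "set_integrable lborel {0..c} (\<lambda>t. (G k t)\<^sup>2)" by (rule set_integrable_subset) auto
      with i have "(LINT t:{0..c}|lborel. (G k t)\<^sup>2) \<le> (LINT t:{0..}|lborel. (G k t)\<^sup>2)"
        unfolding set_lebesgue_integral_def set_integrable_def by (intro integral_mono) (auto simp: indicator_def)
      moreover have "1/2 * (LINT t:{0..}|lborel. (G k t)\<^sup>2) - mean (G k) < I + 1 / Suc k"
        using crit[of k] by (simp only: ls_criterion_formula[OF G])
      ultimately show ?thesis unfolding inverse_eq_divide by argo
    qed
    then show "\<exists>N. \<forall>k\<ge>N. (LINT t:{0..c}|lborel. (G k t)\<^sup>2) \<le> 2 * (I + inverse (real (Suc k)) + mean (G k))"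
      by blast
  qed
  show ?thesis by (rule that[OF cvx cont nn mono int])
qed

text \<open>The limit of a minimizing sequence need not be integrable, but it may be replaced by its
  tangent beyond the largest observation.\<close>

lemma truncate_to_convex_cone:
  assumes g: "convex_on {0..} g" "continuous_on {0..} g" "\<And>t. 0 \<le> t \<Longrightarrow> 0 \<le> g t"
    and mono: "\<And>s t. 0 \<le> s \<Longrightarrow> s \<le> t \<Longrightarrow> g t \<le> g s"
    and int: "\<And>c. 0 \<le> c \<Longrightarrow> (LINT t:{0..c}|lborel. (g t)\<^sup>2) \<le> 2 * (I + mean g)"
  obtains h where "h \<in> convex_cone" "ls_criterion n x h \<le> I"
proof -
  obtain \<sigma> where \<sigma>: "\<And>t. 0 \<le> t \<Longrightarrow> g x2 + \<sigma> * (t - x2) \<le> g t"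
    using convex_on_support[OF g(1) x2] by auto
  define T where "T t = g x2 + \<sigma> * (t - x2)" for t
  define u where "u t = g t - T t" for t
  have s: "\<sigma> \<le> 0" by (rule antimono_support_slope[OF \<sigma>]) (use mono x2 in auto)
  \<comment> \<open>The tangent at \<open>x2\<close> must become nonpositive. If it is horizontal,
    then g >= g x2 to the right, and the bounded integrals of the square force g x2 = 0; otherwise
    the line crosses zero.\<close>
  obtain c where c: "x2 \<le> c" "\<And>t. c \<le> t \<Longrightarrow> T t \<le> 0"
  proof (cases "\<sigma> = 0")
    case True
    define J where "J = 2 * (I + mean g)"
    have "(g x2)\<^sup>2 * (c - x2) \<le> J" if c: "x2 \<le> c" for c
    proof -
      have i: "set_integrable lborel {0..c} (\<lambda>t. (g t)\<^sup>2)"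
        using g(2) by (intro borel_integrable_atLeastAtMost' continuous_intros) (auto elim: continuous_on_subset)
      have "(g x2)\<^sup>2 * (c - x2) = (LINT t:{x2..c}|lborel. (g x2)\<^sup>2)"
        using c by (simp add: set_lebesgue_integral_def)
      also have "\<dots> \<le> (LINT t:{x2..c}|lborel. (g t)\<^sup>2)"
      proof (rule set_integral_mono[OF borel_integrable_atLeastAtMost'])
        show "set_integrable lborel {x2..c} (\<lambda>t. (g t)\<^sup>2)" using i by (rule set_integrable_subset) (use x2 in auto)
        fix t assume "t \<in> {x2..c}"
        then show "(g x2)\<^sup>2 \<le> (g t)\<^sup>2" using \<sigma>[of t] True x2 g(3)[of x2] by (intro power_mono) auto
      qed simp
      also have "\<dots> \<le> (LINT t:{0..c}|lborel. (g t)\<^sup>2)"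
        using i set_integrable_subset[OF i, of "{x2..c}"] x2
        unfolding set_lebesgue_integral_def set_integrable_def by (intro integral_mono) (auto simp: indicator_def)
      also have "\<dots> \<le> J" unfolding J_def by (rule int) (use c x2 in simp)
      finally show ?thesis .
    qed
    from this[of "x2 + (\<bar>J\<bar> + 1) / (g x2)\<^sup>2"] have "g x2 = 0"
      by (cases "g x2 = 0") auto
    then show ?thesis using that[of x2] True by (simp add: T_def)
  next
    case False
    then have s: "\<sigma> < 0" using s by simp
    show ?thesis
    proof (rule that[of "x2 + g x2 / (- \<sigma>)"])
      show "x2 \<le> x2 + g x2 / (- \<sigma>)" using s g(3)[of x2] x2 by (simp add: divide_nonneg_neg)
      fix t assume "x2 + g x2 / (- \<sigma>) \<le> t"
      then have "\<sigma> * (t - x2) \<le> \<sigma> * (g x2 / (- \<sigma>))" using s by (intro mult_left_mono_neg) auto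
      then show "T t \<le> 0" using s by (simp add: T_def)
    qed
  qed
  have Tg: "T t \<le> g t" if "0 \<le> t" for t using \<sigma>[OF that] by (simp add: T_def)
  have u: "convex_on {0..} u"
    using convex_on_diff_line[OF g(1)] by (simp add: u_def[abs_def] T_def)
  define h where "h t = max 0 (T t) + u (min t x2)" for t
  have h_left: "h t = g t" if "t \<le> x2" for t
  proof -
    have "0 \<le> \<sigma> * (t - x2)" using s that by (simp add: mult_nonpos_nonpos)
    then have "0 \<le> T t" using g(3)[of x2] x2 by (simp add: T_def)
    then show ?thesis using that by (simp add: h_def u_def)
  qed
  have h_right: "h t = max 0 (T t)" if "x2 \<le> t" for t using that by (simp add: h_def u_def T_def)
  have cu: "convex_on {0..} (\<lambda>t. u (min t x2))"
    by (rule convex_on_clip_left[OF u]) (use Tg x2 in \<open>auto simp: u_def T_def\<close>)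
  have cT: "convex_on {0..} (\<lambda>t. 0 + 0 * t :: real)" "convex_on {0..} (\<lambda>t. (g x2 - \<sigma> * x2) + \<sigma> * t)"
    by (intro convex_on_affine; simp)+
  have 1: "convex_on {0..} h"
    by (rule convex_on_eqI[OF convex_on_add[OF convex_on_max[OF cT] cu]]) (simp add: h_def T_def algebra_simps)
  have 2: "continuous_on {0..} h"
    unfolding h_def u_def T_def using x2
    by (intro continuous_intros continuous_on_compose2[OF g(2)]) auto
  have h0: "0 \<le> h t" "h t \<le> g t" if "0 \<le> t" for t
    using h_left[of t] h_right[of t] g(3)[OF that] Tg[OF that] by (cases "t \<le> x2"; auto)+
  have hc: "h t = 0" if "c \<le> t" for t using h_right[of t] c that by simp
  have h: "h \<in> convex_cone"
    using 1 2 h0(1) set_integrable_compact_support[OF 2 hc] by (simp add: convex_cone_def)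
  have "(LINT t:{0..}|lborel. (h t)\<^sup>2) = (LINT t:{0..c}|lborel. (h t)\<^sup>2)"
    unfolding set_lebesgue_integral_def by (rule Bochner_Integration.integral_cong) (auto simp: indicator_def hc)
  also have "\<dots> \<le> (LINT t:{0..c}|lborel. (g t)\<^sup>2)"
    using 2 g(2) h0
    by (intro set_integral_mono borel_integrable_atLeastAtMost' continuous_intros power_mono)
      (auto elim: continuous_on_subset)
  also have "\<dots> \<le> 2 * (I + mean g)" using int[of c] c x2 by simp
  also have "(\<Sum>i<n. g (x i)) = (\<Sum>i<n. h (x i))" using x12 h_left by (intro sum.cong) auto
  finally have "ls_criterion n x h \<le> I" by (simp add: ls_criterion_formula[OF h])
  then show ?thesis using that h by blast
qed

text \<open>If the criterion is never negative, the zero function is optimal. Otherwise the infimum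
  is negative and a minimizing sequence can be kept where the criterion is nonpositive, as the a
  priori bounds require.\<close>

lemma ls_criterion_minimizer:
  obtains f where "f \<in> convex_cone" "\<And>g. g \<in> convex_cone \<Longrightarrow> ls_criterion n x f \<le> ls_criterion n x g"
proof (cases "\<forall>g\<in>convex_cone. 0 \<le> ls_criterion n x g")
  case True
  have z: "(\<lambda>t. 0) \<in> convex_cone" using convex_cone_scale[OF hinge_in_convex_cone, of 0] by simp
  show ?thesis by (rule that[OF z]) (use True ls_criterion_formula[OF z] in simp)
next
  case False
  define I where "I = (INF g\<in>convex_cone. ls_criterion n x g)"
  have bdd: "bdd_below (ls_criterion n x ` convex_cone)"
    using ls_criterion_lower by (intro bdd_belowI[of _ "- (2 / x1)"]) auto
  have lower: "I \<le> ls_criterion n x w" if "w \<in> convex_cone" for w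
    unfolding I_def by (rule cINF_lower[OF bdd that])
  from False obtain w where w: "w \<in> convex_cone" "ls_criterion n x w < 0" by force
  have I0: "I < 0" using lower[OF w(1)] w(2) by simp
  have "\<exists>h. h \<in> convex_cone \<and> ls_criterion n x h < I + 1 / Suc k \<and> h 0 \<le> 8 / x1 \<and>
      (\<forall>s t. 0 \<le> s \<longrightarrow> 0 \<le> t \<longrightarrow> \<bar>h s - h t\<bar> \<le> 6 / x1\<^sup>2 * \<bar>s - t\<bar>)" for k
  proof -
    have "Inf (ls_criterion n x ` convex_cone) < min 0 (I + 1 / Suc k)" using I0 by (simp add: I_def)
    moreover have "ls_criterion n x ` convex_cone \<noteq> {}" using w by auto
    ultimately obtain g where g: "g \<in> convex_cone" "ls_criterion n x g < min 0 (I + 1 / Suc k)"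
      using cInf_lessD[of "ls_criterion n x ` convex_cone"] by blast
    then have "ls_criterion n x g \<le> 0" by simp
    then obtain h where "h \<in> convex_cone" "ls_criterion n x h \<le> ls_criterion n x g" "h 0 \<le> 8 / x1"
      "\<And>s t. 0 \<le> s \<Longrightarrow> 0 \<le> t \<Longrightarrow> \<bar>h s - h t\<bar> \<le> 6 / x1\<^sup>2 * \<bar>s - t\<bar>"
      using ls_criterion_tame[OF g(1)] by blast
    then show ?thesis using g by (intro exI[of _ h]) auto
  qed
  then have "\<forall>k. \<exists>h. h \<in> convex_cone \<and> ls_criterion n x h < I + 1 / Suc k \<and> h 0 \<le> 8 / x1 \<and>
      (\<forall>s t. 0 \<le> s \<longrightarrow> 0 \<le> t \<longrightarrow> \<bar>h s - h t\<bar> \<le> 6 / x1\<^sup>2 * \<bar>s - t\<bar>)" by blast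
  from choice[OF this] obtain G where G: "\<And>k. G k \<in> convex_cone" "\<And>k. ls_criterion n x (G k) < I + 1 / Suc k"
    "\<And>k. G k 0 \<le> 8 / x1"
    "\<And>k s t. 0 \<le> s \<Longrightarrow> 0 \<le> t \<Longrightarrow> \<bar>G k s - G k t\<bar> \<le> 6 / x1\<^sup>2 * \<bar>s - t\<bar>"
    by blast
  have "0 < 6 / x1\<^sup>2" using x1 by simp
  from minimizing_sequence_limit[OF G this lower] obtain g where
    "convex_on {0..} g" "continuous_on {0..} g" "\<And>t. 0 \<le> t \<Longrightarrow> 0 \<le> g t"
    "\<And>s t. 0 \<le> s \<Longrightarrow> s \<le> t \<Longrightarrow> g t \<le> g s"
    "\<And>c. 0 \<le> c \<Longrightarrow> (LINT t:{0..c}|lborel. (g t)\<^sup>2) \<le> 2 * (I + mean g)"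
    by blast
  from truncate_to_convex_cone[OF this] obtain h where h: "h \<in> convex_cone" "ls_criterion n x h \<le> I" by blast
  show ?thesis by (rule that[OF h(1)]) (use h(2) lower order_trans in blast)
qed

end

lemma convex_lse_minimizes:
  assumes n: "0 < n" and x: "\<And>i. i < n \<Longrightarrow> 0 < x i"
  shows "convex_lse n x \<in> convex_cone"
    "\<And>g. g \<in> convex_cone \<Longrightarrow> ls_criterion n x (convex_lse n x) \<le> ls_criterion n x g"
proof -
  define x1 x2 where "x1 = Min (x ` {..<n})" and "x2 = Max (x ` {..<n})"
  have fin: "finite (x ` {..<n})" "x ` {..<n} \<noteq> {}" using n by auto
  have x12: "x1 \<le> x i \<and> x i \<le> x2" if "i < n" for i using fin that by (auto simp: x1_def x2_def)
  have x1: "0 < x1" unfolding x1_def using fin x by (subst Min_gr_iff) auto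
  have x2: "0 < x2" using x12[of 0] x1 n by auto
  obtain f where f: "f \<in> convex_cone" "\<And>g. g \<in> convex_cone \<Longrightarrow> ls_criterion n x f \<le> ls_criterion n x g"
    using ls_criterion_minimizer[where n=n and x=x, OF n x1 x12 x2] by blast
  then have "is_arg_min (ls_criterion n x) (\<lambda>g. g \<in> convex_cone) f" by (simp add: is_arg_min_linorder)
  then have "is_arg_min (ls_criterion n x) (\<lambda>g. g \<in> convex_cone) (convex_lse n x)"
    unfolding convex_lse_def arg_min_on_def arg_min_def 
    by (rule someI[of "is_arg_min (ls_criterion n x) (\<lambda>g. g \<in> convex_cone)"])
  then show "convex_lse n x \<in> convex_cone"
    "\<And>g. g \<in> convex_cone \<Longrightarrow> ls_criterion n x (convex_lse n x) \<le> ls_criterion n x g"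
    by (simp_all add: is_arg_min_linorder)
qed

subsection \<open>Integrated distribution functions at contact points\<close>

text \<open>A gauge integral, equal to 0 for negative s because the interval is empty; so
  \<open>cum f0\<close> is the distribution function on the whole line.\<close>

definition cum :: "(real \<Rightarrow> real) \<Rightarrow> real \<Rightarrow> real" where
  "cum f s = integral {0..s} f"

lemma cum_0 [simp]: "cum f 0 = 0"
  by (simp add: cum_def)

lemma cum_cont:
  assumes "f integrable_on {0..b}"
  shows "continuous_on {0..b} (cum f)"
  using indefinite_integral_continuous_1[OF assms] by (simp add: cum_def[abs_def])

lemma cum_deriv:
  assumes "f integrable_on {0..b}" "0 < s" "s < b" "isCont f s"
  shows "(cum f has_real_derivative f s) (at s)"
proof -
  have "((\<lambda>u. integral {0..u} f) has_vector_derivative f s) (at s within {0..b} - {})"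
    using assms by (intro integral_has_vector_derivative_continuous_at) (auto intro: continuous_at_imp_continuous_at_within)
  moreover have "at s within {0..b} = at s" using assms by (intro at_within_Icc_at) auto
  ultimately show ?thesis by (simp add: cum_def[abs_def] has_real_derivative_iff_has_vector_derivative)
qed

lemma isCont_of_continuous_on_nonneg:
  fixes f :: "real \<Rightarrow> real"
  assumes "continuous_on {0..} f" "0 < s"
  shows "isCont f s"
  using assms by (intro continuous_on_interior[of "{0..}"]) auto

lemma cum_cum_deriv:
  assumes f: "f integrable_on {0..b}" and s: "0 < s" "s < b"
  shows "(cum (cum f) has_real_derivative cum f s) (at s)"
proof (rule cum_deriv[OF _ s])
  show "cum f integrable_on {0..b}" by (rule integrable_continuous_real[OF cum_cont[OF f]])
  show "isCont (cum f) s"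
    by (rule continuous_on_interior[OF cum_cont[OF f]]) (use s in simp)
qed

lemma cum_cum_cont:
  assumes "f integrable_on {0..b}"
  shows "continuous_on {0..b} (cum (cum f))"
  by (rule cum_cont[OF integrable_continuous_real[OF cum_cont[OF assms]]])

text \<open>Integration by parts: \<open>W\<close> is an antiderivative of f t * (s - t), with W s -
  W 0 the iterated integral.\<close>

lemma hinge_integral:
  fixes f :: "real \<Rightarrow> real"
  assumes f: "continuous_on {0..} f" and s: "0 \<le> s"
  shows "(LINT t:{0..}|lborel. f t * max 0 (s - t)) = cum (cum f) s"
proof -
  have int: "f integrable_on {0..b}" for b
    using f by (intro integrable_continuous_real) (auto elim: continuous_on_subset)
  define W where "W t = (s - t) * cum f t + cum (cum f) t" for t
  have "((\<lambda>t. f t * (s - t)) has_integral (W s - W 0)) {0..s}"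
  proof (rule fundamental_theorem_of_calculus_interior[OF s])
    show "continuous_on {0..s} W" unfolding W_def
      by (intro continuous_intros cum_cont[OF int] cum_cum_cont[OF int])
    fix t assume t: "t \<in> {0<..<s}"
    have "(cum f has_real_derivative f t) (at t)"
      using t by (intro cum_deriv[OF int[of s]] isCont_of_continuous_on_nonneg[OF f]) auto
    moreover have "(cum (cum f) has_real_derivative cum f t) (at t)"
      using t by (intro cum_cum_deriv[OF int[of s]]) auto
    ultimately have "(W has_real_derivative f t * (s - t)) (at t)"
      unfolding W_def by (auto intro!: derivative_eq_intros)
    then show "(W has_vector_derivative f t * (s - t)) (at t)"
      by (simp add: has_real_derivative_iff_has_vector_derivative)
  qed
  then have hi: "integral {0..s} (\<lambda>t. f t * (s - t)) = cum (cum f) s"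
    by (simp add: W_def integral_unique)
  have "set_integrable lborel {0..s} (\<lambda>t. f t * (s - t))"
    using f by (intro borel_integrable_atLeastAtMost' continuous_intros) (auto elim: continuous_on_subset)
  from set_borel_integral_eq_integral(2)[OF this]
  have "(LINT t:{0..s}|lborel. f t * (s - t)) = cum (cum f) s" by (simp add: hi)
  moreover have "(LINT t:{0..}|lborel. f t * max 0 (s - t)) = (LINT t:{0..s}|lborel. f t * (s - t))"
    unfolding set_lebesgue_integral_def by (rule Bochner_Integration.integral_cong) (auto simp: indicator_def)
  ultimately show ?thesis by simp
qed

lemma nonpos_of_le_mult_all_pos:
  fixes A c :: real
  assumes "\<And>h. 0 < h \<Longrightarrow> A \<le> c * h"
  shows "A \<le> 0"
proof (rule field_le_epsilon)
  fix e :: real assume e: "0 < e"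
  have "A \<le> c * (e / (\<bar>c\<bar> + 1))" using e by (intro assms) auto
  also have "\<dots> \<le> (\<bar>c\<bar> + 1) * (e / (\<bar>c\<bar> + 1))" using e by (intro mult_right_mono) auto
  finally show "A \<le> 0 + e" by simp
qed

context lse
begin

lemma f_integrable: "f integrable_on {0..b}"
  using convex_coneD(2)[OF f] by (intro integrable_continuous_real) (auto elim: continuous_on_subset)

lemma f_isCont: "0 < s \<Longrightarrow> isCont f s"
  by (rule isCont_of_continuous_on_nonneg[OF convex_coneD(2)[OF f]])

definition sample_hinge :: "real \<Rightarrow> real" where
  "sample_hinge s = sample_mean (\<lambda>t. max 0 (s - t))"

lemma gap_eq: "0 \<le> s \<Longrightarrow> gap s = cum (cum f) s - sample_hinge s"
  unfolding gap_def f_inner_def sample_hinge_def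
  by (subst hinge_integral) (auto intro: convex_coneD[OF f])

lemma sample_hinge_cont: "continuous_on A sample_hinge"
  unfolding sample_hinge_def sample_mean_def using n by (intro continuous_intros) auto

lemma gap_cont: "continuous_on {0..b} gap"
proof -
  have "continuous_on {0..b} (\<lambda>s. cum (cum f) s - sample_hinge s)"
    by (intro continuous_intros cum_cum_cont[OF f_integrable] sample_hinge_cont)
  then show ?thesis by (rule continuous_on_eq) (simp add: gap_eq)
qed

lemma contacts_compact: "compact (contacts \<inter> {..b})"
proof -
  have "closed ({0..b} \<inter> gap -` {0})" by (rule continuous_closed_preimage[OF gap_cont]) auto
  then have "compact ({0..b} \<inter> ({0..b} \<inter> gap -` {0}))" by (intro compact_Int_closed) auto
  moreover have "{0..b} \<inter> ({0..b} \<inter> gap -` {0}) = contacts \<inter> {..b}" by (auto simp: contacts_def)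
  ultimately show ?thesis by simp
qed

lemma zero_contact: "0 \<in> contacts"
  using x_pos by (auto simp: contacts_def gap_eq sample_hinge_def sample_mean_def less_imp_le intro!: sum.neutral)

lemma ecdf_eq: "ecdf n x s = sample_mean (\<lambda>t. if t \<le> s then 1 else 0)"
proof -
  have "(\<Sum>i<n. if x i \<le> s then 1 else 0 :: real) = card {i \<in> {..<n}. x i \<le> s}"
    by (simp add: sum.If_cases Int_def flip: sum.inter_filter)
  then show ?thesis by (simp add: ecdf_def sample_mean_def)
qed

lemma ecdf_le_1: "ecdf n x s \<le> 1"
proof -
  have "ecdf n x s \<le> sample_mean (\<lambda>t. 1)" unfolding ecdf_eq by (rule sample_mean_mono) auto
  then show ?thesis by (simp add: sample_mean_const)
qed

lemma ecdf_0: "ecdf n x 0 = 0"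
  using x_pos by (auto simp: ecdf_def not_le[symmetric] card_eq_0_iff dest: x_pos)

lemma sample_hinge_increment:
  assumes "s \<le> t"
  shows "(t - s) * ecdf n x s \<le> sample_hinge t - sample_hinge s"
    "sample_hinge t - sample_hinge s \<le> (t - s) * ecdf n x t"
proof -
  have "sample_mean (\<lambda>u. (t - s) * (if u \<le> s then 1 else 0) + max 0 (s - u)) \<le> sample_hinge t"
    unfolding sample_hinge_def by (rule sample_mean_mono) (use assms in \<open>auto simp: max_def\<close>)
  then show "(t - s) * ecdf n x s \<le> sample_hinge t - sample_hinge s"
    by (simp add: sample_mean_add sample_mean_cmult ecdf_eq sample_hinge_def)
  have "sample_hinge t \<le> sample_mean (\<lambda>u. (t - s) * (if u \<le> t then 1 else 0) + max 0 (s - u))"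
    unfolding sample_hinge_def by (rule sample_mean_mono) (use assms in \<open>auto simp: max_def\<close>)
  then show "sample_hinge t - sample_hinge s \<le> (t - s) * ecdf n x t"
    by (simp add: sample_mean_add sample_mean_cmult ecdf_eq sample_hinge_def)
qed

lemma cum_f_increment:
  assumes "0 \<le> s" "s \<le> t"
  shows "0 \<le> cum f t - cum f s" "cum f t - cum f s \<le> f 0 * (t - s)"
proof -
  have c: "continuous_on {s..t} (cum f)"
    by (rule continuous_on_subset[OF cum_cont[OF f_integrable[of t]]]) (use assms in auto)
  have d: "(cum f has_real_derivative f u) (at u)" if "s < u" "u < t" for u
    using that assms by (intro cum_deriv[OF f_integrable[of t]] f_isCont) auto
  have "0 * (t - s) \<le> cum f t - cum f s"
    by (rule mvt_lower[OF assms(2) c d]) (use assms convex_coneD(1)[OF f] in auto)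
  then show "0 \<le> cum f t - cum f s" by simp
  have "(- f 0) * (t - s) \<le> (- cum f t) - (- cum f s)"
    by (rule mvt_lower[OF assms(2) _ DERIV_minus[OF d]])
      (use assms c convex_cone_antimono[OF f, of 0] in \<open>auto intro!: continuous_intros\<close>)
  then show "cum f t - cum f s \<le> f 0 * (t - s)" by simp
qed

lemma cum_cum_increment:
  assumes "0 \<le> s" "s \<le> t"
  shows "(t - s) * cum f s \<le> cum (cum f) t - cum (cum f) s"
    "cum (cum f) t - cum (cum f) s \<le> (t - s) * cum f t"
proof -
  have c: "continuous_on {s..t} (cum (cum f))"
    by (rule continuous_on_subset[OF cum_cum_cont[OF f_integrable[of t]]]) (use assms in auto)
  have d: "(cum (cum f) has_real_derivative cum f u) (at u)" if "s < u" "u < t" for u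
    using that assms by (intro cum_cum_deriv[OF f_integrable[of t]]) auto
  have "cum f s * (t - s) \<le> cum (cum f) t - cum (cum f) s"
    by (rule mvt_lower[OF assms(2) c d]) (use assms cum_f_increment(1) in fastforce)+
  then show "(t - s) * cum f s \<le> cum (cum f) t - cum (cum f) s" by (simp add: mult.commute)
  have "(- cum f t) * (t - s) \<le> (- cum (cum f) t) - (- cum (cum f) s)"
    by (rule mvt_lower[OF assms(2) _ DERIV_minus[OF d]])
      (use assms c cum_f_increment(1)[of _ t] in \<open>auto intro!: continuous_intros\<close>)
  then show "cum (cum f) t - cum (cum f) s \<le> (t - s) * cum f t" by (simp add: mult.commute)
qed

text \<open>A contact is a minimum of the gap function, which may have corners at observations. Its
  increments to the right and to the left give one inequality each; at 0, where only the right side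
  exists, both distribution functions vanish.\<close>

lemma cum_f_contact:
  assumes "\<tau> \<in> contacts"
  shows "cum f \<tau> = ecdf n x \<tau>"
proof (rule antisym)
  have t: "0 \<le> \<tau>" "gap \<tau> = 0" using assms by (auto simp: contacts_def)
  have "ecdf n x \<tau> - cum f \<tau> \<le> f 0 * h" if h: "0 < h" for h
  proof -
    have "0 \<le> gap (\<tau> + h) - gap \<tau>" using gap_nonneg t by simp
    also have "\<dots> \<le> h * cum f (\<tau> + h) - h * ecdf n x \<tau>"
      using cum_cum_increment(2)[of \<tau> "\<tau> + h"] sample_hinge_increment(1)[of \<tau> "\<tau> + h"] t h
      by (simp add: gap_eq)
    finally have "ecdf n x \<tau> \<le> cum f (\<tau> + h)" using h by simp
    then show ?thesis using cum_f_increment(2)[of \<tau> "\<tau> + h"] t h by simp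
  qed
  then have "ecdf n x \<tau> - cum f \<tau> \<le> 0" by (rule nonpos_of_le_mult_all_pos)
  then show "ecdf n x \<tau> \<le> cum f \<tau>" by simp
  show "cum f \<tau> \<le> ecdf n x \<tau>"
  proof (cases "\<tau> = 0")
    case True then show ?thesis by (simp add: ecdf_0)
  next
    case False
    have "cum f \<tau> - ecdf n x \<tau> \<le> f 0 * h" if h: "0 < h" for h
    proof -
      define k where "k = min h \<tau>"
      have k: "0 < k" "k \<le> h" "k \<le> \<tau>" using h False t by (auto simp: k_def)
      have "0 \<le> gap (\<tau> - k) - gap \<tau>" using gap_nonneg t by simp
      also have "\<dots> \<le> k * ecdf n x \<tau> - k * cum f (\<tau> - k)"
        using cum_cum_increment(1)[of "\<tau> - k" \<tau>] sample_hinge_increment(2)[of "\<tau> - k" \<tau>] t k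
        by (simp add: gap_eq)
      finally have "cum f (\<tau> - k) \<le> ecdf n x \<tau>" using k by simp
      moreover have "f 0 * k \<le> f 0 * h" using k convex_coneD(1)[OF f, of 0] by (intro mult_left_mono) auto
      ultimately show ?thesis using cum_f_increment(2)[of "\<tau> - k" \<tau>] t k by simp
    qed
    then have "cum f \<tau> - ecdf n x \<tau> \<le> 0" by (rule nonpos_of_le_mult_all_pos)
    then show ?thesis by simp
  qed
qed

text \<open>\<open>f\<close> has integral at most one up to the next contact and vanishes beyond the last one,
  so a long affine stretch forces small values.\<close>

lemma small_of_no_contact:
  assumes y: "0 < y" "2 * y \<le> Z" and no: "contacts \<inter> {y..Z} = {}"
  obtains \<tau> where "\<tau> \<in> contacts" "\<tau> < y" "\<exists>p r. \<forall>s\<in>{\<tau>..Z}. f s = p + r * s"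
    "\<And>t. \<tau> \<le> t \<Longrightarrow> t \<le> Z \<Longrightarrow> f t \<le> 8 / (Z - y)"
proof -
  have "contacts \<inter> {..y} \<noteq> {}" using zero_contact y by auto
  then obtain \<tau> where t: "\<tau> \<in> contacts" "\<tau> \<le> y" "\<And>s. s \<in> contacts \<Longrightarrow> s \<le> y \<Longrightarrow> s \<le> \<tau>"
    using compact_attains_sup[OF contacts_compact[of y]] by auto
  have ty: "\<tau> < y" using t(1,2) no y by (cases "\<tau> = y") auto
  have t0: "0 \<le> \<tau>" using t(1) by (simp add: contacts_def)
  \<comment> \<open>On an affine stretch with nonnegative end value the midpoint keeps at least half
    of f y.\<close>
  have half: "f y / 2 \<le> f u" if u: "y \<le> u" "u \<le> (y + b) / 2" "Z \<le> b" "{\<tau><..<b} \<inter> contacts = {}" for u b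
  proof -
    obtain p r where pr: "\<And>s. s \<in> {\<tau>..b} \<Longrightarrow> f s = p + r * s"
      using affine_off_contacts[of \<tau> b] u y ty t0 by auto
    have "f ((y + b) / 2) = (f y + f b) / 2"
      using u y ty t0 by (simp add: pr field_simps)
    moreover have "0 \<le> f b" using convex_coneD(1)[OF f, of b] u y by simp
    moreover have "f ((y + b) / 2) \<le> f u" using convex_cone_antimono[OF f, of u] u y by simp
    ultimately show ?thesis by simp
  qed
  have sep: "{\<tau><..<Z} \<inter> contacts = {}" using t(3) no by (force simp: not_le)
  have v: "f y \<le> 4 / (Z - y)"
  proof (cases "\<exists>\<tau>'\<in>contacts. Z < \<tau>'")
    case True
    then obtain \<tau>' where t': "\<tau>' \<in> contacts" "Z < \<tau>'" by blast
    have c: "continuous_on {y..(y + Z) / 2} (cum f)"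
      by (rule continuous_on_subset[OF cum_cont[OF f_integrable[of Z]]]) (use y in auto)
    have "f y / 2 * ((y + Z) / 2 - y) \<le> cum f ((y + Z) / 2) - cum f y"
      by (rule mvt_lower[OF _ c, of f])
        (use y half[OF _ _ _ sep] in \<open>auto intro!: cum_deriv[OF f_integrable[of Z]] f_isCont\<close>)
    also have "\<dots> \<le> cum f \<tau>' - cum f 0"
      using cum_f_increment(1)[of "(y + Z) / 2" \<tau>'] cum_f_increment(1)[of 0 y] y t' by simp
    also have "\<dots> \<le> 1" using cum_f_contact[OF t'(1)] ecdf_le_1[of \<tau>'] by simp
    finally show ?thesis using y by (simp add: field_simps)
  next
    case False
    define J where "J = (LINT t:{0..}|lborel. f t)"
    \<comment> \<open>No contact lies beyond Z, so f is affine arbitrarily far. The total mass J is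
      not known to be at most one here; b is taken so far out that the factor 1 + |J|
      cancels.\<close>
    define b where "b = Z + \<bar>J\<bar> * (Z - y)"
    have b: "Z \<le> b" using y by (simp add: b_def)
    have "{\<tau><..<b} \<inter> contacts = {}" using False sep t(3) no by (force simp: not_le not_less)
    then have "f y / 2 * ((y + b) / 2 - y) \<le> J"
      unfolding J_def using y b half[of _ b] convex_coneD[OF f]
      by (intro set_integral_ge_const) auto
    then have "f y * (b - y) \<le> 4 * J" by (simp add: field_simps)
    also have "b - y = (1 + \<bar>J\<bar>) * (Z - y)" by (simp add: b_def algebra_simps)
    also have "4 * J \<le> 4 * (1 + \<bar>J\<bar>)" by simp
    finally have "(1 + \<bar>J\<bar>) * (f y * (Z - y)) \<le> (1 + \<bar>J\<bar>) * 4" by (simp add: mult_ac)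
    then have "f y * (Z - y) \<le> 4" by (subst (asm) mult_le_cancel_left_pos) auto
    then show ?thesis using y by (simp add: field_simps)
  qed
  obtain p r where pr: "\<forall>s\<in>{\<tau>..Z}. f s = p + r * s"
    using affine_off_contacts[OF t0 _ sep] ty y by auto
  have "f s \<le> 8 / (Z - y)" if s: "\<tau> \<le> s" "s \<le> Z" for s
  proof (cases "y \<le> s")
    case True
    have "f s \<le> f y" using convex_cone_antimono[OF f, of y s] True y by simp
    also have "\<dots> \<le> 4 / (Z - y)" by (rule v)
    also have "\<dots> \<le> 8 / (Z - y)" using y by (intro divide_right_mono) auto
    finally show ?thesis .
  next
    case False
    have fs: "f s = f y - r * (y - s)" "f Z = f y + r * (Z - y)"
      using pr s ty y by (auto simp: algebra_simps)
    \<comment> \<open>Going back from y to \<open>\<tau>\<close>, a distance at most y <= Z - y, the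
      affine piece rises by no more than f y, as it may fall by no more than f y from y to Z. This
      doubles 4 to 8.\<close>
    have "- r * (Z - y) \<le> f y" using fs(2) convex_coneD(1)[OF f, of Z] y by simp
    moreover have "- r * (y - s) \<le> max 0 (- r) * (Z - y)"
      using s t0 y False by (intro mult_mono) auto
    ultimately have "- r * (y - s) \<le> f y"
      using convex_coneD(1)[OF f, of y] y by (simp add: max_def split: if_splits)
    then show ?thesis using fs(1) v by simp
  qed
  then show ?thesis using that t ty pr by blast
qed

end

subsection \<open>Error curves of the estimator\<close>

text \<open>Reduces the form with curvature to the left of \<open>x0\<close> to the one with
  curvature to the right.\<close>

lemma contact_curve_reflect:
  assumes "contact_curve a b T d m g g1"
  shows "contact_curve b a (uminus ` T) (\<lambda>s. d (- s)) (\<lambda>s. m (- s)) (\<lambda>s. g (- s)) (\<lambda>s. - g1 (- s))"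
proof -
  interpret contact_curve a b T d m g g1 by (rule assms)
  show ?thesis
  proof
    show "0 < b" "0 < a" using ab by auto
    show "compact (uminus ` T)" using T(1) by (intro compact_continuous_image continuous_intros)
    show "uminus ` T \<subseteq> {- b..a}" "- b \<in> uminus ` T" "a \<in> uminus ` T" using T by force+
    show "convex_on {- b..a} (\<lambda>s. d (- s))" using convex_on_reflect[OF d_convex] by simp
    show "convex_on {- b<..<a} (\<lambda>s. m (- s))" using convex_on_reflect[OF m_convex] by simp
    show "continuous_on {- b..a} (\<lambda>s. g (- s))" "continuous_on {- b..a} (\<lambda>s. - g1 (- s))"
      by (intro continuous_intros continuous_on_compose2[OF cont_g] continuous_on_compose2[OF cont_g1]; auto)+
  next
    fix \<tau> \<tau>' assume t: "\<tau> \<in> uminus ` T" "\<tau>' \<in> uminus ` T" "{\<tau><..<\<tau>'} \<inter> uminus ` T = {}"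
    have "{- \<tau>'<..<- \<tau>} \<inter> T = {}"
    proof (rule equals0I)
      fix s assume "s \<in> {- \<tau>'<..<- \<tau>} \<inter> T"
      then have "- s \<in> {\<tau><..<\<tau>'} \<inter> uminus ` T" by auto
      then show False using t(3) by auto
    qed
    moreover have "- \<tau> \<in> T" "- \<tau>' \<in> T" using t(1,2) by auto
    ultimately obtain p r where pr: "\<forall>s\<in>{- \<tau>'..- \<tau>}. d s = p + r * s"
      using d_affine[of "- \<tau>'" "- \<tau>"] by blast
    then show "\<exists>p r. \<forall>s\<in>{\<tau>..\<tau>'}. d (- s) = p + r * s"
      by (intro exI[of _ p] exI[of _ "- r"]) auto
  next
    fix s assume s: "- b < s" "s < a"
    have "((\<lambda>s. g (- s)) has_real_derivative g1 (- s) * - 1) (at s)"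
      by (rule DERIV_chain2[OF deriv_g]) (use s in \<open>auto intro!: derivative_eq_intros\<close>)
    then show "((\<lambda>s. g (- s)) has_real_derivative - g1 (- s)) (at s)" by simp
    have "((\<lambda>s. g1 (- s)) has_real_derivative (d (- s) - m (- s)) * - 1) (at s)"
      by (rule DERIV_chain2[OF deriv_g1]) (use s in \<open>auto intro!: derivative_eq_intros\<close>)
    from DERIV_minus[OF this]
    show "((\<lambda>s. - g1 (- s)) has_real_derivative d (- s) - m (- s)) (at s)" by simp
  qed
qed

lemma noise_reflect:
  assumes c: "contact_curve a b T d m g g1" and n: "contact_curve.noise a b T g g1 L N"
  shows "contact_curve.noise b a (uminus ` T) (\<lambda>s. g (- s)) (\<lambda>s. - g1 (- s)) L N"
proof -
  interpret contact_curve a b T d m g g1 by (rule c)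
  interpret r: contact_curve b a "uminus ` T" "\<lambda>s. d (- s)" "\<lambda>s. m (- s)" "\<lambda>s. g (- s)" "\<lambda>s. - g1 (- s)"
    by (rule contact_curve_reflect[OF c])
  show ?thesis using n unfolding noise_def r.noise_def by auto
qed

section \<open>Empirical error centred at \<open>x0\<close> and the error curve of the
  estimator\<close>

definition emp_err :: "nat \<Rightarrow> (nat \<Rightarrow> real) \<Rightarrow> (real \<Rightarrow> real) \<Rightarrow> real \<Rightarrow> real" where
  "emp_err n x f0 t = ecdf n x t - cum f0 t"

text \<open>Only increments from \<open>x0\<close> are bounded, because these shrink with the scale
  L while the empirical error itself does not.\<close>

definition local_noise :: "nat \<Rightarrow> (nat \<Rightarrow> real) \<Rightarrow> (real \<Rightarrow> real) \<Rightarrow> real \<Rightarrow> real \<Rightarrow> real \<Rightarrow> bool" where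
  "local_noise n x f0 x0 L N \<longleftrightarrow>
    (\<forall>t\<ge>0. \<bar>t - x0\<bar> \<le> L \<longrightarrow> \<bar>emp_err n x f0 t - emp_err n x f0 x0\<bar> \<le> N)"

locale lse_truth = lse +
  fixes f0 :: "real \<Rightarrow> real" and x0 :: real
  assumes f0_nonneg: "\<And>t. 0 \<le> t \<Longrightarrow> 0 \<le> f0 t" and f0_convex: "convex_on {0..} f0"
    and f0_antimono: "\<And>s t. 0 \<le> s \<Longrightarrow> s \<le> t \<Longrightarrow> f0 t \<le> f0 s"
    and f0_integrable: "set_integrable lborel {0..} f0" and x0: "0 < x0"
begin

abbreviation U :: "real \<Rightarrow> real" where
  "U \<equiv> emp_err n x f0"

abbreviation near_noise :: "real \<Rightarrow> real \<Rightarrow> bool" where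
  "near_noise \<equiv> local_noise n x f0 x0"

definition iemp_err :: "real \<Rightarrow> real" where
  "iemp_err t = sample_hinge t - cum (cum f0) t"

lemma f0_integrable_on: "f0 integrable_on {0..b}"
proof -
  have "set_integrable lborel {0..b} f0" by (rule set_integrable_subset[OF f0_integrable]) auto
  then show ?thesis by (rule set_borel_integral_eq_integral(1))
qed

lemma f0_isCont:
  assumes "0 < s" shows "isCont f0 s"
proof -
  have "convex_on {0<..} f0" by (rule convex_on_subset[OF f0_convex]) auto
  then have "continuous_on {0<..} f0" by (intro convex_on_continuous) auto
  then show ?thesis by (rule continuous_on_interior) (use assms in \<open>simp add: interior_open\<close>)
qed

lemma sample_hinge_deriv:
  assumes "w \<notin> x ` {..<n}"
  shows "(sample_hinge has_real_derivative ecdf n x w) (at w)"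
proof -
  have "((\<lambda>s. max 0 (s - x i)) has_real_derivative (if x i \<le> w then 1 else 0)) (at w)" if i: "i < n" for i
  proof (cases "x i < w")
    case True
    have "((\<lambda>s. s - x i) has_real_derivative 1) (at w)" by (auto intro!: derivative_eq_intros)
    then have "((\<lambda>s. max 0 (s - x i)) has_real_derivative 1) (at w)"
      by (rule has_field_derivative_transform_within_open[of _ _ _ "{x i<..}"]) (use True in auto)
    then show ?thesis using True by simp
  next
    case False
    then have lt: "w < x i" using assms i by (metis image_eqI lessThan_iff linorder_less_linear)
    have "((\<lambda>s. 0::real) has_real_derivative 0) (at w)" by simp
    then have "((\<lambda>s. max 0 (s - x i)) has_real_derivative 0) (at w)"
      by (rule has_field_derivative_transform_within_open[of _ _ _ "{..<x i}"]) (use lt in auto)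
    then show ?thesis using lt by simp
  qed
  then have "((\<lambda>s. (\<Sum>i<n. max 0 (s - x i)) / n) has_real_derivative (\<Sum>i<n. if x i \<le> w then 1 else 0) / n) (at w)"
    using n by (intro DERIV_cdivide DERIV_sum) auto
  then show ?thesis
    by (simp add: sample_hinge_def[abs_def] ecdf_eq sample_mean_def)
qed

text \<open>\<open>iemp_err\<close> is a primitive of the empirical error. It fails to be
  differentiable at observations, which form a finite exceptional set for the fundamental
  theorem.\<close>

lemma iemp_err_increment:
  assumes uv: "0 \<le> u" "u \<le> v" and N: "\<And>w. u \<le> w \<Longrightarrow> w \<le> v \<Longrightarrow> \<bar>U w - c\<bar> \<le> N"
  shows "\<bar>iemp_err v - iemp_err u - (v - u) * c\<bar> \<le> (v - u) * N"
proof -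
  define W where "W t = iemp_err t - t * c" for t
  have "((\<lambda>w. U w - c) has_integral (W v - W u)) {u..v}"
  proof (rule fundamental_theorem_of_calculus_interior_strong[of "x ` {..<n}"])
    show "continuous_on {u..v} W" unfolding W_def iemp_err_def
      by (intro continuous_intros sample_hinge_cont continuous_on_subset[OF cum_cum_cont[OF f0_integrable_on[of v]]])
        (use uv in auto)
    fix w assume w: "w \<in> {u<..<v} - x ` {..<n}"
    have "(cum (cum f0) has_real_derivative cum f0 w) (at w)"
      using w uv by (intro cum_cum_deriv[OF f0_integrable_on[of v]]) auto
    moreover have "(sample_hinge has_real_derivative ecdf n x w) (at w)"
      using w by (intro sample_hinge_deriv) auto
    ultimately have "(W has_real_derivative U w - c) (at w)"
      unfolding W_def iemp_err_def emp_err_def by (auto intro!: derivative_eq_intros)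
    then show "(W has_vector_derivative U w - c) (at w)"
      by (simp add: has_real_derivative_iff_has_vector_derivative)
  qed (use uv in auto)
  moreover have "0 \<le> N" using N[of u] uv by (smt (verit) abs_ge_zero)
  ultimately have "norm (W v - W u) \<le> N * measure lborel {u..v}"
    using N by (intro has_integral_bound_real[where f="\<lambda>w. U w - c" and S="{}"]) auto
  then show ?thesis using uv by (simp add: W_def algebra_simps)
qed

lemma near_noise_iemp:
  assumes nn: "near_noise L N" and t: "0 \<le> t" "\<bar>t - x0\<bar> \<le> L"
  shows "\<bar>iemp_err t - iemp_err x0 - (t - x0) * U x0\<bar> \<le> L * N"
proof -
  have N0: "0 \<le> N" using nn[unfolded local_noise_def, rule_format, of x0] x0 t by simp
  have "\<bar>iemp_err t - iemp_err x0 - (t - x0) * U x0\<bar> \<le> \<bar>t - x0\<bar> * N"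
  proof (cases "x0 \<le> t")
    case True
    then show ?thesis using iemp_err_increment[of x0 t "U x0" N] nn x0 t by (auto simp: local_noise_def)
  next
    case False
    have "\<bar>iemp_err x0 - iemp_err t - (x0 - t) * U x0\<bar> \<le> (x0 - t) * N"
      using False nn t by (intro iemp_err_increment) (auto simp: local_noise_def)
    moreover have "iemp_err t - iemp_err x0 - (t - x0) * U x0 = - (iemp_err x0 - iemp_err t - (x0 - t) * U x0)"
      by (simp add: algebra_simps)
    ultimately show ?thesis using False by simp
  qed
  also have "\<dots> \<le> L * N" using t N0 by (intro mult_right_mono) auto
  finally show ?thesis .
qed

text \<open>The affine correction is minus the first order expansion of \<open>iemp_err\<close> at
  \<open>x0\<close>. The second derivative remains f - f0, and at contacts only the remainder of
  that expansion is left.\<close>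

definition err :: "real \<Rightarrow> real" where
  "err t = cum (cum f) t - cum (cum f0) t - iemp_err x0 - (t - x0) * U x0"

definition err' :: "real \<Rightarrow> real" where
  "err' t = cum f t - cum f0 t - U x0"

lemma err_eq: "0 \<le> t \<Longrightarrow> err t = gap t + (iemp_err t - iemp_err x0 - (t - x0) * U x0)"
  by (simp add: err_def gap_eq iemp_err_def)

lemma err_ge:
  assumes "near_noise L N" "0 \<le> t" "\<bar>t - x0\<bar> \<le> L"
  shows "- (L * N) \<le> err t"
  using near_noise_iemp[OF assms] gap_nonneg[of t] err_eq[OF assms(2)] by linarith

lemma err_contact:
  assumes "near_noise L N" "t \<in> contacts" "\<bar>t - x0\<bar> \<le> L"
  shows "\<bar>err t\<bar> \<le> L * N" "\<bar>err' t\<bar> \<le> N"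
proof -
  have t: "0 \<le> t" "gap t = 0" using assms(2) by (auto simp: contacts_def)
  show "\<bar>err t\<bar> \<le> L * N" using near_noise_iemp[OF assms(1) t(1) assms(3)] err_eq[OF t(1)] t(2) by simp
  have "err' t = U t - U x0" by (simp add: err'_def emp_err_def cum_f_contact[OF assms(2)])
  then show "\<bar>err' t\<bar> \<le> N" using assms(1,3) t by (simp add: local_noise_def)
qed

lemma err_cont: "continuous_on {0..b} err" "continuous_on {0..b} err'"
  unfolding err_def err'_def
  by (intro continuous_intros cum_cum_cont cum_cont f_integrable f0_integrable_on)+

lemma err_deriv:
  assumes "0 < t"
  shows "(err has_real_derivative err' t) (at t)" "(err' has_real_derivative f t - f0 t) (at t)"
proof -
  have "(cum (cum f) has_real_derivative cum f t) (at t)" "(cum (cum f0) has_real_derivative cum f0 t) (at t)"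
    using assms by (auto intro!: cum_cum_deriv[of _ "t + 1"] f_integrable f0_integrable_on)
  then show "(err has_real_derivative err' t) (at t)"
    unfolding err_def err'_def by (auto intro!: derivative_eq_intros)
  have "(cum f has_real_derivative f t) (at t)" "(cum f0 has_real_derivative f0 t) (at t)"
    using assms by (auto intro!: cum_deriv[of _ "t + 1"] f_integrable f0_integrable_on f_isCont f0_isCont)
  then show "(err' has_real_derivative f t - f0 t) (at t)"
    unfolding err'_def by (auto intro!: derivative_eq_intros)
qed

text \<open>Without a contact in [y, Z] the estimator is at most half of f0 w between the last
  contact \<open>\<tau>\<close> and w = y + eta. Integrating f - f0 <= -f0 w / 2 twice from
  \<open>\<tau>\<close> pushes \<open>err w\<close> below its lower noise bound. The 12 comes from
  three noise terms \<open>Z * e\<close> against a quarter of f0 w * eta^2.\<close>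

lemma contact_exists:
  assumes y: "0 < y" "0 < \<eta>" "2 * y \<le> Z" "y + \<eta> \<le> Z" "x0 \<le> Z"
    and Zf: "8 / (Z - y) \<le> f0 (y + \<eta>) / 2"
    and e: "near_noise Z e" "12 * Z * e < f0 (y + \<eta>) * \<eta>\<^sup>2"
  obtains \<tau> where "\<tau> \<in> contacts" "y \<le> \<tau>" "\<tau> \<le> Z"
proof (rule ccontr)
  assume "\<not> thesis"
  then have "contacts \<inter> {y..Z} = {}" using that by auto
  then obtain \<tau> where t: "\<tau> \<in> contacts" "\<tau> < y" "\<And>t. \<tau> \<le> t \<Longrightarrow> t \<le> Z \<Longrightarrow> f t \<le> 8 / (Z - y)"
    using small_of_no_contact[OF y(1,3)] by metis
  define w where "w = y + \<eta>"
  define \<kappa> where "\<kappa> = f0 w / 2"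
  have t0: "0 \<le> \<tau>" using t(1) by (simp add: contacts_def)
  have tw: "\<tau> < w" "\<eta> \<le> w - \<tau>" "w - \<tau> \<le> Z" using t y t0 by (auto simp: w_def)
  have k0: "0 \<le> \<kappa>" using f0_nonneg[of w] y by (simp add: \<kappa>_def w_def)
  have k: "f s - f0 s \<le> - \<kappa>" if s: "\<tau> < s" "s < w" for s
  proof -
    have "f s \<le> f0 w / 2" using t(3)[of s] s y Zf by (simp add: w_def)
    moreover have "f0 w \<le> f0 s" using s t0 by (intro f0_antimono) auto
    ultimately show ?thesis by (simp add: \<kappa>_def)
  qed
  have tx: "\<bar>\<tau> - x0\<bar> \<le> Z" "\<bar>w - x0\<bar> \<le> Z" using t t0 y x0 by (auto simp: w_def)
  note c = err_contact[OF e(1) t(1) tx(1)]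
  have cont: "continuous_on {\<tau>..s} err" "continuous_on {\<tau>..s} err'" for s
    using t0 by (auto intro: continuous_on_subset[OF err_cont(1)[of s]] continuous_on_subset[OF err_cont(2)[of s]])
  have d': "err' s \<le> e - \<kappa> * (s - \<tau>)" if s: "\<tau> < s" "s < w" for s
  proof -
    have "\<kappa> * (s - \<tau>) \<le> (- err' s) - (- err' \<tau>)"
      by (rule mvt_lower[OF _ continuous_on_minus[OF cont(2)] DERIV_minus[OF err_deriv(2)]])
        (use s t0 k in force)+
    then show ?thesis using c(2) by simp
  qed
  define \<phi> where "\<phi> s = - (err s - e * s + \<kappa> / 2 * (s - \<tau>)\<^sup>2)" for s
  have "0 * (w - \<tau>) \<le> \<phi> w - \<phi> \<tau>"
  proof (rule mvt_lower)
    show "\<tau> \<le> w" using tw by simp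
    show "continuous_on {\<tau>..w} \<phi>" unfolding \<phi>_def by (intro continuous_intros cont)
    fix s assume s: "\<tau> < s" "s < w"
    show "(\<phi> has_real_derivative - (err' s - e + \<kappa> * (s - \<tau>))) (at s)"
      unfolding \<phi>_def using s t0 by (auto intro!: derivative_eq_intros err_deriv)
    show "0 \<le> - (err' s - e + \<kappa> * (s - \<tau>))" using d'[OF s] by simp
  qed
  then have "err w + \<kappa> / 2 * (w - \<tau>)\<^sup>2 \<le> err \<tau> + e * (w - \<tau>)" by (simp add: \<phi>_def algebra_simps)
  moreover have "- (Z * e) \<le> err w" using tx y by (intro err_ge[OF e(1)]) (auto simp: w_def)
  moreover have "0 \<le> e" using c(2) by linarith
  then have "e * (w - \<tau>) \<le> e * Z" using tw by (intro mult_left_mono) auto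
  moreover have "\<eta>\<^sup>2 \<le> (w - \<tau>)\<^sup>2" using tw y by (intro power_mono) auto
  then have "\<kappa> / 2 * \<eta>\<^sup>2 \<le> \<kappa> / 2 * (w - \<tau>)\<^sup>2" using k0 by (intro mult_left_mono) auto
  ultimately have "\<kappa> / 2 * \<eta>\<^sup>2 \<le> 3 * (Z * e)" using c(1) by (simp add: mult.commute)
  then show False using e(2) by (simp add: \<kappa>_def w_def)
qed

context
  fixes b K1 :: real
  assumes b: "0 < b" "x0 + b \<in> contacts"
begin

text \<open>The left end corresponds to the contact 0, the right end to a contact
  \<open>x0 + b\<close>. The common line is the affine part in the local form of f0.\<close>

lemma curve:
  "contact_curve x0 b ((\<lambda>\<tau>. \<tau> - x0) ` (contacts \<inter> {..x0 + b}))
    (\<lambda>s. f (x0 + s) - (f0 x0 + K1 * s)) (\<lambda>s. f0 (x0 + s) - (f0 x0 + K1 * s))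
    (\<lambda>s. err (x0 + s)) (\<lambda>s. err' (x0 + s))" (is "contact_curve _ _ ?T ?d ?m ?g ?g1")
proof
  have shift: "convex_on S (\<lambda>s. h (x0 + s) - (f0 x0 + K1 * s))"
    if h: "convex_on {0..} h" and S: "S \<subseteq> {-x0..}" "convex S" for h :: "real \<Rightarrow> real" and S
  proof -
    have "convex_on S (\<lambda>s. h (x0 + s))"
    proof (rule convex_onI[OF _ S(2)])
      fix t u v :: real assume "0 < t" "t < 1" "u \<in> S" "v \<in> S"
      moreover have "x0 + ((1 - t) *\<^sub>R u + t *\<^sub>R v) = (1 - t) *\<^sub>R (x0 + u) + t *\<^sub>R (x0 + v)"
        by (simp add: algebra_simps)
      ultimately show "h (x0 + ((1 - t) *\<^sub>R u + t *\<^sub>R v)) \<le> (1 - t) * h (x0 + u) + t * h (x0 + v)"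
        using convex_onD[OF h, of t "x0 + u" "x0 + v"] S(1) by fastforce
    qed
    from convex_on_add[OF this convex_on_affine[OF S(2), of "- f0 x0" "- K1"]]
    show ?thesis by (rule convex_on_eqI) simp
  qed
  show "0 < x0" "0 < b" by (fact x0 b)+
  show "compact ?T" by (intro compact_continuous_image contacts_compact continuous_intros)
  show "?T \<subseteq> {- x0..b}" by (auto simp: contacts_def)
  show "- x0 \<in> ?T" by (rule image_eqI[of _ _ 0]) (use zero_contact x0 b in auto)
  show "b \<in> ?T" by (rule image_eqI[of _ _ "x0 + b"]) (use b in auto)
  show "convex_on {- x0..b} ?d" by (rule shift[OF convex_coneD(3)[OF f]]) auto
  show "convex_on {- x0<..<b} ?m" by (rule shift[OF f0_convex]) auto
  show "continuous_on {- x0..b} ?g"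
    by (intro continuous_on_compose2[OF err_cont(1)[of "x0 + b"]] continuous_intros) auto
  show "continuous_on {- x0..b} ?g1"
    by (intro continuous_on_compose2[OF err_cont(2)[of "x0 + b"]] continuous_intros) auto
  fix s assume s: "- x0 < s" "s < b"
  have "(?g has_real_derivative err' (x0 + s) * 1) (at s)"
    by (rule DERIV_chain2[OF err_deriv(1)]) (use s in \<open>auto intro!: derivative_eq_intros\<close>)
  then show "(?g has_real_derivative ?g1 s) (at s)" by simp
  have "(?g1 has_real_derivative (f (x0 + s) - f0 (x0 + s)) * 1) (at s)"
    by (rule DERIV_chain2[OF err_deriv(2)]) (use s in \<open>auto intro!: derivative_eq_intros\<close>)
  then show "(?g1 has_real_derivative ?d s - ?m s) (at s)" by simp
next
  fix \<tau> \<tau>' assume t: "\<tau> \<in> ?T" "\<tau>' \<in> ?T" "{\<tau><..<\<tau>'} \<inter> ?T = {}"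
  show "\<exists>p r. \<forall>s\<in>{\<tau>..\<tau>'}. ?d s = p + r * s"
  proof (cases "\<tau> \<le> \<tau>'")
    case True
    have "{x0 + \<tau><..<x0 + \<tau>'} \<inter> contacts = {}"
    proof (rule equals0I)
      fix s assume s: "s \<in> {x0 + \<tau><..<x0 + \<tau>'} \<inter> contacts"
      then have "s \<le> x0 + b" using t(2) by auto
      then have "s - x0 \<in> {\<tau><..<\<tau>'} \<inter> ?T" using s by auto
      then show False using t(3) by blast
    qed
    moreover have "0 \<le> x0 + \<tau>" using t(1) by (auto simp: contacts_def)
    ultimately obtain p r where pr: "\<forall>s\<in>{x0 + \<tau>..x0 + \<tau>'}. f s = p + r * s"
      using affine_off_contacts[of "x0 + \<tau>" "x0 + \<tau>'"] True by auto
    show ?thesis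
      by (intro exI[of _ "p + r * x0 - f0 x0"] exI[of _ "r - K1"]) (use pr in \<open>auto simp: algebra_simps\<close>)
  qed auto
qed

lemma curve_noise:
  assumes nn: "near_noise L N"
  shows "contact_curve.noise x0 b ((\<lambda>\<tau>. \<tau> - x0) ` (contacts \<inter> {..x0 + b}))
    (\<lambda>s. err (x0 + s)) (\<lambda>s. err' (x0 + s)) L N"
  unfolding contact_curve.noise_def[OF curve]
  using err_contact[OF nn] err_ge[OF nn] by auto

end

end

text \<open>The interface between the deterministic and the probabilistic part: C, rho and epsilon
  serve all sample sizes and all samples on which the noise bounds hold.\<close>

definition error_controlled ::
    "(real \<Rightarrow> real) \<Rightarrow> real \<Rightarrow> real \<Rightarrow> real \<Rightarrow> real \<Rightarrow> real \<Rightarrow> real \<Rightarrow> real \<Rightarrow> bool" where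
  "error_controlled f0 x0 \<alpha> \<kappa> Z C \<rho> \<epsilon> \<longleftrightarrow>
    (\<forall>n x f L0 e. lse n x f \<longrightarrow> 0 < L0 \<longrightarrow> L0 < \<rho> \<longrightarrow> e < \<epsilon> \<longrightarrow> local_noise n x f0 x0 Z e \<longrightarrow>
      (\<forall>L. L0 \<le> L \<longrightarrow> L \<le> Z \<longrightarrow> local_noise n x f0 x0 L (scale_noise \<kappa> \<alpha> L0 L)) \<longrightarrow>
      - (C * e) \<le> f x0 - f0 x0 \<and> f x0 - f0 x0 \<le> C * (e + L0 powr \<alpha>))"

lemma lse_error_bounds:
  fixes f0 :: "real \<Rightarrow> real" and x0 K1 K2 \<alpha> :: real
  assumes nonneg: "\<And>t. 0 \<le> t \<Longrightarrow> 0 \<le> f0 t" and convex: "convex_on {0..} f0"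
    and antimono: "\<And>s t. 0 \<le> s \<Longrightarrow> s \<le> t \<Longrightarrow> f0 t \<le> f0 s"
    and integrable: "set_integrable lborel {0..} f0"
    and x0: "0 < x0" "0 < f0 x0" and const: "0 < K2" "1 < \<alpha>"
    and local_form:
      "(\<forall>\<^sub>F t in nhds x0. f0 t = f0 x0 + K1 * (t - x0)
            + K2 * (t - x0) powr \<alpha> * indicator {x0..} t) \<or>
       (\<forall>\<^sub>F t in nhds x0. f0 t = f0 x0 + K1 * (t - x0)
            + K2 * (x0 - t) powr \<alpha> * indicator {0..<x0} t)"
  shows "\<exists>Z\<ge>x0. \<forall>\<kappa>>0. \<exists>C>0. \<exists>\<rho>>0. \<exists>\<epsilon>>0. error_controlled f0 x0 \<alpha> \<kappa> Z C \<rho> \<epsilon>"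
proof -
  define B where "B \<longleftrightarrow> (\<forall>\<^sub>F t in nhds x0. f0 t = f0 x0 + K1 * (t - x0)
            + K2 * (t - x0) powr \<alpha> * indicator {x0..} t)"
  obtain \<delta>0 where d0: "0 < \<delta>0"
    "\<And>t. \<bar>t - x0\<bar> < \<delta>0 \<Longrightarrow> B \<Longrightarrow> f0 t = f0 x0 + K1 * (t - x0) + K2 * (t - x0) powr \<alpha> * indicator {x0..} t"
    "\<And>t. \<bar>t - x0\<bar> < \<delta>0 \<Longrightarrow> \<not> B \<Longrightarrow> f0 t = f0 x0 + K1 * (t - x0) + K2 * (x0 - t) powr \<alpha> * indicator {0..<x0} t"
  proof (cases B)
    case True
    then show ?thesis using that unfolding B_def eventually_nhds_metric dist_real_def by metis
  next
    case False
    then show ?thesis using that local_form unfolding B_def eventually_nhds_metric dist_real_def by metis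
  qed
  have "convex_on {0<..} f0" by (rule convex_on_subset[OF convex]) auto
  then have "continuous_on {0<..} f0" by (intro convex_on_continuous) auto
  then have "isCont f0 x0" by (rule continuous_on_interior) (use x0 in \<open>simp add: interior_open\<close>)
  then have "(f0 \<longlongrightarrow> f0 x0) (nhds x0)"
    by (simp add: isCont_def tendsto_at_iff_tendsto_nhds[symmetric])
  then have "\<forall>\<^sub>F t in nhds x0. f0 x0 / 2 < f0 t"
    by (rule order_tendstoD(1)) (use x0 in simp)
  then obtain \<delta>1 where d1: "0 < \<delta>1" "\<And>t. \<bar>t - x0\<bar> < \<delta>1 \<Longrightarrow> f0 x0 / 2 < f0 t"
    unfolding eventually_nhds_metric dist_real_def by blast
  \<comment> \<open>At most the radius of the local form, at most the distance to the contact 0, and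
    small enough that x0 + 2 delta lies where f0 exceeds half of f0 x0.\<close>
  define \<delta> where "\<delta> = min (min \<delta>0 x0) (\<delta>1 / 3)"
  have del: "0 < \<delta>" "\<delta> \<le> \<delta>0" "\<delta> \<le> x0" "2 * \<delta> < \<delta>1" using d0 d1 x0 by (auto simp: \<delta>_def)
  define y where "y = x0 + \<delta>"
  have fw: "0 < f0 (y + \<delta>)" using d1(2)[of "y + \<delta>"] del x0 by (simp add: y_def)
  \<comment> \<open>Far enough for the bound 8 / (Z - y) on an affine stretch to be at most half of
    f0 (y + delta).\<close>
  define Z where "Z = 2 * (y + \<delta>) + 16 / f0 (y + \<delta>)"
  have y0: "0 < y" using x0 del by (simp add: y_def)
  have p16: "0 < 16 / f0 (y + \<delta>)" using fw by simp
  have Z: "2 * y \<le> Z" "y + \<delta> \<le> Z" "x0 \<le> Z" "\<delta> \<le> Z" "16 / f0 (y + \<delta>) \<le> Z - y"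
    using p16 del y0 x0 by (auto simp: Z_def y_def)
  have Zf: "8 / (Z - y) \<le> f0 (y + \<delta>) / 2"
  proof -
    have "0 < Z - y" using Z(5) p16 by linarith
    then show ?thesis using Z(5) fw by (simp add: field_simps)
  qed
  have Z0: "0 < Z" using Z x0 by linarith
  show ?thesis
  proof (rule exI[of _ Z], intro conjI allI impI Z(3))
    fix \<kappa> :: real assume k: "0 < \<kappa>"
    define \<epsilon> where "\<epsilon> = f0 (y + \<delta>) * \<delta>\<^sup>2 / (12 * Z)"
    have eps: "0 < \<epsilon>" using fw del Z0 by (simp add: \<epsilon>_def)
    from contact_curve_bounds[OF const(2,1) del(1) Z(4) k] obtain C \<rho> where C: "0 < C" "0 < \<rho>"
      and bounds: "\<And>a b T d m g g1 L0 e. contact_curve a b T d m g g1 \<Longrightarrow> \<delta> \<le> a \<Longrightarrow> \<delta> \<le> b \<Longrightarrow> a \<le> Z \<Longrightarrow> b \<le> Z \<Longrightarrow>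
        (\<And>s. -\<delta> < s \<Longrightarrow> s < 0 \<Longrightarrow> m s = 0) \<Longrightarrow> (\<And>s. 0 < s \<Longrightarrow> s < \<delta> \<Longrightarrow> m s = K2 * s powr \<alpha>) \<Longrightarrow>
        0 < L0 \<Longrightarrow> L0 < \<rho> \<Longrightarrow> contact_curve.noise a b T g g1 Z e \<Longrightarrow>
        (\<And>L. L0 \<le> L \<Longrightarrow> L \<le> Z \<Longrightarrow> contact_curve.noise a b T g g1 L (scale_noise \<kappa> \<alpha> L0 L)) \<Longrightarrow>
        - (C * e) \<le> d 0 \<and> d 0 \<le> C * (e + L0 powr \<alpha>)"
      by blast
    have main: "- (C * e) \<le> f x0 - f0 x0 \<and> f x0 - f0 x0 \<le> C * (e + L0 powr \<alpha>)"
      if l: "lse n x f" and L0: "0 < L0" "L0 < \<rho>" and e: "e < \<epsilon>" "local_noise n x f0 x0 Z e"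
        and nz: "\<And>L. L0 \<le> L \<Longrightarrow> L \<le> Z \<Longrightarrow> local_noise n x f0 x0 L (scale_noise \<kappa> \<alpha> L0 L)"
      for n x f L0 e
    proof -
      interpret lse n x f by (rule l)
      interpret lse_truth n x f f0 x0
        by unfold_locales (use nonneg convex antimono integrable x0 in auto)
      have "12 * Z * e < f0 (y + \<delta>) * \<delta>\<^sup>2"
        using e(1) Z0 by (simp add: \<epsilon>_def field_simps)
      then obtain \<tau> where tau: "\<tau> \<in> contacts" "y \<le> \<tau>" "\<tau> \<le> Z"
        using contact_exists[OF y0 del(1) Z(1,2,3) Zf e(2)] by blast
      define b where "b = \<tau> - x0"
      have b: "0 < b" "x0 + b \<in> contacts" "\<delta> \<le> b" "b \<le> Z"
        using tau del x0 by (auto simp: b_def y_def)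
      note cv = curve[OF b(1,2), of K1]
      note cn = curve_noise[OF b(1,2)]
      show ?thesis
      proof (cases B)
        case True
        have m: "f0 (x0 + s) - (f0 x0 + K1 * s) = 0" if "- \<delta> < s" "s < 0" for s
          using d0(2)[of "x0 + s", OF _ True] that del by simp
        have m': "f0 (x0 + s) - (f0 x0 + K1 * s) = K2 * s powr \<alpha>" if "0 < s" "s < \<delta>" for s
          using d0(2)[of "x0 + s", OF _ True] that del by simp
        have "- (C * e) \<le> f (x0 + 0) - (f0 x0 + K1 * 0) \<and> f (x0 + 0) - (f0 x0 + K1 * 0) \<le> C * (e + L0 powr \<alpha>)"
          by (rule bounds[OF cv del(3) b(3) Z(3) b(4) m m' L0 cn[OF e(2)] cn[OF nz]])
        then show ?thesis by simp
      next
        case False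
        have m: "f0 (x0 + - s) - (f0 x0 + K1 * - s) = 0" if "- \<delta> < s" "s < 0" for s
          using d0(3)[of "x0 + - s", OF _ False] that del by simp
        have m': "f0 (x0 + - s) - (f0 x0 + K1 * - s) = K2 * s powr \<alpha>" if "0 < s" "s < \<delta>" for s
          using d0(3)[of "x0 + - s", OF _ False] that del by simp
        have "- (C * e) \<le> f (x0 + - 0) - (f0 x0 + K1 * - 0) \<and> f (x0 + - 0) - (f0 x0 + K1 * - 0) \<le> C * (e + L0 powr \<alpha>)"
          by (rule bounds[OF contact_curve_reflect[OF cv] b(3) del(3) b(4) Z(3) m m' L0
                noise_reflect[OF cv cn[OF e(2)]] noise_reflect[OF cv cn[OF nz]]])
        then show ?thesis by simp
      qed
    qed
    show "\<exists>C>0. \<exists>\<rho>>0. \<exists>\<epsilon>>0. error_controlled f0 x0 \<alpha> \<kappa> Z C \<rho> \<epsilon>"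
      using C eps main unfolding error_controlled_def by blast
  qed
qed

subsection \<open>Empirical process bounds at all scales\<close>

lemma exp_le_quadratic:
  fixes y :: real
  assumes "\<bar>y\<bar> \<le> 1"
  shows "exp y \<le> 1 + y + y\<^sup>2"
proof (cases "0 \<le> y")
  case True then show ?thesis using assms by (intro exp_bound) auto
next
  case False
  define z where "z = - y"
  have z: "0 \<le> z" "z \<le> 1" using False assms by (auto simp: z_def)
  have "1 \<le> (1 - z + z\<^sup>2) * (1 + z)"
  proof -
    have "(1 - z + z\<^sup>2) * (1 + z) = 1 + z ^ 3" by (simp add: power2_eq_square power3_eq_cube algebra_simps)
    then show ?thesis using z by simp
  qed
  also have "\<dots> \<le> (1 - z + z\<^sup>2) * exp z"
  proof (intro mult_left_mono exp_ge_add_one_self)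
    show "0 \<le> 1 - z + z\<^sup>2" using z by (smt (verit) zero_le_power2)
  qed
  finally have "exp (- z) \<le> (1 - z + z\<^sup>2) * exp z * exp (- z)" by (simp add: mult_le_cancel_right)
  then show ?thesis by (simp add: z_def mult.assoc flip: exp_add)
qed

text \<open>Trades the exponential tail for a fourth power, which suffices for chaining.\<close>

lemma power4_le_exp:
  fixes z :: real
  assumes "0 \<le> z"
  shows "z ^ 4 / 256 \<le> exp z"
proof -
  have "z ^ 4 / 256 = (z / 4) ^ 4" by (simp add: power_divide)
  also have "\<dots> \<le> exp (z / 4) ^ 4"
    using assms exp_ge_add_one_self[of "z / 4"] by (intro power_mono) linarith+
  also have "\<dots> = exp z" by (simp flip: exp_of_nat_mult)
  finally show ?thesis .
qed

text \<open>A grid point of level j + 1 either belongs to level j or is the right neighbour, one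
  fine cell away, of a point of level j.\<close>

lemma dyadic_chaining:
  fixes \<phi> :: "real \<Rightarrow> real"
  assumes step: "\<And>j i. j \<le> J \<Longrightarrow> i < 2 ^ j \<Longrightarrow>
      \<bar>\<phi> (a + real (Suc i) * L / 2 ^ j) - \<phi> (a + real i * L / 2 ^ j)\<bar> \<le> y j"
    and y: "\<And>j. 0 \<le> y j"
  shows "j \<le> J \<Longrightarrow> i \<le> 2 ^ j \<Longrightarrow> \<bar>\<phi> (a + real i * L / 2 ^ j) - \<phi> a\<bar> \<le> (\<Sum>k\<le>j. y k)"
proof (induction j arbitrary: i)
  case 0
  then consider "i = 0" | "i = 1" by force
  then show ?case using step[of 0 0] y[of 0] by cases auto
next
  case (Suc j)
  define i' where "i' = i div 2"
  have i': "i' \<le> 2 ^ j" using Suc.prems by (simp add: i'_def)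
  have IH: "\<bar>\<phi> (a + real i' * L / 2 ^ j) - \<phi> a\<bar> \<le> (\<Sum>k\<le>j. y k)" using Suc.IH[OF _ i'] Suc.prems by simp
  have pt: "a + real i' * L / 2 ^ j = a + real (2 * i') * L / 2 ^ Suc j" by simp
  show ?case
  proof (cases "even i")
    case True
    then have i: "i = 2 * i'" by (simp add: i'_def)
    show ?thesis using IH y[of "Suc j"] unfolding pt i sum.atMost_Suc by linarith
  next
    case False
    then have i: "i = Suc (2 * i')" by (simp add: i'_def)
    have "\<bar>\<phi> (a + real (Suc (2 * i')) * L / 2 ^ Suc j) - \<phi> (a + real (2 * i') * L / 2 ^ Suc j)\<bar> \<le> y (Suc j)"
      using Suc.prems i by (intro step) auto
    then show ?thesis using IH unfolding pt i sum.atMost_Suc by linarith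
  qed
qed

lemma sum_geometric_le:
  fixes r :: real
  assumes "0 \<le> r" "r < 1"
  shows "(\<Sum>j\<le>J. r ^ j) \<le> 1 / (1 - r)"
proof -
  have "(\<Sum>j\<le>J. r ^ j) = (\<Sum>j<Suc J. r ^ j)" by (simp add: lessThan_Suc_atMost)
  also have "\<dots> = (1 - r ^ Suc J) / (1 - r)" using assms sum_gp_strict[of r "Suc J"]
    by (simp del: sum.lessThan_Suc power_Suc)
  also have "\<dots> \<le> 1 / (1 - r)" using assms by (intro divide_right_mono) auto
  finally show ?thesis .
qed

section \<open>Chaining for the empirical distribution function\<close>

locale iid_cdf = prob_space M for M :: "'a measure" +
  fixes X :: "nat \<Rightarrow> 'a \<Rightarrow> real" and F :: "real \<Rightarrow> real" and B :: real
  assumes indep: "indep_vars (\<lambda>_. borel) X UNIV"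
    and cdf: "\<And>i t. prob {\<omega> \<in> space M. X i \<omega> \<le> t} = F t"
    and lip: "\<And>u v. u \<le> v \<Longrightarrow> F v - F u \<le> B * (v - u)" and B: "0 < B"
begin

lemma rv [measurable]: "X i \<in> borel_measurable M"
  using indep by (simp add: indep_vars_def)

lemma F_mono:
  assumes "u \<le> v" shows "F u \<le> F v"
proof -
  have "prob {\<omega> \<in> space M. X 0 \<omega> \<le> u} \<le> prob {\<omega> \<in> space M. X 0 \<omega> \<le> v}"
    using assms by (intro finite_measure_mono) auto
  then show ?thesis by (simp add: cdf)
qed

lemma prob_interval:
  assumes "u \<le> v"
  shows "prob {\<omega> \<in> space M. X i \<omega> \<in> {u<..v}} = F v - F u"
proof -
  have "prob ({\<omega> \<in> space M. X i \<omega> \<le> v} - {\<omega> \<in> space M. X i \<omega> \<le> u}) = F v - F u"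
    using assms by (subst finite_measure_Diff) (auto simp: cdf)
  moreover have "{\<omega> \<in> space M. X i \<omega> \<le> v} - {\<omega> \<in> space M. X i \<omega> \<le> u} = {\<omega> \<in> space M. X i \<omega> \<in> {u<..v}}"
    by auto
  ultimately show ?thesis by simp
qed

definition cell_dev :: "nat \<Rightarrow> real \<Rightarrow> real \<Rightarrow> 'a \<Rightarrow> real" where
  "cell_dev n u v \<omega> = (\<Sum>i<n. indicator {u<..v} (X i \<omega>) - (F v - F u))"

definition dev :: "nat \<Rightarrow> 'a \<Rightarrow> real \<Rightarrow> real" where
  "dev n \<omega> t = ecdf n (\<lambda>i. X i \<omega>) t - F t"

lemma cell_dev_measurable [measurable]: "cell_dev n u v \<in> borel_measurable M"
  unfolding cell_dev_def[abs_def] by measurable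

lemma ecdf_sum: "real n * ecdf n x t = (\<Sum>i<n. indicator {..t} (x i))"
proof -
  have "(\<Sum>i<n. indicator {..t} (x i) :: real) = (\<Sum>i<n. if x i \<le> t then 1 else 0)"
    by (intro sum.cong) (auto simp: indicator_def)
  also have "\<dots> = card {i \<in> {..<n}. x i \<le> t}"
    by (simp add: sum.If_cases Int_def flip: sum.inter_filter)
  also have "{i \<in> {..<n}. x i \<le> t} = {i. i < n \<and> x i \<le> t}" by auto
  finally show ?thesis by (simp add: ecdf_def)
qed

lemma cell_dev_eq:
  assumes "u \<le> v"
  shows "cell_dev n u v \<omega> = real n * (dev n \<omega> v - dev n \<omega> u)"
proof -
  have "indicator {u<..v} z = (indicator {..v} z - indicator {..u} z :: real)" for z
    using assms by (auto simp: indicator_def)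
  then have "cell_dev n u v \<omega> = (\<Sum>i<n. indicator {..v} (X i \<omega>)) - (\<Sum>i<n. indicator {..u} (X i \<omega>)) - n * (F v - F u)"
    by (simp add: cell_dev_def sum_subtractf)
  then show ?thesis by (simp add: dev_def flip: ecdf_sum) (simp add: algebra_simps)
qed

text \<open>For a centred indicator with success probability p, the quadratic bound on exp leaves
  only the variance, at most p, after the linear term averages out. Independence multiplies the
  factors.\<close>

lemma mgf_bound:
  assumes uv: "u \<le> v" and l: "\<bar>l\<bar> \<le> 1"
  shows "integrable M (\<lambda>\<omega>. exp (l * cell_dev n u v \<omega>))"
    "expectation (\<lambda>\<omega>. exp (l * cell_dev n u v \<omega>)) \<le> exp (n * (l\<^sup>2 * (F v - F u)))"
proof -
  define p where "p = F v - F u"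
  have p: "0 \<le> p" "p \<le> 1"
    using F_mono[OF uv] prob_interval[OF uv, of 0] by (auto simp: p_def) (metis prob_le_1)
  define Y where "Y i \<omega> = exp (l * (indicator {u<..v} (X i \<omega>) - p))" for i \<omega>
  have prod: "exp (l * cell_dev n u v \<omega>) = (\<Prod>i<n. Y i \<omega>)" for \<omega>
    by (simp add: cell_dev_def Y_def p_def sum_distrib_left exp_sum)
  have small: "\<bar>l * (indicator {u<..v} z - p)\<bar> \<le> 1" for z :: real
  proof -
    have "\<bar>l\<bar> * \<bar>indicator {u<..v} z - p\<bar> \<le> 1 * 1"
      using l p by (intro mult_mono) (auto simp: indicator_def)
    then show ?thesis by (simp add: abs_mult)
  qed
  have [measurable]: "Y i \<in> borel_measurable M" for i unfolding Y_def[abs_def] by measurable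
  have Y_int: "integrable M (Y i)" for i
  proof (rule integrable_const_bound[of _ "exp 1"])
    show "AE \<omega> in M. norm (Y i \<omega>) \<le> exp 1"
      unfolding Y_def using small by (intro AE_I2) (simp add: abs_le_iff)
  qed simp
  have ind: "indep_vars (\<lambda>_. borel) Y {..<n}"
    unfolding Y_def[abs_def]
    by (rule indep_vars_compose2[OF indep_vars_subset[OF indep]]) auto
  have Y_exp: "expectation (Y i) \<le> exp (l\<^sup>2 * p)" for i
  proof -
    let ?I = "\<lambda>\<omega>. indicator {u<..v} (X i \<omega>) :: real"
    have I: "?I \<omega> = indicator {\<omega> \<in> space M. X i \<omega> \<in> {u<..v}} \<omega>" if "\<omega> \<in> space M" for \<omega>
      using that by (auto simp: indicator_def)
    have Iint: "integrable M ?I"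
      by (rule integrable_const_bound[of _ 1]) (auto simp: indicator_def)
    have EI: "expectation ?I = p"
    proof -
      have "expectation ?I = expectation (indicator {\<omega> \<in> space M. X i \<omega> \<in> {u<..v}})"
        by (rule Bochner_Integration.integral_cong) (auto simp: I)
      also have "\<dots> = p" using prob_interval[OF uv, of i] by (simp add: p_def)
      finally show ?thesis .
    qed
    have "expectation (Y i) \<le> expectation (\<lambda>\<omega>. (1 - l * p + l\<^sup>2 * p\<^sup>2) + (l + l\<^sup>2 - 2 * l\<^sup>2 * p) * ?I \<omega>)"
    proof (rule integral_mono[OF Y_int])
      show "integrable M (\<lambda>\<omega>. (1 - l * p + l\<^sup>2 * p\<^sup>2) + (l + l\<^sup>2 - 2 * l\<^sup>2 * p) * ?I \<omega>)" using Iint by simp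
      fix \<omega>
      have "Y i \<omega> \<le> 1 + l * (?I \<omega> - p) + (l * (?I \<omega> - p))\<^sup>2"
        unfolding Y_def by (rule exp_le_quadratic[OF small])
      also have "\<dots> = (1 - l * p + l\<^sup>2 * p\<^sup>2) + (l + l\<^sup>2 - 2 * l\<^sup>2 * p) * ?I \<omega>"
        by (cases "X i \<omega> \<in> {u<..v}") (simp_all add: power2_eq_square algebra_simps)
      finally show "Y i \<omega> \<le> (1 - l * p + l\<^sup>2 * p\<^sup>2) + (l + l\<^sup>2 - 2 * l\<^sup>2 * p) * ?I \<omega>" .
    qed
    also have "\<dots> = (1 - l * p + l\<^sup>2 * p\<^sup>2) + (l + l\<^sup>2 - 2 * l\<^sup>2 * p) * p"
      using Iint by (simp add: EI prob_space)
    also have "\<dots> = 1 + (l\<^sup>2 * p - l\<^sup>2 * p\<^sup>2)" by (simp add: power2_eq_square algebra_simps)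
    also have "\<dots> \<le> 1 + l\<^sup>2 * p" by simp
    also have "\<dots> \<le> exp (l\<^sup>2 * p)" by (rule exp_ge_add_one_self)
    finally show ?thesis .
  qed
  show "integrable M (\<lambda>\<omega>. exp (l * cell_dev n u v \<omega>))"
    unfolding prod by (rule indep_vars_integrable[OF _ ind Y_int]) simp
  have "expectation (\<lambda>\<omega>. exp (l * cell_dev n u v \<omega>)) = (\<Prod>i<n. expectation (Y i))"
    unfolding prod by (rule indep_vars_lebesgue_integral[OF _ ind Y_int]) simp
  also have "\<dots> \<le> (\<Prod>i<n. exp (l\<^sup>2 * p))"
    using Y_exp by (intro prod_mono) (auto simp: Y_def intro!: Bochner_Integration.integral_nonneg)
  also have "\<dots> = exp (n * (l\<^sup>2 * p))" by (simp flip: exp_of_nat_mult)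
  finally show "expectation (\<lambda>\<omega>. exp (l * cell_dev n u v \<omega>)) \<le> exp (n * (l\<^sup>2 * (F v - F u)))"
    by (simp add: p_def)
qed

text \<open>Exponential Markov inequality with the fixed parameter 1 / sqrt (n w), for which the
  moment is at most exp 1; it is admissible since n w >= 1. The constant is 3 * 256 for each of the
  two signs.\<close>

lemma cell_dev_tail:
  assumes uv: "u \<le> v" and w: "F v - F u \<le> w" and nw: "1 \<le> real n * w" and y: "0 < y"
  shows "prob {\<omega> \<in> space M. y \<le> \<bar>cell_dev n u v \<omega>\<bar>} \<le> 1536 * (real n * w)\<^sup>2 / y ^ 4"
proof -
  define l where "l = 1 / sqrt (real n * w)"
  have l: "0 < l" "l \<le> 1" "l\<^sup>2 = 1 / (real n * w)" using nw by (auto simp: l_def power_divide)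
  define H where "H s = {\<omega> \<in> space M. exp (l * y) \<le> exp (s * l * cell_dev n u v \<omega>)}" for s
  have [measurable]: "H s \<in> sets M" for s unfolding H_def by measurable
  have one: "prob (H s) \<le> 768 * (real n * w)\<^sup>2 / y ^ 4"
    if s: "s\<^sup>2 = 1" "\<bar>s\<bar> = 1" for s
  proof -
    have sl: "\<bar>s * l\<bar> \<le> 1" using s l by (simp add: abs_mult)
    have "prob (H s)
        \<le> expectation (\<lambda>\<omega>. exp (s * l * cell_dev n u v \<omega>)) / exp (l * y)"
      unfolding H_def by (rule integral_Markov_inequality_measure[of _ _ "{}"]) (auto intro!: mgf_bound uv sl)
    also have "\<dots> \<le> exp 1 / exp (l * y)"
    proof (intro divide_right_mono order_trans[OF mgf_bound(2)[OF uv sl]])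
      have "real n * (F v - F u) \<le> real n * w" using w by (intro mult_left_mono) auto
      then have "real n * (F v - F u) * l\<^sup>2 \<le> real n * w * l\<^sup>2" by (intro mult_right_mono) auto
      also have "real n * w * l\<^sup>2 = 1" unfolding l(3) using nw by (cases "n = 0 \<or> w = 0") auto
      finally have "real n * ((s * l)\<^sup>2 * (F v - F u)) \<le> 1"
        by (simp add: power_mult_distrib s mult_ac)
      then show "exp (real n * ((s * l)\<^sup>2 * (F v - F u))) \<le> exp 1" by simp
    qed simp
    also have "\<dots> \<le> 3 / ((l * y) ^ 4 / 256)"
      using exp_le l y by (intro frac_le power4_le_exp) auto
    also have "(l * y) ^ 4 = (l\<^sup>2)\<^sup>2 * y ^ 4" by (simp add: power_mult_distrib flip: power_mult)
    also have "3 / ((l\<^sup>2)\<^sup>2 * y ^ 4 / 256) = 768 * (real n * w)\<^sup>2 / y ^ 4"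
      unfolding l(3) using nw y by (simp add: power_divide)
    finally show ?thesis .
  qed
  have "{\<omega> \<in> space M. y \<le> \<bar>cell_dev n u v \<omega>\<bar>} \<subseteq> H 1 \<union> H (- 1)"
  proof
    fix \<omega> assume o: "\<omega> \<in> {\<omega> \<in> space M. y \<le> \<bar>cell_dev n u v \<omega>\<bar>}"
    then consider "y \<le> cell_dev n u v \<omega>" | "y \<le> - cell_dev n u v \<omega>" by force
    then show "\<omega> \<in> H 1 \<union> H (- 1)"
    proof cases
      case 1 then have "l * y \<le> l * cell_dev n u v \<omega>" using l by (intro mult_left_mono) auto
      then show ?thesis using o by (simp add: H_def)
    next
      case 2 then have "l * y \<le> l * (- cell_dev n u v \<omega>)" using l by (intro mult_left_mono) auto
      then show ?thesis using o by (simp add: H_def)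
    qed
  qed
  then have "prob {\<omega> \<in> space M. y \<le> \<bar>cell_dev n u v \<omega>\<bar>} \<le> prob (H 1 \<union> H (- 1))"
    by (rule finite_measure_mono) measurable
  also have "\<dots> \<le> prob (H 1) + prob (H (- 1))" by (rule measure_Un_le) measurable
  also have "\<dots> \<le> 768 * (real n * w)\<^sup>2 / y ^ 4 + 768 * (real n * w)\<^sup>2 / y ^ 4"
    by (intro add_mono one) auto
  finally show ?thesis by simp
qed

text \<open>At level \<open>j\<close> there are \<open>2 ^ j\<close> cells, each with failure probability of order
  \<open>4 powr (-j) / (9/10) ^ (4 * j)\<close>; as \<open>2 * (9/10) ^ 4 > 1\<close>, both the failure
  probabilities and the thresholds are summable over the levels.\<close>

lemma dev_interval:
  assumes L: "0 < L" "1 \<le> real n * (B * L)" and q: "1 \<le> q"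
  obtains A where "A \<in> sets M" "prob A \<le> 7680 / q ^ 4"
    "\<And>\<omega> t. \<omega> \<in> space M - A \<Longrightarrow> a \<le> t \<Longrightarrow> t \<le> a + L \<Longrightarrow>
      \<bar>real n * dev n \<omega> t - real n * dev n \<omega> a\<bar> \<le> 13 * q * sqrt (real n * (B * L))"
proof -
  define W where "W = real n * (B * L)"
  have W: "1 \<le> W" using L by (simp add: W_def)
  have sW: "1 \<le> sqrt W" "0 < sqrt W" "(sqrt W)\<^sup>2 = W" using W by auto
  \<comment> \<open>At the finest level a cell has expected count bound between 1 and 2: large
    enough for the tail bound, small enough that the drift inside a cell is at most 2.\<close>
  obtain J where J: "2 ^ J \<le> W" "W < 2 ^ Suc J"
  proof -
    define J where "J = nat \<lfloor>log 2 W\<rfloor>"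
    have "0 \<le> log 2 W" using W by simp
    then have "real J \<le> log 2 W" "log 2 W < real (Suc J)" by (auto simp: J_def; linarith)+
    then have "2 powr real J \<le> W" "W < 2 powr real (Suc J)"
      using W by (auto simp: le_log_iff log_less_iff)
    then show ?thesis using that[of J] by (simp only: powr_realpow[of 2, simplified])
  qed
  define y where "y j = q * sqrt W * (9/10) ^ j" for j :: nat
  have y: "0 < y j" for j using q sW by (simp add: y_def)
  define pt where "pt j i = a + real i * L / 2 ^ j" for j i :: nat
  have pt_step: "pt j (Suc i) - pt j i = L / 2 ^ j" for j i by (simp add: pt_def field_simps)
  then have pt_le: "pt j i \<le> pt j (Suc i)" for j i using L by (smt (verit) divide_nonneg_nonneg zero_le_power)
  define bad where "bad j i = {\<omega> \<in> space M. y j \<le> \<bar>cell_dev n (pt j i) (pt j (Suc i)) \<omega>\<bar>}" for j i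
  have [measurable]: "bad j i \<in> sets M" for j i unfolding bad_def by measurable
  define A where "A = (\<Union>j\<in>{..J}. \<Union>i\<in>{..<2 ^ j}. bad j i)"
  have A: "A \<in> sets M" unfolding A_def by measurable
  have cell: "prob (bad j i) \<le> 1536 * (W / 2 ^ j)\<^sup>2 / y j ^ 4" if j: "j \<le> J" for j i
  proof -
    have nw: "real n * (B * (L / 2 ^ j)) = W / 2 ^ j" by (simp add: W_def)
    have "(2::real) ^ j \<le> 2 ^ J" using j by (intro power_increasing) auto
    from order_trans[OF this J(1)] have "1 \<le> W / 2 ^ j" by simp
    then have "1 \<le> real n * (B * (L / 2 ^ j))" by (simp only: nw)
    moreover have "F (pt j (Suc i)) - F (pt j i) \<le> B * (L / 2 ^ j)"
      using lip[OF pt_le, of j i] pt_step by simp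
    ultimately have "prob (bad j i) \<le> 1536 * (real n * (B * (L / 2 ^ j)))\<^sup>2 / y j ^ 4"
      unfolding bad_def using y pt_le by (intro cell_dev_tail) auto
    then show ?thesis by (simp only: nw)
  qed
  have "prob A \<le> (\<Sum>j\<le>J. prob (\<Union>i\<in>{..<2 ^ j}. bad j i))"
    unfolding A_def by (rule measure_UNION_le) auto
  also have "\<dots> \<le> (\<Sum>j\<le>J. 1536 / q ^ 4 * (4/5) ^ j)"
  proof (rule sum_mono)
    fix j assume j: "j \<in> {..J}"
    have "prob (\<Union>i\<in>{..<2 ^ j}. bad j i) \<le> (\<Sum>i\<in>{..<2 ^ j}. prob (bad j i))"
      by (rule measure_UNION_le) auto
    also have "\<dots> \<le> (\<Sum>i\<in>{..<2 ^ j :: nat}. 1536 * (W / 2 ^ j)\<^sup>2 / y j ^ 4)"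
      using j by (intro sum_mono cell) auto
    also have "\<dots> = 2 ^ j * (1536 * (W / 2 ^ j)\<^sup>2 / y j ^ 4)" by simp
    also have "y j ^ 4 = q ^ 4 * W\<^sup>2 * ((9/10) ^ 4) ^ j"
    proof -
      have "sqrt W ^ 4 = W\<^sup>2" using sW(3) by (simp add: power2_eq_square eval_nat_numeral)
      then show ?thesis by (simp add: y_def power_mult_distrib power_mult[symmetric] mult.commute)
    qed
    also have "2 ^ j * (1536 * (W / 2 ^ j)\<^sup>2 / (q ^ 4 * W\<^sup>2 * ((9/10) ^ 4) ^ j)) = 1536 / q ^ 4 * (5000/6561) ^ j"
    proof -
      have "2 ^ j * (1536 * (W / 2 ^ j)\<^sup>2 / (q ^ 4 * W\<^sup>2 * ((9/10) ^ 4) ^ j))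
        = 1536 / q ^ 4 * (1 / (2 ^ j * ((9/10) ^ 4) ^ j))"
        using W by (simp add: power_divide power2_eq_square)
      also have "1 / (2 ^ j * ((9/10) ^ 4) ^ j) = (1 / (2 * (9/10) ^ 4) :: real) ^ j"
        by (simp only: power_divide power_one power_mult_distrib)
      also have "1 / (2 * (9/10) ^ 4) = (5000/6561 :: real)" by (simp add: power4_eq_xxxx)
      finally show ?thesis .
    qed
    also have "\<dots> \<le> 1536 / q ^ 4 * (4/5) ^ j"
      using q by (intro mult_left_mono power_mono) auto
    finally show "prob (\<Union>i\<in>{..<2 ^ j}. bad j i) \<le> 1536 / q ^ 4 * (4/5) ^ j" .
  qed
  also have "\<dots> = 1536 / q ^ 4 * (\<Sum>j\<le>J. (4/5) ^ j)" by (simp only: sum_distrib_left)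
  also have "\<dots> \<le> 1536 / q ^ 4 * (1 / (1 - 4/5))"
    using q by (intro mult_left_mono sum_geometric_le) auto
  finally have pA: "prob A \<le> 7680 / q ^ 4" by simp
  have main: "\<bar>real n * dev n \<omega> t - real n * dev n \<omega> a\<bar> \<le> 13 * q * sqrt W"
    if om: "\<omega> \<in> space M - A" and t: "a \<le> t" "t \<le> a + L" for \<omega> t
  proof -
    define \<phi> where "\<phi> s = real n * dev n \<omega> s" for s
    have step: "\<bar>\<phi> (pt j (Suc i)) - \<phi> (pt j i)\<bar> \<le> y j" if "j \<le> J" "i < 2 ^ j" for j i
    proof -
      have "\<omega> \<notin> bad j i" using om that by (auto simp: A_def)
      then have "\<bar>cell_dev n (pt j i) (pt j (Suc i)) \<omega>\<bar> < y j" using om by (auto simp: bad_def)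
      then show ?thesis by (simp add: cell_dev_eq[OF pt_le] \<phi>_def right_diff_distrib)
    qed
    have "(\<Sum>k\<le>J. y k) = q * sqrt W * (\<Sum>k\<le>J. (9/10) ^ k)" by (simp only: y_def sum_distrib_left)
    also have "\<dots> \<le> q * sqrt W * (1 / (1 - 9/10))"
      using q sW by (intro mult_left_mono sum_geometric_le) auto
    finally have sum_y: "(\<Sum>k\<le>J. y k) \<le> 10 * (q * sqrt W)" by simp
    have grid: "\<bar>\<phi> (pt J i) - \<phi> a\<bar> \<le> 10 * (q * sqrt W)" if "i \<le> 2 ^ J" for i
      using dyadic_chaining[of J \<phi> a L y J i] step y that sum_y unfolding pt_def by (force intro: less_imp_le)
    have yJ: "y J \<le> q * sqrt W * 1"
      unfolding y_def using q sW by (intro mult_left_mono power_le_one) auto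
    have "1 * 1 \<le> q * sqrt W" using q sW by (intro mult_mono) auto
    then have qW: "1 \<le> q * sqrt W" by simp
    have small: "real n * (B * (L / 2 ^ J)) \<le> 2" using J(2) by (simp add: W_def field_simps)
    show ?thesis
    proof (cases "t = a + L")
      case True
      then have "t = pt J (2 ^ J)" by (simp add: pt_def)
      then show ?thesis using grid[of "2 ^ J"] qW by (simp add: \<phi>_def)
    next
      case False
      define i where "i = nat \<lfloor>(t - a) * 2 ^ J / L\<rfloor>"
      have z: "0 \<le> (t - a) * 2 ^ J / L" using t L by simp
      have i1: "real i \<le> (t - a) * 2 ^ J / L" "(t - a) * 2 ^ J / L < real (Suc i)"
        using z by (auto simp: i_def; linarith)+
      have "t - a < L" using t False by simp
      then have "(t - a) * 2 ^ J < L * 2 ^ J" by (intro mult_strict_right_mono) auto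
      then have "(t - a) * 2 ^ J / L < 2 ^ J" using L by (simp add: divide_less_eq mult.commute)
      with i1(1) have "real i < 2 ^ J" by (rule le_less_trans)
      then have "real i < real (2 ^ J)" by (simp only: of_nat_power of_nat_numeral)
      then have i2: "i < 2 ^ J" by (simp only: of_nat_less_iff)
      have lo: "pt J i \<le> t" using i1(1) L by (simp add: pt_def field_simps)
      have hi: "t \<le> pt J (Suc i)" using i1(2) L by (simp add: pt_def field_simps)
      \<comment> \<open>Inside a finest cell counts and F are both monotone, so the deviation
        exceeds the increment over the cell by at most the drift. The 13 is 10 from the grid, 1 from
        the last cell and 2 from the drift, absorbed because q * sqrt W >= 1.\<close>
      define N where "N s = real n * ecdf n (\<lambda>i. X i \<omega>) s" for s
      have N: "N s \<le> N s'" if "s \<le> s'" for s s'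
        unfolding N_def ecdf_sum using that by (intro sum_mono) (auto simp: indicator_def)
      have \<phi>: "\<phi> s = N s - real n * F s" for s by (simp add: \<phi>_def N_def dev_def right_diff_distrib)
      have "F (pt J (Suc i)) - F (pt J i) \<le> B * (L / 2 ^ J)"
        using lip[OF pt_le, of J i] pt_step by simp
      then have "real n * (F (pt J (Suc i)) - F (pt J i)) \<le> real n * (B * (L / 2 ^ J))"
        by (intro mult_left_mono) auto
      then have Fd: "real n * F (pt J (Suc i)) - real n * F (pt J i) \<le> 2"
        using small by (simp add: right_diff_distrib)
      have Fm: "real n * F (pt J i) \<le> real n * F t" "real n * F t \<le> real n * F (pt J (Suc i))"
        using F_mono[OF lo] F_mono[OF hi] by (auto intro!: mult_left_mono)
      have "\<bar>\<phi> (pt J (Suc i)) - \<phi> (pt J i)\<bar> \<le> y J" by (rule step) (use i2 in auto)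
      then have "\<bar>\<phi> t - \<phi> (pt J i)\<bar> \<le> y J + 2"
        using Fd Fm N[OF lo] N[OF hi] unfolding \<phi> by linarith
      moreover have "\<bar>\<phi> (pt J i) - \<phi> a\<bar> \<le> 10 * (q * sqrt W)" using i2 by (intro grid) auto
      ultimately have "\<bar>\<phi> t - \<phi> a\<bar> \<le> 13 * (q * sqrt W)" using yJ qW by linarith
      then show ?thesis by (simp add: \<phi>_def)
    qed
  qed
  show ?thesis
  proof (rule that[OF A pA])
    fix \<omega> t assume "\<omega> \<in> space M - A" "a \<le> t" "t \<le> a + L"
    then show "\<bar>real n * dev n \<omega> t - real n * dev n \<omega> a\<bar> \<le> 13 * q * sqrt (real n * (B * L))"
      unfolding W_def[symmetric] by (rule main)
  qed
qed

text \<open>Points to the left of c are reached from the anchor c - L, as is c itself, which doubles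
  the deviation; the two exceptional sets double the probability.\<close>

lemma dev_near:
  assumes L: "0 < L" "1 \<le> real n * (B * L)" and q: "1 \<le> q"
  obtains A where "A \<in> sets M" "prob A \<le> 15360 / q ^ 4"
    "\<And>\<omega> t. \<omega> \<in> space M - A \<Longrightarrow> \<bar>t - c\<bar> \<le> L \<Longrightarrow> \<bar>dev n \<omega> t - dev n \<omega> c\<bar> \<le> 26 * q * sqrt (B * L / real n)"
proof -
  obtain A1 where A1: "A1 \<in> sets M" "prob A1 \<le> 7680 / q ^ 4"
    "\<And>\<omega> t. \<omega> \<in> space M - A1 \<Longrightarrow> c \<le> t \<Longrightarrow> t \<le> c + L \<Longrightarrow>
      \<bar>real n * dev n \<omega> t - real n * dev n \<omega> c\<bar> \<le> 13 * q * sqrt (real n * (B * L))"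
    using dev_interval[OF L q, of c] by blast
  obtain A2 where A2: "A2 \<in> sets M" "prob A2 \<le> 7680 / q ^ 4"
    "\<And>\<omega> t. \<omega> \<in> space M - A2 \<Longrightarrow> c - L \<le> t \<Longrightarrow> t \<le> c - L + L \<Longrightarrow>
      \<bar>real n * dev n \<omega> t - real n * dev n \<omega> (c - L)\<bar> \<le> 13 * q * sqrt (real n * (B * L))"
    using dev_interval[OF L q, of "c - L"] by blast
  have n: "0 < real n" using L(2) by (cases "n = 0") auto
  have "prob (A1 \<union> A2) \<le> 15360 / q ^ 4"
    using measure_Un_le[OF A1(1) A2(1)] A1(2) A2(2) by simp
  moreover have "\<bar>dev n \<omega> t - dev n \<omega> c\<bar> \<le> 26 * q * sqrt (B * L / real n)"
    if om: "\<omega> \<in> space M - (A1 \<union> A2)" and t: "\<bar>t - c\<bar> \<le> L" for \<omega> t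
  proof -
    define s where "s = q * sqrt (real n * (B * L))"
    have s0: "0 \<le> s" using q L B by (simp add: s_def)
    have "\<bar>real n * dev n \<omega> t - real n * dev n \<omega> c\<bar> \<le> 26 * s"
    proof (cases "c \<le> t")
      case True
      then show ?thesis using A1(3)[of \<omega> t] om t s0 by (simp add: s_def)
    next
      case False
      then have "\<bar>real n * dev n \<omega> t - real n * dev n \<omega> (c - L)\<bar> \<le> 13 * s"
        "\<bar>real n * dev n \<omega> c - real n * dev n \<omega> (c - L)\<bar> \<le> 13 * s"
        using A2(3)[of \<omega> t] A2(3)[of \<omega> c] om t L by (auto simp: s_def)
      then show ?thesis by linarith
    qed
    then have "real n * \<bar>dev n \<omega> t - dev n \<omega> c\<bar> \<le> 26 * s"
      using n by (simp add: abs_mult flip: right_diff_distrib)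
    then have "\<bar>dev n \<omega> t - dev n \<omega> c\<bar> \<le> 26 * s / real n" using n by (simp add: field_simps)
    also have "s / real n = q * sqrt (B * L / real n)"
      using n by (simp add: s_def real_sqrt_divide real_sqrt_mult field_simps)
    then have "26 * s / real n = 26 * q * sqrt (B * L / real n)" by simp
    finally show ?thesis .
  qed
  ultimately show ?thesis using that[of "A1 \<union> A2"] A1(1) A2(1) by blast
qed

text \<open>Relaxing the bound at scale \<open>2 ^ m * L0\<close> by the factor \<open>2 powr (m/4)\<close>
  makes the failure probabilities summable over all scales.\<close>

lemma dev_all_scales:
  assumes L0: "0 < L0" "1 \<le> real n * (B * L0)" and K: "1 \<le> K"
  obtains A where "A \<in> sets M" "prob A \<le> 30720 / K ^ 4"
    "\<And>\<omega> L t. \<omega> \<in> space M - A \<Longrightarrow> L0 \<le> L \<Longrightarrow> L \<le> Z \<Longrightarrow> \<bar>t - c\<bar> \<le> L \<Longrightarrow>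
      \<bar>dev n \<omega> t - dev n \<omega> c\<bar> \<le> 52 * K * sqrt (2 * B) * (L / L0) powr (1/4) * sqrt (L / real n)"
proof -
  define q where "q m = K * 2 powr (real m / 4)" for m :: nat
  have q: "1 \<le> q m" for m
    using mult_mono[of 1 K 1 "2 powr (real m / 4)"] K by (simp add: q_def ge_one_powr_ge_zero)
  have q4: "q m ^ 4 = K ^ 4 * 2 ^ m" for m
    by (simp add: q_def power_mult_distrib powr_power powr_realpow)
  have pos: "0 < 2 ^ m * L0" "1 \<le> real n * (B * (2 ^ m * L0))" for m
  proof -
    show "0 < 2 ^ m * L0" using L0 by simp
    have "1 * 1 \<le> 2 ^ m * (real n * (B * L0))" using L0 by (intro mult_mono) auto
    then show "1 \<le> real n * (B * (2 ^ m * L0))" by (simp add: mult_ac)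
  qed
  have "\<forall>m. \<exists>A. A \<in> sets M \<and> prob A \<le> 15360 / q m ^ 4 \<and>
    (\<forall>\<omega> t. \<omega> \<in> space M - A \<longrightarrow> \<bar>t - c\<bar> \<le> 2 ^ m * L0 \<longrightarrow>
      \<bar>dev n \<omega> t - dev n \<omega> c\<bar> \<le> 26 * q m * sqrt (B * (2 ^ m * L0) / real n))"
    using dev_near[OF pos q] by metis
  from choice[OF this] obtain S where S: "\<And>m. S m \<in> sets M" "\<And>m. prob (S m) \<le> 15360 / q m ^ 4"
    "\<And>m \<omega> t. \<omega> \<in> space M - S m \<Longrightarrow> \<bar>t - c\<bar> \<le> 2 ^ m * L0 \<Longrightarrow>
      \<bar>dev n \<omega> t - dev n \<omega> c\<bar> \<le> 26 * q m * sqrt (B * (2 ^ m * L0) / real n)"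
    by blast
  obtain m0 :: nat where m0: "Z / L0 < 2 ^ m0" using real_arch_pow[of 2 "Z / L0"] by auto
  define A where "A = (\<Union>m\<in>{..m0}. S m)"
  have A: "A \<in> sets M" unfolding A_def using S(1) by auto
  have "prob A \<le> (\<Sum>m\<le>m0. prob (S m))" unfolding A_def by (rule measure_UNION_le) (auto simp: S)
  also have "\<dots> \<le> (\<Sum>m\<le>m0. 15360 / K ^ 4 * (1/2) ^ m)"
    using S(2) by (intro sum_mono) (simp add: q4 power_one_over field_simps)
  also have "\<dots> = 15360 / K ^ 4 * (\<Sum>m\<le>m0. (1/2) ^ m)" by (simp only: sum_distrib_left)
  also have "\<dots> \<le> 15360 / K ^ 4 * (1 / (1 - 1/2))" using K by (intro mult_left_mono sum_geometric_le) auto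
  finally have pA: "prob A \<le> 30720 / K ^ 4" by simp
  have main: "\<bar>dev n \<omega> t - dev n \<omega> c\<bar> \<le> 52 * K * sqrt (2 * B) * (L / L0) powr (1/4) * sqrt (L / real n)"
    if om: "\<omega> \<in> space M - A" and L: "L0 \<le> L" "L \<le> Z" and t: "\<bar>t - c\<bar> \<le> L" for \<omega> L t
  proof -
    \<comment> \<open>The least dyadic scale above L is below 2L; passing to it costs a factor 2 in
      q and the 2 in sqrt (2 * B).\<close>
    define m where "m = (LEAST m. L \<le> 2 ^ m * L0)"
    have "L \<le> 2 ^ m0 * L0" using m0 L L0 by (simp add: field_simps)
    then have m: "L \<le> 2 ^ m * L0" "m \<le> m0" unfolding m_def by (auto intro: LeastI Least_le)
    have m2: "2 ^ m * L0 \<le> 2 * L"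
    proof (cases m)
      case 0 then show ?thesis using L L0 by simp
    next
      case (Suc k)
      then have "\<not> L \<le> 2 ^ k * L0" using not_less_Least[of k "\<lambda>m. L \<le> 2 ^ m * L0"] by (simp add: m_def)
      then show ?thesis using Suc by simp
    qed
    have "2 powr (real m / 4) = (2 ^ m) powr (1/4)" by (simp add: powr_powr flip: powr_realpow)
    also have "\<dots> \<le> (2 * (L / L0)) powr (1/4)" using m2 L0 by (intro powr_mono2) (auto simp: field_simps)
    also have "\<dots> = 2 powr (1/4) * (L / L0) powr (1/4)" by (rule powr_mult)
    also have "\<dots> \<le> 2 powr 1 * (L / L0) powr (1/4)" by (intro mult_right_mono powr_mono) auto
    finally have qm: "q m \<le> K * (2 * (L / L0) powr (1/4))" unfolding q_def using K by (intro mult_left_mono) auto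
    have "sqrt (B * (2 ^ m * L0) / real n) \<le> sqrt (B * (2 * L) / real n)"
      using m2 B by (intro real_sqrt_le_mono divide_right_mono mult_left_mono) auto
    also have "B * (2 * L) / real n = (2 * B) * (L / real n)" by simp
    also have "sqrt \<dots> = sqrt (2 * B) * sqrt (L / real n)" by (rule real_sqrt_mult)
    finally have sq: "sqrt (B * (2 ^ m * L0) / real n) \<le> sqrt (2 * B) * sqrt (L / real n)" .
    have "\<omega> \<in> space M - S m" using om m(2) by (auto simp: A_def)
    then have "\<bar>dev n \<omega> t - dev n \<omega> c\<bar> \<le> 26 * q m * sqrt (B * (2 ^ m * L0) / real n)"
      using t m(1) by (intro S(3)) auto
    also have "\<dots> \<le> 26 * (K * (2 * (L / L0) powr (1/4))) * (sqrt (2 * B) * sqrt (L / real n))"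
      using qm sq q[of m] K B L L0 by (intro mult_mono) auto
    finally show ?thesis by (simp add: mult_ac)
  qed
  show ?thesis by (rule that[OF A pA main])
qed

end

subsection \<open>Rates of convergence\<close>

lemma distributed_cdf:
  assumes X: "distributed M lborel Y (\<lambda>t. ennreal (f0 t * indicator {0..} t))"
    and nonneg: "\<And>t. 0 \<le> t \<Longrightarrow> 0 \<le> f0 t" and int: "set_integrable lborel {0..} f0"
  shows "measure M {\<omega> \<in> space M. Y \<omega> \<le> t} = cum f0 t"
proof -
  have i: "set_integrable lborel {0..t} f0" by (rule set_integrable_subset[OF int]) auto
  have "emeasure M (Y -` {..t} \<inter> space M) = (\<integral>\<^sup>+s. ennreal (f0 s * indicator {0..} s) * indicator {..t} s \<partial>lborel)"
    by (rule distributed_emeasure[OF X]) simp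
  also have "\<dots> = (\<integral>\<^sup>+s. ennreal (indicator {0..t} s *\<^sub>R f0 s) \<partial>lborel)"
    by (intro nn_integral_cong) (auto simp: indicator_def)
  also have "\<dots> = ennreal (LINT s:{0..t}|lborel. f0 s)"
    unfolding set_lebesgue_integral_def using i nonneg
    by (intro nn_integral_eq_integral) (auto simp: set_integrable_def indicator_def)
  also have "(LINT s:{0..t}|lborel. f0 s) = cum f0 t"
    using set_borel_integral_eq_integral(2)[OF i] by (simp add: cum_def)
  finally have "emeasure M (Y -` {..t} \<inter> space M) = ennreal (cum f0 t)" .
  moreover have "Y -` {..t} \<inter> space M = {\<omega> \<in> space M. Y \<omega> \<le> t}" by auto
  moreover have "0 \<le> cum f0 t"
    unfolding cum_def using nonneg set_borel_integral_eq_integral(1)[OF i] by (intro integral_nonneg) auto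
  ultimately show ?thesis by (simp add: measure_def)
qed

lemma cum_lipschitz:
  assumes nonneg: "\<And>t. 0 \<le> t \<Longrightarrow> 0 \<le> f0 t" and bound: "\<And>t. 0 \<le> t \<Longrightarrow> f0 t \<le> B"
    and int: "\<And>b. f0 integrable_on {0..b}" and uv: "u \<le> v"
  shows "cum f0 v - cum f0 u \<le> B * (v - u)"
proof -
  have B: "0 \<le> B" using nonneg[of 0] bound[of 0] by simp
  have main: "cum f0 v - cum f0 u \<le> B * (v - u)" if "0 \<le> u" "u \<le> v" for u v
  proof -
    have "integral {0..u} f0 + integral {u..v} f0 = integral {0..v} f0"
      using that by (intro Henstock_Kurzweil_Integration.integral_combine int) auto
    moreover have "integral {u..v} f0 \<le> integral {u..v} (\<lambda>_. B)"
    proof (rule integral_le)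
      show "f0 integrable_on {u..v}" by (rule integrable_on_subinterval[OF int[of v]]) (use that in auto)
    qed (use that bound in auto)
    ultimately show ?thesis using that by (simp add: cum_def mult.commute)
  qed
  consider "v \<le> 0" | "u < 0" "0 < v" | "0 \<le> u" by linarith
  then show ?thesis
  proof cases
    case 1
    have z: "cum f0 w = 0" if "w \<le> 0" for w using that by (cases "w = 0") (auto simp: cum_def)
    show ?thesis using 1 uv B z[of u] z[of v] by simp
  next
    case 2
    have "cum f0 v - cum f0 0 \<le> B * (v - 0)" using 2 by (intro main) auto
    also have "\<dots> \<le> B * (v - u)" using 2 B by (intro mult_left_mono) auto
    finally show ?thesis using 2 by (simp add: cum_def)
  next
    case 3 then show ?thesis using uv by (rule main)
  qed
qed

lemma bigO_in_probI:
  assumes "\<And>\<epsilon>. 0 < \<epsilon> \<Longrightarrow> \<exists>C>0. \<forall>\<^sub>F n in sequentially. \<exists>A\<in>sets M. measure M A \<le> \<epsilon> \<and>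
      (\<forall>\<omega>\<in>space M - A. \<bar>Y n \<omega>\<bar> \<le> C * r n)"
  shows "bigO_in_prob M Y r"
  unfolding bigO_in_prob_def
proof (intro allI impI)
  fix \<epsilon> :: real assume "0 < \<epsilon>"
  from assms[OF this] obtain C where C: "0 < C" and ev: "\<forall>\<^sub>F n in sequentially. \<exists>A\<in>sets M.
      measure M A \<le> \<epsilon> \<and> (\<forall>\<omega>\<in>space M - A. \<bar>Y n \<omega>\<bar> \<le> C * r n)"
    by blast
  from ev have "\<forall>\<^sub>F n in sequentially. \<exists>A\<in>sets M. {\<omega> \<in> space M. \<bar>Y n \<omega>\<bar> > C * r n} \<subseteq> A \<and> measure M A \<le> \<epsilon>"
  proof eventually_elim
    case (elim n)
    then obtain A where A: "A \<in> sets M" "measure M A \<le> \<epsilon>"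
      "\<And>\<omega>. \<omega> \<in> space M - A \<Longrightarrow> \<bar>Y n \<omega>\<bar> \<le> C * r n" by blast
    have "{\<omega> \<in> space M. \<bar>Y n \<omega>\<bar> > C * r n} \<subseteq> A"
    proof (rule subsetI, rule ccontr)
      fix \<omega> assume "\<omega> \<in> {\<omega> \<in> space M. \<bar>Y n \<omega>\<bar> > C * r n}" "\<omega> \<notin> A"
      then show False using A(3)[of \<omega>] by simp
    qed
    then show ?case using A(1,2) by blast
  qed
  then show "\<exists>C>0. \<forall>\<^sub>F n in sequentially. \<exists>A\<in>sets M. {\<omega> \<in> space M. \<bar>Y n \<omega>\<bar> > C * r n} \<subseteq> A \<and> measure M A \<le> \<epsilon>"
    using C by blast
qed

theorem theorem2p13:
  fixes M :: "'a measure" and X :: "nat \<Rightarrow> 'a \<Rightarrow> real"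
    and f\<^sub>0 :: "real \<Rightarrow> real" and x\<^sub>0 K\<^sub>1 K\<^sub>2 \<alpha> :: real
  assumes density: "probability_density_on_nonneg f\<^sub>0"
    and convex: "convex_on {0..} f\<^sub>0"
    and decreasing: "antimono_on {0..} f\<^sub>0"
    and x0: "0 < x\<^sub>0" "0 < f\<^sub>0 x\<^sub>0"
    and constants: "K\<^sub>1 < 0" "0 < K\<^sub>2" "1 < \<alpha>"
    and local_form:
      "(\<forall>\<^sub>F t in nhds x\<^sub>0. f\<^sub>0 t = f\<^sub>0 x\<^sub>0 + K\<^sub>1 * (t - x\<^sub>0)
            + K\<^sub>2 * (t - x\<^sub>0) powr \<alpha> * indicator {x\<^sub>0..} t) \<or>
       (\<forall>\<^sub>F t in nhds x\<^sub>0. f\<^sub>0 t = f\<^sub>0 x\<^sub>0 + K\<^sub>1 * (t - x\<^sub>0)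
            + K\<^sub>2 * (x\<^sub>0 - t) powr \<alpha> * indicator {0..<x\<^sub>0} t)"
    and prob: "prob_space M"
    and indep: "prob_space.indep_vars M (\<lambda>_. borel) X UNIV"
    and distr: "\<And>i. distributed M lborel (X i) (\<lambda>t. ennreal (f\<^sub>0 t * indicator {0..} t))"
  shows "bigO_in_prob M
           (\<lambda>n \<omega>. \<bar>convex_lse n (\<lambda>i. X i \<omega>) x\<^sub>0 - f\<^sub>0 x\<^sub>0\<bar>)
           (\<lambda>n. real n powr (- (\<alpha> / (2 * \<alpha> + 1))) * sqrt (ln (ln (real n))))
       \<and> bigO_in_prob M
           (\<lambda>n \<omega>. min (convex_lse n (\<lambda>i. X i \<omega>) x\<^sub>0 - f\<^sub>0 x\<^sub>0) 0)
           (\<lambda>n. real n powr (- (1 / 2)))"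
proof -
  have nonneg: "\<And>t. 0 \<le> t \<Longrightarrow> 0 \<le> f\<^sub>0 t" and int: "set_integrable lborel {0..} f\<^sub>0"
    using density by (auto simp: probability_density_on_nonneg_def)
  have antimono: "\<And>s t. 0 \<le> s \<Longrightarrow> s \<le> t \<Longrightarrow> f\<^sub>0 t \<le> f\<^sub>0 s"
    using decreasing by (auto simp: monotone_on_def)
  have int_on: "f\<^sub>0 integrable_on {0..b}" for b
    by (rule set_borel_integral_eq_integral(1)[OF set_integrable_subset[OF int]]) auto
  define B where "B = f\<^sub>0 0"
  have B: "0 < B" using antimono[of 0 x\<^sub>0] x0 by (simp add: B_def)
  have cdf: "measure M {\<omega> \<in> space M. X i \<omega> \<le> t} = cum f\<^sub>0 t" for i t
    by (rule distributed_cdf[OF distr nonneg int])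
  interpret prob_space M by (rule prob)
  interpret iid_cdf M X "cum f\<^sub>0" B
    by unfold_locales
      (use indep cdf B cum_lipschitz[OF nonneg _ int_on] antimono[of 0] in \<open>auto simp: B_def\<close>)
  have "\<exists>Z\<ge>x\<^sub>0. \<forall>\<kappa>>0. \<exists>C>0. \<exists>\<rho>>0. \<exists>\<epsilon>>0. error_controlled f\<^sub>0 x\<^sub>0 \<alpha> \<kappa> Z C \<rho> \<epsilon>"
    by (rule lse_error_bounds) (fact nonneg convex antimono int x0 constants local_form)+
  then obtain Z where Z: "x\<^sub>0 \<le> Z"
    and Zb: "\<And>\<kappa>. 0 < \<kappa> \<Longrightarrow> \<exists>C>0. \<exists>\<rho>>0. \<exists>\<epsilon>>0. error_controlled f\<^sub>0 x\<^sub>0 \<alpha> \<kappa> Z C \<rho> \<epsilon>"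
    by blast
  have Z0: "0 < Z" using Z x0 by simp
  \<comment> \<open>The exponent with \<open>L\<^sub>0 = n powr (- \<beta>)\<close>: then
    \<open>L\<^sub>0 powr (2 * \<alpha> + 1)\<close> is 1/n and
    \<open>L\<^sub>0 powr \<alpha>\<close> is the rate.\<close>
  define \<beta> where "\<beta> = 1 / (2 * \<alpha> + 1)"
  have \<beta>: "0 < \<beta>" "\<beta> \<le> 1/2" "\<alpha> * \<beta> = \<alpha> / (2 * \<alpha> + 1)" "\<alpha> * \<beta> \<le> 1/2" "(2 * \<alpha> + 1) * \<beta> = 1"
    using constants by (auto simp: \<beta>_def field_simps)
  define D where "D n \<omega> = convex_lse n (\<lambda>i. X i \<omega>) x\<^sub>0 - f\<^sub>0 x\<^sub>0" for n \<omega>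
  \<comment> \<open>Both claims are read off one event, on which the rate holds even without the
    iterated logarithm.\<close>
  have event: "\<exists>C>0. \<forall>\<^sub>F n in sequentially. \<exists>A\<in>sets M. prob A \<le> \<epsilon> \<and>
      (\<forall>\<omega>\<in>space M - A. - (C * real n powr (- (1 / 2))) \<le> D n \<omega> \<and>
         \<bar>D n \<omega>\<bar> \<le> C * real n powr (- (\<alpha> / (2 * \<alpha> + 1))))"
    if eps: "0 < \<epsilon>" for \<epsilon> :: real
  proof -
    \<comment> \<open>46080 is the sum of 15360 and 30720, the constants in the failure
      probabilities at scale Z and over all scales; K <= K^4 avoids a root.\<close>
    define K where "K = max 1 (46080 / \<epsilon>)"
    have K: "1 \<le> K" "46080 / \<epsilon> \<le> K" by (auto simp: K_def)
    have "K \<le> K ^ 4" using K(1) by (simp add: self_le_power)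
    then have "46080 / \<epsilon> \<le> K ^ 4" using K by simp
    then have K4: "15360 / K ^ 4 + 30720 / K ^ 4 \<le> \<epsilon>"
      using eps K(1) by (simp add: field_simps)
    define \<kappa> where "\<kappa> = 52 * K * sqrt (2 * B)"
    have "0 < \<kappa>" using K B by (simp add: \<kappa>_def)
    from Zb[OF this] obtain C \<rho> \<epsilon>\<^sub>1 where C: "0 < C" "0 < \<rho>" "0 < \<epsilon>\<^sub>1"
      and bound: "error_controlled f\<^sub>0 x\<^sub>0 \<alpha> \<kappa> Z C \<rho> \<epsilon>\<^sub>1"
      by blast
    define E where "E = 26 * K * sqrt (B * Z)"
    have E: "0 < E" using K B Z0 by (simp add: E_def)
    have ev1: "\<forall>\<^sub>F n in sequentially. real n powr (- \<beta>) < \<rho>"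
      using tendsto_neg_powr[OF _ filterlim_real_sequentially, of "- \<beta>"] \<beta> C by (auto intro: order_tendstoD)
    have "(\<lambda>n. E * real n powr (- (1 / 2))) \<longlonglongrightarrow> E * 0"
      by (intro tendsto_intros tendsto_neg_powr filterlim_real_sequentially) auto
    then have ev2: "\<forall>\<^sub>F n in sequentially. E * real n powr (- (1 / 2)) < \<epsilon>\<^sub>1"
      using C by (intro order_tendstoD(2)) auto
    \<comment> \<open>These thresholds make the expected count bounds n B L at least 1 at the scales
      \<open>L\<^sub>0\<close> and Z; for \<open>L\<^sub>0\<close> because n powr (1 - beta) >= sqrt
      n.\<close>
    have ev3: "\<forall>\<^sub>F n in sequentially. max 1 (max (1 / B\<^sup>2) (1 / (B * Z))) \<le> real n"
      using filterlim_real_sequentially unfolding filterlim_at_top by blast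
    show ?thesis
    proof (intro exI[of _ "C * (E + 1)"] conjI)
      show "0 < C * (E + 1)" using C E by simp
      show "\<forall>\<^sub>F n in sequentially. \<exists>A\<in>sets M. prob A \<le> \<epsilon> \<and>
        (\<forall>\<omega>\<in>space M - A. - (C * (E + 1) * real n powr (- (1 / 2))) \<le> D n \<omega> \<and>
         \<bar>D n \<omega>\<bar> \<le> C * (E + 1) * real n powr (- (\<alpha> / (2 * \<alpha> + 1))))"
        using ev1 ev2 ev3
      proof eventually_elim
        case (elim n)
        define L\<^sub>0 where "L\<^sub>0 = real n powr (- \<beta>)"
        define e where "e = E * real n powr (- (1 / 2))"
        have n: "1 \<le> real n" "1 / B\<^sup>2 \<le> real n" "1 / (B * Z) \<le> real n" using elim(3) by auto
        have n0: "0 < n" using n by (cases n) auto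
        have L0: "0 < L\<^sub>0" "L\<^sub>0 < \<rho>" using n elim(1) by (auto simp: L\<^sub>0_def)
        have e1: "e < \<epsilon>\<^sub>1" using elim(2) by (simp add: e_def)
        have nL0: "1 \<le> real n * (B * L\<^sub>0)"
        proof -
          have "1 / real n \<le> B\<^sup>2" using n(1,2) B by (simp add: field_simps)
          then have "sqrt (1 / real n) \<le> sqrt (B\<^sup>2)" by (rule real_sqrt_le_mono)
          then have "1 \<le> B * sqrt (real n)" using n(1) B by (simp add: real_sqrt_divide field_simps)
          also have "sqrt (real n) = real n powr (1/2)" using n(1) by (simp add: powr_half_sqrt)
          also have "\<dots> \<le> real n powr (1 + - \<beta>)" using n(1) \<beta> by (intro powr_mono) auto
          also have "\<dots> = real n * L\<^sub>0" using n(1) by (simp only: powr_add) (simp add: L\<^sub>0_def)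
          finally show ?thesis using B by (simp add: mult_ac)
        qed
        have nZ: "1 \<le> real n * (B * Z)" using n(3) B Z0 by (simp add: field_simps)
        obtain A1 where A1: "A1 \<in> sets M" "prob A1 \<le> 15360 / K ^ 4"
          "\<And>\<omega> t. \<omega> \<in> space M - A1 \<Longrightarrow> \<bar>t - x\<^sub>0\<bar> \<le> Z \<Longrightarrow>
            \<bar>dev n \<omega> t - dev n \<omega> x\<^sub>0\<bar> \<le> 26 * K * sqrt (B * Z / real n)"
          using dev_near[OF Z0 nZ K(1), of x\<^sub>0] by blast
        obtain A2 where A2: "A2 \<in> sets M" "prob A2 \<le> 30720 / K ^ 4"
          "\<And>\<omega> L t. \<omega> \<in> space M - A2 \<Longrightarrow> L\<^sub>0 \<le> L \<Longrightarrow> L \<le> Z \<Longrightarrow> \<bar>t - x\<^sub>0\<bar> \<le> L \<Longrightarrow>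
            \<bar>dev n \<omega> t - dev n \<omega> x\<^sub>0\<bar> \<le> 52 * K * sqrt (2 * B) * (L / L\<^sub>0) powr (1/4) * sqrt (L / real n)"
          using dev_all_scales[OF L0(1) nL0 K(1), of Z x\<^sub>0] by blast
        \<comment> \<open>Samples with a nonpositive observation form a null set; outside it the
          minimizer exists.\<close>
        define A3 where "A3 = (\<Union>i\<in>{..<n}. {\<omega> \<in> space M. X i \<omega> \<le> 0})"
        have A3: "A3 \<in> sets M" unfolding A3_def by measurable
        have "prob A3 \<le> (\<Sum>i\<in>{..<n}. prob {\<omega> \<in> space M. X i \<omega> \<le> 0})"
          unfolding A3_def by (rule measure_UNION_le) auto
        also have "\<dots> = 0" by (simp add: cdf)
        finally have pA3: "prob A3 \<le> 0" .
        have "prob (A1 \<union> A2 \<union> A3) \<le> prob A1 + prob A2 + prob A3"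
          using measure_Un_le[OF A1(1) A2(1)] measure_Un_le[OF sets.Un[OF A1(1) A2(1)] A3] by simp
        then have pA: "prob (A1 \<union> A2 \<union> A3) \<le> \<epsilon>" using A1(2) A2(2) pA3 K4 by simp
        have ez: "26 * K * sqrt (B * Z / real n) = e"
          using n(1) by (simp add: e_def E_def real_sqrt_divide powr_minus powr_half_sqrt field_simps)
        \<comment> \<open>Rewrites the bound from chaining with 1/n as a power of
          \<open>L\<^sub>0\<close>; the exponent 3/4 is 1/4 + 1/2.\<close>
        have scale: "52 * K * sqrt (2 * B) * (L / L\<^sub>0) powr (1/4) * sqrt (L / real n) = scale_noise \<kappa> \<alpha> L\<^sub>0 L"
          if L: "0 < L" for L
        proof -
          have "L\<^sub>0 powr (2 * \<alpha> + 1) = real n powr (- ((2 * \<alpha> + 1) * \<beta>))"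
            by (simp add: L\<^sub>0_def powr_powr mult.commute)
          then have n1: "1 / real n = L\<^sub>0 powr (2 * \<alpha> + 1)" using n(1) \<beta>(5) by (simp add: powr_minus divide_inverse)
          have n2: "L\<^sub>0 powr (2 * \<alpha> + 1) * L\<^sub>0 = (L\<^sub>0 powr (\<alpha> + 1))\<^sup>2"
            using L0 by (simp add: power2_eq_square flip: powr_add) (simp add: powr_add power2_eq_square)
          have "L / real n = L * (1 / real n)" by simp
          also have "\<dots> = (L\<^sub>0 powr (2 * \<alpha> + 1) * L\<^sub>0) * (L / L\<^sub>0)" unfolding n1 using L0 by simp
          finally have "L / real n = (L\<^sub>0 powr (\<alpha> + 1))\<^sup>2 * (L / L\<^sub>0)" by (simp only: n2)
          then have "sqrt (L / real n) = sqrt ((L\<^sub>0 powr (\<alpha> + 1))\<^sup>2) * sqrt (L / L\<^sub>0)"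
            by (simp only: real_sqrt_mult)
          also have "sqrt ((L\<^sub>0 powr (\<alpha> + 1))\<^sup>2) = L\<^sub>0 powr (\<alpha> + 1)" by simp
          also have "sqrt (L / L\<^sub>0) = (L / L\<^sub>0) powr (1/2)" using L L0 by (simp add: powr_half_sqrt)
          finally have "(L / L\<^sub>0) powr (1/4) * sqrt (L / real n) = L\<^sub>0 powr (\<alpha> + 1) * ((L / L\<^sub>0) powr (1/4) * (L / L\<^sub>0) powr (1/2))"
            by simp
          also have "(L / L\<^sub>0) powr (1/4) * (L / L\<^sub>0) powr (1/2) = (L / L\<^sub>0) powr (3/4)"
            by (simp flip: powr_add)
          finally show ?thesis by (simp add: scale_noise_def \<kappa>_def)
        qed
        have main: "- (C * (E + 1) * real n powr (- (1 / 2))) \<le> D n \<omega> \<and>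
           \<bar>D n \<omega>\<bar> \<le> C * (E + 1) * real n powr (- (\<alpha> / (2 * \<alpha> + 1)))"
          if om: "\<omega> \<in> space M - (A1 \<union> A2 \<union> A3)" for \<omega>
        proof -
          have pos: "0 < X i \<omega>" if "i < n" for i using om that by (auto simp: A3_def not_le)
          have lse: "lse n (\<lambda>i. X i \<omega>) (convex_lse n (\<lambda>i. X i \<omega>))"
            using convex_lse_minimizes[of n "\<lambda>i. X i \<omega>"] n0 pos by unfold_locales auto
          have nz: "local_noise n (\<lambda>i. X i \<omega>) f\<^sub>0 x\<^sub>0 Z e"
            using A1(3)[of \<omega>] om by (auto simp: local_noise_def emp_err_def dev_def ez)
          have nL: "local_noise n (\<lambda>i. X i \<omega>) f\<^sub>0 x\<^sub>0 L (scale_noise \<kappa> \<alpha> L\<^sub>0 L)" if "L\<^sub>0 \<le> L" "L \<le> Z" for L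
            using A2(3)[of \<omega> L] om that L0 scale[of L] by (auto simp: local_noise_def emp_err_def dev_def)
          have D: "- (C * e) \<le> D n \<omega>" "D n \<omega> \<le> C * (e + L\<^sub>0 powr \<alpha>)"
            using bound lse L0 e1 nz nL unfolding error_controlled_def D_def by blast+
          define p where "p = real n powr (- (1 / 2))"
          define r where "r = real n powr (- (\<alpha> / (2 * \<alpha> + 1)))"
          have pr: "p \<le> r" unfolding p_def r_def using n(1) \<beta> by (intro powr_mono) auto
          have p0: "0 \<le> p" by (simp add: p_def)
          have Lr: "L\<^sub>0 powr \<alpha> = r" unfolding L\<^sub>0_def r_def powr_powr by (simp add: \<beta>_def)
          have e: "e = E * p" by (simp add: e_def p_def)
          have "C * e \<le> C * (E + 1) * p" using C p0 by (simp add: e algebra_simps)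
          moreover have "C * (E * p) \<le> C * (E * r)" using C E pr by (intro mult_left_mono) auto
          then have "C * (e + r) \<le> C * (E + 1) * r" by (simp add: e algebra_simps)
          moreover have "C * (E + 1) * p \<le> C * (E + 1) * r" using C E pr by (intro mult_left_mono) auto
          ultimately have "- (C * (E + 1) * p) \<le> D n \<omega>" "\<bar>D n \<omega>\<bar> \<le> C * (E + 1) * r"
            using D unfolding Lr by linarith+
          then show ?thesis by (simp add: p_def r_def)
        qed
        show ?case
          by (intro bexI[of _ "A1 \<union> A2 \<union> A3"] conjI ballI pA main) (use A1(1) A2(1) A3 in auto)
      qed
    qed
  qed
  show ?thesis
    unfolding D_def[symmetric]
  proof (intro conjI bigO_in_probI)
    fix \<epsilon> :: real assume "0 < \<epsilon>"
    from event[OF this] obtain C where C: "0 < C" and ev: "\<forall>\<^sub>F n in sequentially. \<exists>A\<in>sets M. prob A \<le> \<epsilon> \<and>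
      (\<forall>\<omega>\<in>space M - A. - (C * real n powr (- (1 / 2))) \<le> D n \<omega> \<and>
         \<bar>D n \<omega>\<bar> \<le> C * real n powr (- (\<alpha> / (2 * \<alpha> + 1))))" by blast
    have "\<forall>\<^sub>F n in sequentially. exp (exp 1) \<le> real n"
      using filterlim_real_sequentially unfolding filterlim_at_top by blast
    with ev have "\<forall>\<^sub>F n in sequentially. \<exists>A\<in>sets M. prob A \<le> \<epsilon> \<and>
      (\<forall>\<omega>\<in>space M - A. \<bar>\<bar>D n \<omega>\<bar>\<bar> \<le> C * (real n powr (- (\<alpha> / (2 * \<alpha> + 1))) * sqrt (ln (ln (real n)))))"
    proof eventually_elim
      case (elim n)
      have "0 < real n" using elim(2) by (smt (verit) exp_gt_zero)
      then have "exp 1 \<le> ln (real n)" using elim(2) by (simp add: ln_ge_iff)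
      \<comment> \<open>From exp (exp 1) on the additional factor is at least 1, so the sharper rate
        implies the stated one.\<close>
      then have "1 \<le> ln (ln (real n))" by (subst ln_ge_iff) (auto intro: less_le_trans[OF exp_gt_zero])
      then have "1 \<le> sqrt (ln (ln (real n)))" by simp
      then have "C * real n powr (- (\<alpha> / (2 * \<alpha> + 1))) * 1 \<le> C * real n powr (- (\<alpha> / (2 * \<alpha> + 1))) * sqrt (ln (ln (real n)))"
        using C by (intro mult_left_mono) auto
      then show ?case using elim(1) unfolding abs_abs mult.assoc mult_1_right by (blast intro: order_trans)
    qed
    then show "\<exists>C>0. \<forall>\<^sub>F n in sequentially. \<exists>A\<in>sets M. prob A \<le> \<epsilon> \<and>
      (\<forall>\<omega>\<in>space M - A. \<bar>\<bar>D n \<omega>\<bar>\<bar> \<le> C * (real n powr (- (\<alpha> / (2 * \<alpha> + 1))) * sqrt (ln (ln (real n)))))"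
      using C by blast
    from ev have "\<forall>\<^sub>F n in sequentially. \<exists>A\<in>sets M. prob A \<le> \<epsilon> \<and>
      (\<forall>\<omega>\<in>space M - A. \<bar>min (D n \<omega>) 0\<bar> \<le> C * real n powr (- (1 / 2)))"
    proof eventually_elim
      case (elim n)
      have "0 \<le> C * real n powr (- (1 / 2))" using C by simp
      then have "\<bar>min z 0\<bar> \<le> C * real n powr (- (1 / 2))" if "- (C * real n powr (- (1 / 2))) \<le> z" for z
        using that by (simp add: min_def abs_le_iff)
      then show ?case using elim by blast
    qed
    then show "\<exists>C>0. \<forall>\<^sub>F n in sequentially. \<exists>A\<in>sets M. prob A \<le> \<epsilon> \<and>
      (\<forall>\<omega>\<in>space M - A. \<bar>min (D n \<omega>) 0\<bar> \<le> C * real n powr (- (1 / 2)))"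
      using C by blast
  qed
qed

end
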